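(* Let $d\ge 3$ and, for $n\ge 2$, let $(\Psi_{\mathbb{T}_n^d}(\alpha))_{\alpha\in\mathbb{T}_n^d}$ be the zero-average Gaussian free field on the discrete torus $\mathbb{T}_n^d=(\mathbb{Z}/n\mathbb{Z})^d$, and let $N=n^d$. The maximum of the zero-average Gaussian free field on the torus belongs to the domain of attraction of the Gumbel distribution; in particular, for all $z\in\mathbb{R}$, $$\lim_{n\to\infty}P\left(\max_{\alpha\in\mathbb{T}_n^d}\Psi_{\mathbb{T}_n^d}(\alpha)\le a_Nz+b_N\right)=\exp(-e^{-z}).$$
   Context: Throughout $d\ge 3$. $\mathbb{T}_n^d=(\mathbb{Z}/n\mathbb{Z})^d$ and $\mathbb{Z}^d$ carry the usual nearest-neighbour graph structure. Green's function on $\mathbb{Z}^d$: $g_{\mathbb{Z}^d}(x,y)=\sum_{k=0}^\infty P_x^{\mathbb{Z}^d}[X_k=y]$, where $(X_k)_{k\ge 0}$ under $P_x^{\mathbb{Z}^d}$ is the discrete-time simple random walk on $\mathbb{Z}^d$ started at $x$ (finite since $d\ge3$). Zero-average Green's function: for $x,y\in\mathbb{T}_n^d$, $$G_{\mathbb{T}_n^d}(x,y)=\int_0^\infty\left(P_x^{\mathbb{T}_n^d}[\bar X_t=y]-\frac{1}{n^d}\right)dt,$$ where $(\bar X_t)_{t\ge 0}$ under $P_x^{\mathbb{T}_n^d}$ is the continuous-time simple random walk on $\mathbb{T}_n^d$ started at $x$ with i.i.d. $\operatorname{Exp}(1)$ holding times. It is finite, symmetric and positive semi-definite. The zero-average Gaussian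 free field $(\Psi_{\mathbb{T}_n^d}(x))_{x\in\mathbb{T}_n^d}$ is the centered Gaussian field with covariance $\mathbb{E}[\Psi_{\mathbb{T}_n^d}(x)\Psi_{\mathbb{T}_n^d}(y)]=G_{\mathbb{T}_n^d}(x,y)$; $P$ denotes its law. Normalizing constants: with $N=n^d$, $$b_N=\sqrt{g_{\mathbb{Z}^d}(0,0)}\left[\sqrt{2\log N}-\frac{\log\log N+\log 4\pi}{2\sqrt{2\log N}}\right],\qquad a_N=g_{\mathbb{Z}^d}(0,0)\,b_N^{-1}.$$ "Belongs to the domain of attraction of the Gumbel distribution" means that, after suitable centering and scaling, the maximum converges in distribution to the standard Gumbel law; the displayed limit is the precise form. *)

theory Defs
  imports "HOL-Probability.Probability"
begin

section \<open>Simple random walk on a locally finite graph\<close>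

text \<open>A graph is given by its neighbourhood function \<open>nbrs\<close>; the sets \<open>nbrs v\<close> must be finite and
  nonempty.  \<open>srw nbrs x\<close> is the law on path space of the discrete-time simple random walk started
  at \<open>x\<close>, obtained from the Ionescu-Tulcea theorem; the walk is the coordinate process.\<close>

definition srw_kernel :: "('v \<Rightarrow> 'v set) \<Rightarrow> 'v \<Rightarrow> nat \<Rightarrow> (nat \<Rightarrow> 'v) \<Rightarrow> 'v measure" where
  "srw_kernel nbrs x k \<omega> =
     measure_pmf (if k = 0 then return_pmf x else pmf_of_set (nbrs (\<omega> (k - 1))))"

definition srw :: "('v \<Rightarrow> 'v set) \<Rightarrow> 'v \<Rightarrow> (nat \<Rightarrow> 'v) measure" where
  "srw nbrs x = projective_family.lim UNIV
     (Ionescu_Tulcea.CI (srw_kernel nbrs x) (\<lambda>_. count_space UNIV)) (\<lambda>_. count_space UNIV)"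

lemma Ionescu_Tulcea_srw: "Ionescu_Tulcea (srw_kernel nbrs x) (\<lambda>_. count_space UNIV)"
proof (rule Ionescu_Tulcea.intro)
  fix k
  show "srw_kernel nbrs x k \<in>
      measurable (PiM {0..<k} (\<lambda>_. count_space UNIV)) (subprob_algebra (count_space UNIV))"
  proof (cases k)
    case 0
    have "measure_pmf (return_pmf x) \<in> space (subprob_algebra (count_space UNIV))"
      by (auto simp: space_subprob_algebra
          intro: prob_space_imp_subprob_space measure_pmf.prob_space_axioms)
    then show ?thesis
      using 0 by (simp add: srw_kernel_def [abs_def])
  next
    case (Suc j)
    have "(\<lambda>v. measure_pmf (pmf_of_set (nbrs v))) \<in>
        measurable (count_space UNIV) (subprob_algebra (count_space UNIV))"
      by (auto simp: space_subprob_algebra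
          intro: prob_space_imp_subprob_space measure_pmf.prob_space_axioms)
    moreover have "(\<lambda>\<omega>. \<omega> j) \<in> measurable (PiM {0..<k} (\<lambda>_. count_space UNIV)) (count_space UNIV)"
      using Suc by (intro measurable_component_singleton) auto
    ultimately show ?thesis
      using Suc by (simp add: srw_kernel_def [abs_def] measurable_compose)
  qed
qed (simp add: srw_kernel_def measure_pmf.prob_space_axioms)

lemma prob_space_srw: "prob_space (srw nbrs x)"
proof -
  interpret Ionescu_Tulcea "srw_kernel nbrs x" "\<lambda>_. count_space UNIV"
    by (rule Ionescu_Tulcea_srw)
  have "emeasure PF.lim (PF.emb UNIV {} (space (PiM {} (\<lambda>_. count_space UNIV)))) =
      emeasure (CI {}) (space (PiM {} (\<lambda>_. count_space UNIV)))"
    by (rule lim) auto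
  also have "\<dots> = 1"
    using prob_space.emeasure_space_1 [OF PF.prob_space_P [of "{}"]] by (simp add: CI_def)
  finally show ?thesis
    unfolding srw_def by (intro prob_spaceI) (simp add: prod_emb_def space_PiM restrict_def vimage_def)
qed

text \<open>The continuous-time walk stays at the \<open>k\<close>-th site \<open>\<omega> k\<close> of its jump chain for a holding time
  \<open>\<tau> k\<close>, the holding times being i.i.d. standard exponential and independent of the jump chain.\<close>

definition ctsrw :: "('v \<Rightarrow> 'v set) \<Rightarrow> 'v \<Rightarrow> ((nat \<Rightarrow> 'v) \<times> (nat \<Rightarrow> real)) measure" where
  "ctsrw nbrs x =
     srw nbrs x \<Otimes>\<^sub>M PiM UNIV (\<lambda>_::nat. density lborel (exponential_density 1))"

definition ctsrw_at :: "real \<Rightarrow> (nat \<Rightarrow> 'v) \<times> (nat \<Rightarrow> real) \<Rightarrow> 'v" where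
  "ctsrw_at t = (\<lambda>(\<omega>, \<tau>). \<omega> (LEAST k. t < (\<Sum>i\<le>k. \<tau> i)))"

section \<open>The lattice, the discrete torus and their Green's functions\<close>

definition lattice_nbrs :: "int ^ 'd \<Rightarrow> (int ^ 'd) set" where
  "lattice_nbrs x = {x + axis i s | i s. s = 1 \<or> s = -1}"

text \<open>The torus is represented by the residues \<open>0, \<dots>, n - 1\<close> in each coordinate.\<close>

definition torus :: "nat \<Rightarrow> (int ^ 'd) set" where
  "torus n = {x. \<forall>i. 0 \<le> x $ i \<and> x $ i < int n}"

definition torus_proj :: "nat \<Rightarrow> int ^ 'd \<Rightarrow> int ^ 'd" where
  "torus_proj n x = (\<chi> i. x $ i mod int n)"

definition torus_nbrs :: "nat \<Rightarrow> int ^ 'd \<Rightarrow> (int ^ 'd) set" where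
  "torus_nbrs n x = torus_proj n ` lattice_nbrs x"

definition green_lattice :: "int ^ 'd \<Rightarrow> int ^ 'd \<Rightarrow> real" where
  "green_lattice x y = (\<Sum>k. \<P>(\<omega> in srw lattice_nbrs x. \<omega> k = y))"

definition green_torus :: "nat \<Rightarrow> int ^ 'd \<Rightarrow> int ^ 'd \<Rightarrow> real" where
  "green_torus n x y =
     (LINT t:{0..}|lborel. \<P>(p in ctsrw (torus_nbrs n) x. ctsrw_at t p = y) - 1 / real n ^ CARD('d))"

section \<open>Gaussian fields\<close>

text \<open>The point mass at 0 counts as a centered Gaussian law; it has to be treated separately because
  \<open>normal_density 0 0\<close> is identically 0.\<close>

definition centered_gaussian :: "'w measure \<Rightarrow> ('w \<Rightarrow> real) \<Rightarrow> bool" where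
  "centered_gaussian M X \<longleftrightarrow> X \<in> borel_measurable M \<and>
     (distr M borel X = return borel 0 \<or>
      (\<exists>\<sigma>>0. distr M borel X = density lborel (normal_density 0 \<sigma>)))"

definition centered_gaussian_field ::
    "'w measure \<Rightarrow> 'v set \<Rightarrow> ('v \<Rightarrow> 'v \<Rightarrow> real) \<Rightarrow> ('v \<Rightarrow> 'w \<Rightarrow> real) \<Rightarrow> bool" where
  "centered_gaussian_field M V K \<Psi> \<longleftrightarrow> prob_space M \<and>
     (\<forall>c. centered_gaussian M (\<lambda>\<omega>. \<Sum>x\<in>V. c x * \<Psi> x \<omega>)) \<and>
     (\<forall>x\<in>V. \<forall>y\<in>V. prob_space.expectation M (\<lambda>\<omega>. \<Psi> x \<omega> * \<Psi> y \<omega>) = K x y)"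

definition zero_average_gff :: "nat \<Rightarrow> 'w measure \<Rightarrow> (int ^ 'd \<Rightarrow> 'w \<Rightarrow> real) \<Rightarrow> bool" where
  "zero_average_gff n M \<Psi> \<longleftrightarrow> centered_gaussian_field M (torus n) (green_torus n) \<Psi>"

section \<open>Gumbel limits and normalizing constants\<close>

definition gumbel :: "real measure" where
  "gumbel = interval_measure (\<lambda>z. exp (- exp (- z)))"

definition gumbel_domain_of_attraction :: "(nat \<Rightarrow> 'w measure) \<Rightarrow> (nat \<Rightarrow> 'w \<Rightarrow> real) \<Rightarrow> bool" where
  "gumbel_domain_of_attraction M Z \<longleftrightarrow> (\<exists>a b. (\<forall>n. a n > 0) \<and>
     weak_conv_m (\<lambda>n. distr (M n) borel (\<lambda>\<omega>. (Z n \<omega> - b n) / a n)) gumbel)"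

text \<open>In the constants below, \<open>g\<close> stands for the lattice Green's function at the origin.\<close>

definition b_const :: "real \<Rightarrow> real \<Rightarrow> real" where
  "b_const g N =
     sqrt g * (sqrt (2 * ln N) - (ln (ln N) + ln (4 * pi)) / (2 * sqrt (2 * ln N)))"

definition a_const :: "real \<Rightarrow> real \<Rightarrow> real" where
  "a_const g N = g / b_const g N"

end

theory Submission
  imports Defs "HOL-Real_Asymp.Real_Asymp"
begin

text \<open>The number of sites where the field exceeds a high level \<open>u\<close> is asymptotically Poisson, so the
maximum stays below \<open>u\<close> with probability close to \<open>exp (- \<lambda>)\<close>, where \<open>\<lambda>\<close> is the expected number of
exceedances; for \<open>u = a\<^sub>N z + b\<^sub>N\<close> the Gaussian tail asymptotics give \<open>\<lambda> \<longlonglongrightarrow> exp (- z)\<close>.  This needs three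
facts about the covariance: the variance converges to the lattice Green's function \<open>g\<close> faster than
\<open>1 / ln N\<close>, the covariance of distinct sites stays a fixed amount below the variance, and it is
polynomially small outside a box whose volume is a small power of \<open>N\<close>.

Covariance.  Every torus quantity is a sum over characters: with \<open>\<phi>\<close> the eigenvalue of the
transition operator at frequency \<open>\<xi>\<close>, the \<open>k\<close>-step transition probability is the average of
\<open>\<phi>(\<xi>)\<^sup>k cos (\<xi> \<cdot> (x - y))\<close>, and the Green's function is the same sum with \<open>1 / (1 - \<phi>(\<xi>))\<close> and without
\<open>\<xi> = 0\<close> (\<open>green_torus_fourier\<close>).  Subtracting the first \<open>m \<le> n\<close> transition probabilities leaves,
up to \<open>m / N\<close>, the terms \<open>\<phi>\<^sup>m / (1 - \<phi>)\<close>, whose average is \<open>O(1 / sqrt m)\<close> uniformly in the torus and in the two points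
(\<open>green_torus_partial_sum\<close>); the estimate rests on the decay of the average of \<open>\<bar>\<phi>\<bar>\<^sup>k\<close>, which is
bounded by a product of one-dimensional sums (\<open>heat_abs_decay\<close>).  A walk of fewer than \<open>n\<close> steps does
not notice the torus, so the first \<open>n\<close> return probabilities coincide with those on the lattice and
the variance differs from \<open>g\<close> by \<open>O(1 / sqrt n)\<close>; a walk of fewer than \<open>m\<close> steps does not leave the box
of radius \<open>m\<close>, so outside that box the covariance is \<open>O(1 / sqrt m)\<close>.  The gap
\<open>G(x,x) - G(x,y) \<ge> 1/2\<close> follows from \<open>1 - \<phi> \<le> 2\<close> and the orthogonality of characters.

Poisson approximation.  For events \<open>A\<^sub>i\<close> of probability \<open>p\<close> consider
\<open>\<psi>(s) = E (\<Prod>\<^sub>i (1 - s 1\<^sub>A\<^sub>i))\<close>, which runs from \<open>1\<close> at \<open>s = 0\<close> to the void probability at \<open>s = 1\<close>.  If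
every \<open>A\<^sub>i\<close> is nearly uncorrelated with the product, then \<open>\<psi>' \<approx> - \<lambda> \<psi>\<close> and hence \<open>\<psi>(1) \<approx> exp (- \<lambda>)\<close>
(\<open>void_probability_poisson\<close>).  For a Gaussian vector with covariance \<open>K\<close> and \<open>A\<^sub>i = {X\<^sub>i > u}\<close>, the
factors of sites near \<open>i\<close> are dropped, and at far sites \<open>X\<^sub>j\<close> is replaced by the residual
\<open>X\<^sub>j - (K\<^sub>i\<^sub>j / K\<^sub>i\<^sub>i) X\<^sub>i\<close>; all residuals together are independent of \<open>X\<^sub>i\<close>, and the replacement
matters only if \<open>X\<^sub>j\<close> lies very close to the level (\<open>gaussian_void_probability\<close>).  Since only linear
combinations of the field are known to be Gaussian, this independence is extracted from
characteristic functions, one coordinate at a time (\<open>char_factor_imp_product_factor\<close>).\<close>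

section \<open>The law of the walk at a fixed time\<close>

primrec walk_pmf :: "('v \<Rightarrow> 'v set) \<Rightarrow> 'v \<Rightarrow> nat \<Rightarrow> 'v pmf" where
  "walk_pmf nbrs x 0 = return_pmf x"
| "walk_pmf nbrs x (Suc k) = bind_pmf (walk_pmf nbrs x k) (\<lambda>v. pmf_of_set (nbrs v))"

lemma sets_srw [measurable_cong]: "sets (srw nbrs x) = sets (PiM UNIV (\<lambda>_::nat. count_space UNIV))"
proof -
  interpret Ionescu_Tulcea "srw_kernel nbrs x" "\<lambda>_. count_space UNIV"
    by (rule Ionescu_Tulcea_srw)
  show ?thesis unfolding srw_def by (rule PF.sets_lim)
qed

text \<open>On finite initial segments the path measure is the iterated composition of the transition
kernels.  Integrating a function of the last coordinate against it obeys the recursion that defines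
\<open>walk_pmf\<close>.\<close>

lemma srw_marginal:
  "measure (srw nbrs x) {\<omega> \<in> space (srw nbrs x). \<omega> k = y} = pmf (walk_pmf nbrs x k) y"
proof -
  interpret Ionescu_Tulcea "srw_kernel nbrs x" "\<lambda>_. count_space UNIV"
    by (rule Ionescu_Tulcea_srw)
  let ?M = "\<lambda>_::nat. count_space (UNIV :: 'a set)"
  let ?u = "\<lambda>_::nat. undefined :: 'a"
  have u: "?u \<in> space (PiM {0..<0} ?M)" by (simp add: space_PiM PiE_def)
  have mg: "(\<lambda>\<omega>. g (\<omega> k)) \<in> borel_measurable (PiM {0..<Suc k} ?M)" for g :: "'a \<Rightarrow> ennreal" and k
    by (rule measurable_compose[OF measurable_component_singleton]) auto
  have key: "(\<integral>\<^sup>+\<omega>. g (\<omega> k) \<partial>C 0 (Suc k) ?u) = (\<integral>\<^sup>+v. g v \<partial>walk_pmf nbrs x k)" for g :: "'a \<Rightarrow> ennreal"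
  proof (induction k arbitrary: g)
    case 0
    have "(\<integral>\<^sup>+\<omega>. g (\<omega> 0) \<partial>C 0 (Suc 0) ?u) = (\<integral>\<^sup>+\<omega>. \<integral>\<^sup>+\<omega>'. g (\<omega>' 0) \<partial>eP 0 \<omega> \<partial>C 0 0 ?u)"
      using mg[of g 0] measurable_eP[of 0]
      by (simp only: C.simps add_0) (subst nn_integral_bind[where B="PiM {0..<Suc 0} ?M"]; simp)
    also have "\<dots> = (\<integral>\<^sup>+\<omega>. \<integral>\<^sup>+v. g v \<partial>srw_kernel nbrs x 0 \<omega> \<partial>C 0 0 ?u)"
    proof (rule nn_integral_cong)
      fix \<omega> assume "\<omega> \<in> space (C 0 0 ?u)"
      then have "\<omega> \<in> space (PiM {0..<0} ?M)" by simp
      from nn_integral_eP[OF this mg[of g 0]]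
      show "(\<integral>\<^sup>+\<omega>'. g (\<omega>' 0) \<partial>eP 0 \<omega>) = (\<integral>\<^sup>+v. g v \<partial>srw_kernel nbrs x 0 \<omega>)" by simp
    qed
    also have "\<dots> = (\<integral>\<^sup>+v. g v \<partial>return_pmf x)"
      using u by (simp add: srw_kernel_def nn_integral_return)
    finally show ?case by simp
  next
    case (Suc k)
    have m: "eP (Suc k) \<in> measurable (C 0 (Suc k) ?u) (subprob_algebra (PiM {0..<Suc (Suc k)} ?M))"
      using measurable_eP[of "Suc k"] sets_C[OF u, of "Suc k"] by (simp cong: measurable_cong_sets)
    have "(\<integral>\<^sup>+\<omega>. g (\<omega> (Suc k)) \<partial>C 0 (Suc (Suc k)) ?u) = (\<integral>\<^sup>+\<omega>. \<integral>\<^sup>+\<omega>'. g (\<omega>' (Suc k)) \<partial>eP (Suc k) \<omega> \<partial>C 0 (Suc k) ?u)"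
      unfolding C.simps(2)[of 0 "Suc k"] add_0
      by (rule nn_integral_bind[OF mg m])
    also have "\<dots> = (\<integral>\<^sup>+\<omega>. \<integral>\<^sup>+v. g v \<partial>srw_kernel nbrs x (Suc k) \<omega> \<partial>C 0 (Suc k) ?u)"
    proof (rule nn_integral_cong)
      fix \<omega> assume "\<omega> \<in> space (C 0 (Suc k) ?u)"
      then have "\<omega> \<in> space (PiM {0..<Suc k} ?M)" using space_C[OF u, of "Suc k"] by simp
      from nn_integral_eP[OF this mg[of g "Suc k"]]
      show "(\<integral>\<^sup>+\<omega>'. g (\<omega>' (Suc k)) \<partial>eP (Suc k) \<omega>) = (\<integral>\<^sup>+v. g v \<partial>srw_kernel nbrs x (Suc k) \<omega>)" by simp
    qed
    also have "\<dots> = (\<integral>\<^sup>+\<omega>. (\<lambda>v. \<integral>\<^sup>+w. g w \<partial>pmf_of_set (nbrs v)) (\<omega> k) \<partial>C 0 (Suc k) ?u)"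
      by (simp add: srw_kernel_def)
    also have "\<dots> = (\<integral>\<^sup>+v. \<integral>\<^sup>+w. g w \<partial>pmf_of_set (nbrs v) \<partial>walk_pmf nbrs x k)"
      by (rule Suc.IH)
    also have "\<dots> = (\<integral>\<^sup>+v. g v \<partial>walk_pmf nbrs x (Suc k))"
      by (simp add: nn_integral_bind_pmf)
    finally show ?case .
  qed
  let ?X = "{f \<in> space (PiM {k} ?M). f k = y}"
  have X: "?X \<in> sets (PiM {k} ?M)" by measurable
  have "{\<omega> \<in> space (srw nbrs x). \<omega> k = y} = PF.emb UNIV {k} ?X"
    unfolding srw_def PF.space_lim by (auto simp: prod_emb_def space_PiM)
  then have "emeasure (srw nbrs x) {\<omega> \<in> space (srw nbrs x). \<omega> k = y} = emeasure (CI {k}) ?X"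
    unfolding srw_def using lim[OF _ X] by simp
  also have "\<dots> = emeasure (C 0 (Suc k) ?u) (PF.emb {0..<Suc k} {k} ?X)"
    by (rule emeasure_CI[OF _ X]) auto
  also have "PF.emb {0..<Suc k} {k} ?X = {\<omega>\<in>space (C 0 (Suc k) ?u). \<omega> k = y}"
    using space_C[OF u, of "Suc k"] by (auto simp: prod_emb_def space_PiM PiE_iff extensional_def simp del: C.simps)
  also have "emeasure (C 0 (Suc k) ?u) \<dots> = (\<integral>\<^sup>+\<omega>. indicator {y} (\<omega> k) \<partial>C 0 (Suc k) ?u)"
  proof -
    have S: "{\<omega>\<in>space (C 0 (Suc k) ?u). \<omega> k = y} \<in> sets (C 0 (Suc k) ?u)"
      unfolding sets_C[OF u] space_C[OF u] by measurable
    show ?thesis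
      unfolding nn_integral_indicator[OF S, symmetric]
      by (rule nn_integral_cong) (simp add: indicator_def del: C.simps)
  qed
  also have "\<dots> = ennreal (pmf (walk_pmf nbrs x k) y)"
    unfolding key by (simp add: emeasure_pmf_single)
  finally show ?thesis by (simp add: measure_def)
qed

definition holding_times :: "(nat \<Rightarrow> real) measure" where
  "holding_times = PiM UNIV (\<lambda>_::nat. density lborel (exponential_density 1))"

lemma prob_space_holding_times: "prob_space holding_times"
  unfolding holding_times_def
  by (intro prob_space_PiM prob_space_exponential_density) simp

lemma sets_holding_times [measurable_cong]: "sets holding_times = sets (PiM UNIV (\<lambda>_::nat. borel :: real measure))"
  unfolding holding_times_def by (rule sets_PiM_cong) auto

lemma holding_times_component:
  "distr holding_times borel (\<lambda>\<tau>. \<tau> i) = density lborel (exponential_density 1)"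
proof -
  have "distr holding_times borel (\<lambda>\<tau>. \<tau> i) = distr holding_times (density lborel (exponential_density 1)) (\<lambda>\<tau>. \<tau> i)"
    by (rule distr_cong) auto
  also have "\<dots> = density lborel (exponential_density 1)"
    unfolding holding_times_def
    by (rule distr_PiM_component) (auto intro: prob_space_exponential_density)
  finally show ?thesis .
qed

lemma holding_times_sum:
  "distributed holding_times lborel (\<lambda>\<tau>. \<Sum>i\<le>k. \<tau> i) (erlang_density k 1)"
proof -
  interpret prob_space holding_times by (rule prob_space_holding_times)
  have d: "distributed holding_times lborel (\<lambda>\<tau>. \<tau> i) (exponential_density 1)" for i
  proof -
    have "distr holding_times lborel (\<lambda>\<tau>. \<tau> i) = distr holding_times borel (\<lambda>\<tau>. \<tau> i)"
      by (rule distr_cong) auto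
    then show ?thesis
      unfolding distributed_def using holding_times_component[of i] by simp
  qed
  have "indep_vars (\<lambda>_. borel) (\<lambda>i \<tau>. \<tau> i :: real) UNIV"
  proof (subst indep_vars_iff_distr_eq_PiM')
    have "distr holding_times (PiM UNIV (\<lambda>_. borel)) (\<lambda>x. \<lambda>i\<in>UNIV. x i) = distr holding_times holding_times (\<lambda>x. x)"
      by (rule distr_cong) (auto simp: sets_holding_times)
    also have "\<dots> = holding_times" by (simp add: distr_id)
    also have "\<dots> = PiM UNIV (\<lambda>i. distr holding_times borel (\<lambda>\<tau>. \<tau> i))"
      unfolding holding_times_component by (simp add: holding_times_def)
    finally show "distr holding_times (PiM UNIV (\<lambda>_. borel)) (\<lambda>x. \<lambda>i\<in>UNIV. x i) =
      PiM UNIV (\<lambda>i. distr holding_times borel (\<lambda>\<tau>. \<tau> i))" .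
  qed auto
  then have "indep_vars (\<lambda>_. borel) (\<lambda>i \<tau>. \<tau> i :: real) {..k}"
    by (rule indep_vars_subset) auto
  from exponential_distributed_sum[OF _ _ _ d this] show ?thesis by simp
qed

lemma holding_times_nonneg: "AE \<tau> in holding_times. \<forall>i. 0 \<le> \<tau> i"
proof -
  have "AE x in density lborel (exponential_density 1). 0 \<le> (x::real)"
    by (subst AE_density) (auto simp: exponential_density_def)
  then show ?thesis unfolding AE_all_countable holding_times_def
    by (auto intro!: AE_PiM_component prob_space_exponential_density)
qed

definition jump_count :: "real \<Rightarrow> (nat \<Rightarrow> real) \<Rightarrow> nat" where
  "jump_count t \<tau> = (LEAST k. t < (\<Sum>i\<le>k. \<tau> i))"

lemma measurable_jump_count [measurable]: "jump_count t \<in> measurable holding_times (count_space UNIV)"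
  unfolding jump_count_def[abs_def] by measurable

text \<open>Almost surely the partial sums of the holding times increase past \<open>t\<close>, so \<open>k\<close> or fewer jumps
have occurred by time \<open>t\<close> exactly if the first \<open>k + 1\<close> holding times sum to more than \<open>t\<close>.  That sum
has an Erlang distribution, whose tail is a partial sum of Poisson weights.  Where all partial sums
stay below \<open>t\<close>, \<open>LEAST\<close> denotes an unspecified number, but this happens with probability zero.\<close>

lemma jump_count_poisson:
  assumes t: "0 \<le> t"
  shows "measure holding_times {\<tau> \<in> space holding_times. jump_count t \<tau> = k} = exp (- t) * t ^ k / fact k"
proof -
  interpret prob_space holding_times by (rule prob_space_holding_times)
  define Q where "Q = (\<lambda>k. \<Sum>n\<le>k. exp (- t) * t ^ n / fact n)"
  have gt: "prob {\<tau> \<in> space holding_times. t < (\<Sum>i\<le>k. \<tau> i)} = Q k" for k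
    using erlang_distributed_gt[OF holding_times_sum[of k], of t] t
    by (simp add: erlang_CDF_def Q_def mult.commute)
  have Qlim: "Q \<longlonglongrightarrow> 1"
  proof -
    have "(\<lambda>n. exp (- t) * (t ^ n /\<^sub>R fact n)) sums (exp (- t) * exp t)"
      by (intro sums_mult exp_converges)
    then have "(\<lambda>n. exp (- t) * t ^ n / fact n) sums 1"
      by (simp add: divide_inverse mult_ac flip: exp_add)
    then show ?thesis unfolding sums_def_le Q_def .
  qed
  have ex: "AE \<tau> in holding_times. \<exists>k. t < (\<Sum>i\<le>k. \<tau> i)"
  proof -
    let ?N = "{\<tau> \<in> space holding_times. \<not> (\<exists>k. t < (\<Sum>i\<le>k. \<tau> i))}"
    have [measurable]: "?N \<in> sets holding_times" by measurable
    have "prob ?N \<le> 1 - Q k" for k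
    proof -
      have [measurable]: "{\<tau> \<in> space holding_times. t < (\<Sum>i\<le>k. \<tau> i)} \<in> sets holding_times" by measurable
      have "prob ?N \<le> prob (space holding_times - {\<tau> \<in> space holding_times. t < (\<Sum>i\<le>k. \<tau> i)})"
        by (rule finite_measure_mono) auto
      then show ?thesis using gt[of k] by (simp add: prob_compl)
    qed
    then have "prob ?N \<le> 1 - 1"
      by (intro LIMSEQ_le_const[OF tendsto_diff[OF tendsto_const Qlim]]) auto
    then have "prob ?N = 0" using measure_nonneg[of holding_times ?N] by linarith
    then show ?thesis using AE_iff_measurable[of ?N holding_times "\<lambda>\<tau>. \<exists>k. t < (\<Sum>i\<le>k. \<tau> i)"]
      by (simp add: emeasure_eq_measure)
  qed
  have le: "prob {\<tau> \<in> space holding_times. jump_count t \<tau> \<le> k} = Q k" for k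
    unfolding gt[symmetric]
  proof (rule finite_measure_eq_AE)
    show "AE \<tau> in holding_times. (\<tau> \<in> {\<tau> \<in> space holding_times. jump_count t \<tau> \<le> k}) =
      (\<tau> \<in> {\<tau> \<in> space holding_times. t < (\<Sum>i\<le>k. \<tau> i)})"
      using ex holding_times_nonneg
    proof eventually_elim
      case (elim \<tau>)
      have "jump_count t \<tau> \<le> k \<longleftrightarrow> t < (\<Sum>i\<le>k. \<tau> i)"
      proof
        assume "jump_count t \<tau> \<le> k"
        moreover have "t < (\<Sum>i\<le>jump_count t \<tau>. \<tau> i)"
          unfolding jump_count_def using elim(1) by (rule LeastI_ex)
        ultimately show "t < (\<Sum>i\<le>k. \<tau> i)"
          using sum_mono2[of "{..k}" "{..jump_count t \<tau>}" \<tau>] elim(2) by (auto intro: less_le_trans)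
      next
        assume "t < (\<Sum>i\<le>k. \<tau> i)"
        then show "jump_count t \<tau> \<le> k" unfolding jump_count_def by (rule Least_le)
      qed
      then show ?case by simp
    qed
  qed measurable
  show ?thesis
  proof (cases k)
    case 0
    then show ?thesis using le[of 0] by (simp add: Q_def)
  next
    case (Suc j)
    have "{\<tau> \<in> space holding_times. jump_count t \<tau> = k} = {\<tau> \<in> space holding_times. jump_count t \<tau> \<le> k} - {\<tau> \<in> space holding_times. jump_count t \<tau> \<le> j}"
      using Suc by auto
    also have "prob \<dots> = Q k - Q j"
      unfolding le[symmetric] by (rule finite_measure_Diff) (use Suc in auto)
    finally show ?thesis using Suc by (simp add: Q_def)
  qed
qed

text \<open>The jump chain is independent of the number of jumps up to time \<open>t\<close>.\<close>

lemma ctsrw_at_sums: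
  assumes t: "0 \<le> t"
  shows "(\<lambda>k. exp (- t) * t ^ k / fact k * pmf (walk_pmf nbrs x k) y) sums
    measure (ctsrw nbrs x) {p \<in> space (ctsrw nbrs x). ctsrw_at t p = y}"
proof -
  let ?S = "srw nbrs x" and ?E = "holding_times"
  interpret S: prob_space ?S by (rule prob_space_srw)
  interpret E: prob_space ?E by (rule prob_space_holding_times)
  interpret SE: pair_prob_space ?S ?E ..
  have C: "ctsrw nbrs x = ?S \<Otimes>\<^sub>M ?E" by (simp add: ctsrw_def holding_times_def)
  define A where "A = (\<lambda>k. {\<omega> \<in> space ?S. \<omega> k = y} \<times> {\<tau> \<in> space ?E. jump_count t \<tau> = k})"
  have m1[measurable]: "{\<omega> \<in> space ?S. \<omega> k = y} \<in> sets ?S" for k by measurable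
  have m2[measurable]: "{\<tau> \<in> space ?E. jump_count t \<tau> = k} \<in> sets ?E" for k by measurable
  have "(\<lambda>k. SE.prob (A k)) sums SE.prob (\<Union>k. A k)"
    by (rule SE.finite_measure_UNION) (auto simp: A_def disjoint_family_on_def)
  moreover have "(\<Union>k. A k) = {p \<in> space (ctsrw nbrs x). ctsrw_at t p = y}"
    by (auto simp: A_def C space_pair_measure ctsrw_at_def jump_count_def)
  moreover have "SE.prob (A k) = exp (- t) * t ^ k / fact k * pmf (walk_pmf nbrs x k) y" for k
    unfolding A_def jump_count_poisson[OF t, symmetric] srw_marginal[symmetric]
    using E.emeasure_pair_measure_Times[OF m1 m2, of k k]
    by (simp add: measure_def enn2real_mult mult.commute)
  ultimately show ?thesis by (simp add: C)
qed

section \<open>Walks on the torus as projected lattice walks, and their Fourier expansion\<close>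

definition unit_steps :: "(int ^ 'd) set" where
  "unit_steps = range (\<lambda>i. axis i 1) \<union> range (\<lambda>i. axis i (-1))"

definition phase :: "('d::finite \<Rightarrow> real) \<Rightarrow> int ^ 'd \<Rightarrow> real" where
  "phase \<theta> w = (\<Sum>i\<in>UNIV. \<theta> i * of_int (w $ i))"

text \<open>The eigenvalue of the transition operator of simple random walk at the character of
frequency \<open>\<theta>\<close>.\<close>

definition mean_cos :: "('d::finite \<Rightarrow> real) \<Rightarrow> real" where
  "mean_cos \<theta> = (\<Sum>i\<in>UNIV. cos (\<theta> i)) / CARD('d)"

lemma phase_add: "phase \<theta> (v + w) = phase \<theta> v + phase \<theta> w"
  by (simp add: phase_def algebra_simps sum.distrib)

lemma phase_axis: "phase \<theta> (axis i s) = \<theta> i * of_int s"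
proof -
  have "phase \<theta> (axis i s) = (\<Sum>j\<in>UNIV. if j = i then \<theta> i * of_int s else 0)"
    unfolding phase_def by (intro sum.cong) (auto simp: axis_def)
  then show ?thesis by simp
qed

lemma lattice_nbrs_eq: "lattice_nbrs x = (+) x ` unit_steps"
  by (auto simp: lattice_nbrs_def unit_steps_def)

lemma finite_unit_steps [simp]: "finite (unit_steps :: (int ^ 'd) set)" 
  and unit_steps_nonempty [simp]: "unit_steps \<noteq> ({} :: (int ^ 'd) set)"
  by (auto simp: unit_steps_def)

lemma finite_lattice_nbrs [simp]: "finite (lattice_nbrs x)" 
  and lattice_nbrs_nonempty [simp]: "lattice_nbrs x \<noteq> {}"
  by (auto simp: lattice_nbrs_eq)

lemma sum_unit_steps:
  fixes f :: "int ^ 'd \<Rightarrow> real"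
  shows "(\<Sum>z\<in>unit_steps. f z) = (\<Sum>i\<in>UNIV. f (axis i 1) + f (axis i (-1)))"
proof -
  have inj: "inj (\<lambda>i. axis i s :: int ^ 'd)" if "s \<noteq> 0" for s
    using that by (auto simp: inj_def axis_eq_axis)
  have "(\<Sum>z\<in>unit_steps. f z) = (\<Sum>z\<in>range (\<lambda>i. axis i 1). f z) + (\<Sum>z\<in>range (\<lambda>i. axis i (-1)). f z)"
    unfolding unit_steps_def by (rule sum.union_disjoint) (auto simp: axis_eq_axis)
  then show ?thesis using inj[of 1] inj[of "-1"] by (simp add: sum.reindex sum.distrib)
qed

lemma card_unit_steps: "card (unit_steps :: (int ^ 'd) set) = 2 * CARD('d)"
proof -
  have "real (card (unit_steps :: (int ^ 'd) set)) = real (2 * CARD('d))"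
    using sum_unit_steps[of "\<lambda>_ :: int ^ 'd. 1 :: real"] by simp
  then show ?thesis by (simp only: of_nat_eq_iff)
qed

lemma pmf_of_set_lattice_nbrs: "pmf_of_set (lattice_nbrs w) = map_pmf ((+) w) (pmf_of_set unit_steps)"
  unfolding lattice_nbrs_eq by (subst map_pmf_of_set_inj) auto

lemma finite_set_walk_lattice: "finite (set_pmf (walk_pmf lattice_nbrs x k))"
  by (induction k) auto

lemma lattice_walk_range: "w \<in> set_pmf (walk_pmf lattice_nbrs 0 k) \<Longrightarrow> \<bar>w $ i\<bar> \<le> int k"
proof (induction k arbitrary: w)
  case (Suc k)
  then obtain v where v: "v \<in> set_pmf (walk_pmf lattice_nbrs 0 k)" and "w \<in> lattice_nbrs v"
    by auto
  then obtain z where z: "z \<in> unit_steps" and w: "w = v + z" by (auto simp: lattice_nbrs_eq)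
  have "\<bar>z $ i\<bar> \<le> 1" using z by (auto simp: unit_steps_def axis_def)
  then show ?case using Suc.IH[OF v] w by simp
qed simp

text \<open>Averaging over opposite steps, \<open>cos (X + \<theta>\<^sub>i) + cos (X - \<theta>\<^sub>i) = 2 cos X cos \<theta>\<^sub>i\<close>, so every step
contributes one factor \<open>mean_cos \<theta>\<close>.  The shift \<open>a\<close> makes the cosines suffice: they play the role of
both the real and the imaginary part of a character.\<close>

lemma lattice_walk_cos:
  "measure_pmf.expectation (walk_pmf lattice_nbrs 0 k) (\<lambda>w. cos (phase \<theta> w + a)) = mean_cos \<theta> ^ k * cos a"
proof (induction k arbitrary: a)
  case 0
  show ?case by (simp add: phase_def)
next
  case (Suc k)
  let ?p = "walk_pmf lattice_nbrs (0 :: int ^ 'a) k"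
  have step: "measure_pmf.expectation (pmf_of_set (lattice_nbrs v)) (\<lambda>w. cos (phase \<theta> w + a)) = mean_cos \<theta> * cos (phase \<theta> v + a)" for v
  proof -
    have "measure_pmf.expectation (pmf_of_set (lattice_nbrs v)) (\<lambda>w. cos (phase \<theta> w + a)) =
      (\<Sum>z\<in>unit_steps. cos (phase \<theta> (v + z) + a)) / card (unit_steps :: (int ^ 'a) set)"
      unfolding pmf_of_set_lattice_nbrs by (simp add: integral_pmf_of_set)
    also have "(\<Sum>z\<in>unit_steps. cos (phase \<theta> (v + z) + a)) = 
      (\<Sum>i\<in>UNIV. cos ((phase \<theta> v + a) + \<theta> i) + cos ((phase \<theta> v + a) - \<theta> i))"
      unfolding sum_unit_steps phase_add phase_axis by (intro sum.cong) (auto simp: algebra_simps)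
    also have "\<dots> = (\<Sum>i\<in>UNIV. 2 * cos (phase \<theta> v + a) * cos (\<theta> i))"
    proof (intro sum.cong refl)
      show "cos (X + \<theta> i) + cos (X - \<theta> i) = 2 * cos X * cos (\<theta> i)" for X i
        by (simp add: cos_add cos_diff)
    qed
    also have "\<dots> / card (unit_steps :: (int ^ 'a) set) = mean_cos \<theta> * cos (phase \<theta> v + a)"
      by (simp add: card_unit_steps mean_cos_def flip: sum_distrib_left)
    finally show ?thesis .
  qed
  have "measure_pmf.expectation (walk_pmf lattice_nbrs 0 (Suc k)) (\<lambda>w. cos (phase \<theta> w + a)) =
     (\<Sum>v\<in>set_pmf ?p. pmf ?p v *\<^sub>R (mean_cos \<theta> * cos (phase \<theta> v + a)))"
    unfolding walk_pmf.simps
    by (subst pmf_expectation_bind[of "set_pmf ?p"]) (auto simp: finite_set_walk_lattice step)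
  also have "\<dots> = mean_cos \<theta> * (\<Sum>v\<in>set_pmf ?p. pmf ?p v *\<^sub>R cos (phase \<theta> v + a))"
    by (simp add: sum_distrib_left mult_ac)
  also have "(\<Sum>v\<in>set_pmf ?p. pmf ?p v *\<^sub>R cos (phase \<theta> v + a)) = measure_pmf.expectation ?p (\<lambda>w. cos (phase \<theta> w + a))"
    by (rule integral_measure_pmf[symmetric]) (auto simp: finite_set_walk_lattice)
  finally show ?case using Suc.IH[of a] by simp
qed

lemma torus_proj_cong_iff:
  "torus_proj n v = torus_proj n v' \<longleftrightarrow> (\<forall>i. int n dvd (v - v') $ i)"
  unfolding torus_proj_def vec_eq_iff vec_lambda_beta mod_eq_dvd_iff vector_minus_component ..

lemma torus_proj_add: "torus_proj n (torus_proj n v + w) = torus_proj n (v + w)"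
  unfolding torus_proj_def vec_eq_iff vec_lambda_beta vector_add_component mod_add_left_eq by simp

lemma torus_proj_id: "x \<in> torus n \<Longrightarrow> torus_proj n x = x"
  unfolding torus_proj_def torus_def vec_eq_iff vec_lambda_beta by (auto intro: mod_pos_pos_trivial)

lemma torus_proj_eq_iff:
  assumes "y \<in> torus n"
  shows "torus_proj n v = y \<longleftrightarrow> (\<forall>i. int n dvd (v - y) $ i)"
  using torus_proj_cong_iff[of n v y] unfolding torus_proj_id[OF assms] .

text \<open>For \<open>n \<ge> 3\<close> the projection is injective on the \<open>2 d\<close> neighbours of a site, so a uniformly
chosen torus neighbour is the projection of a uniformly chosen lattice neighbour.\<close>

lemma walk_torus_eq_map_lattice:
  assumes n: "n \<ge> 3" and x: "x \<in> torus n"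
  shows "walk_pmf (torus_nbrs n) x k = map_pmf (\<lambda>w. torus_proj n (x + w)) (walk_pmf lattice_nbrs 0 k)"
proof (induction k)
  case 0
  show ?case using x by (simp add: torus_proj_id)
next
  case (Suc k)
  have step: "pmf_of_set (torus_nbrs n (torus_proj n (x + w))) = map_pmf (\<lambda>w'. torus_proj n (x + w')) (pmf_of_set (lattice_nbrs w))" for w
  proof -
    have inj: "inj_on (\<lambda>w'. torus_proj n (x + w')) (lattice_nbrs w)"
    proof (rule inj_onI)
      fix v v' assume "v \<in> lattice_nbrs w" "v' \<in> lattice_nbrs w" "torus_proj n (x + v) = torus_proj n (x + v')"
      then obtain z z' where z: "z \<in> unit_steps" "z' \<in> unit_steps" and v: "v = w + z" "v' = w + z'"
        and dvd: "\<forall>i. int n dvd (z - z') $ i"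
        by (auto simp: lattice_nbrs_eq torus_proj_cong_iff)
      have "(z - z') $ i = 0" for i
      proof (rule ccontr)
        assume "(z - z') $ i \<noteq> 0"
        moreover have "\<bar>(z - z') $ i\<bar> \<le> 2" using z by (auto simp: unit_steps_def axis_def)
        ultimately show False using dvd_imp_le_int[of "(z - z') $ i" "int n"] dvd n by auto
      qed
      then show "v = v'" using v by (simp add: vec_eq_iff)
    qed
    have "torus_nbrs n (torus_proj n (x + w)) = (\<lambda>w'. torus_proj n (x + w')) ` lattice_nbrs w"
      unfolding torus_nbrs_def lattice_nbrs_eq image_image torus_proj_add by (simp add: add.assoc)
    then show ?thesis using inj by (simp add: map_pmf_of_set_inj)
  qed
  show ?case
    by (simp add: Suc.IH bind_map_pmf map_bind_pmf step)
qed

text \<open>The torus is a product of intervals; this turns sums of products over it into products of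
one-dimensional sums.\<close>

lemma finite_torus: "finite (torus n :: (int ^ 'd) set)"
  and sum_prod_torus: "(\<Sum>\<xi>\<in>torus n. \<Prod>i\<in>UNIV. f i (\<xi> $ i)) = (\<Prod>i\<in>(UNIV :: 'd set). \<Sum>j\<in>{0..<int n}. f i j :: 'a :: comm_semiring_1)"
proof -
  let ?P = "PiE UNIV (\<lambda>_::'d. {0..<int n})"
  have bij: "bij_betw vec_lambda ?P (torus n)"
    by (rule bij_betw_byWitness[where f'=vec_nth]) (auto simp: torus_def PiE_iff)
  have fin: "finite ?P" by (intro finite_PiE) auto
  then show "finite (torus n :: (int ^ 'd) set)" using bij bij_betw_finite by blast
  have "(\<Sum>\<xi>\<in>torus n. \<Prod>i\<in>UNIV. f i (\<xi> $ i)) = (\<Sum>g\<in>?P. \<Prod>i\<in>UNIV. f i (vec_lambda g $ i))"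
    by (rule sum.reindex_bij_betw[OF bij, symmetric])
  also have "\<dots> = (\<Prod>i\<in>UNIV. \<Sum>j\<in>{0..<int n}. f i j)"
    by (subst prod_sum_PiE) auto
  finally show "(\<Sum>\<xi>\<in>torus n. \<Prod>i\<in>UNIV. f i (\<xi> $ i)) = (\<Prod>i\<in>UNIV. \<Sum>j\<in>{0..<int n}. f i j)" .
qed

lemma card_torus: "card (torus n :: (int ^ 'd) set) = n ^ CARD('d)"
proof -
  have "card (torus n :: (int ^ 'd) set) = (\<Sum>\<xi>\<in>(torus n :: (int ^ 'd) set). \<Prod>i\<in>(UNIV :: 'd set). 1)" by simp
  also have "\<dots> = (\<Prod>i\<in>(UNIV :: 'd set). \<Sum>j\<in>{0..<int n}. 1)"
    using sum_prod_torus[of "\<lambda>(_ :: 'd) _. 1 :: nat" n] .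
  finally show ?thesis by simp
qed

definition freq :: "nat \<Rightarrow> int ^ 'd \<Rightarrow> 'd \<Rightarrow> real" where
  "freq n \<xi> i = 2 * pi * of_int (\<xi> $ i) / n"

lemma sum_roots_of_unity:
  assumes n: "n > 0" and m: "\<not> int n dvd m"
  shows "(\<Sum>j\<in>{0..<int n}. cis (2 * pi * of_int j / n * of_int m)) = 0"
proof -
  define r where "r = cis (2 * pi * of_int m / n)"
  have "r \<noteq> 1"
  proof
    assume "r = 1"
    then have "cos (2 * pi * of_int m / n) = 1" by (metis r_def cis.sel(1) one_complex.sel(1))
    then obtain i :: int where "2 * pi * of_int m / n = of_int i * 2 * pi" by (auto simp: cos_one_2pi_int)
    then have "real_of_int m = of_int (i * int n)" using n by (simp add: field_simps)
    then have "m = i * int n" by (simp only: of_int_eq_iff)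
    then show False using m by simp
  qed
  have rn: "r ^ n = 1"
  proof -
    have "r ^ n = cis (2 * pi * of_int m)" unfolding r_def Complex.DeMoivre using n by simp
    also have "\<dots> = 1" by (simp add: cis_multiple_2pi)
    finally show ?thesis .
  qed
  have "(\<Sum>j\<in>{0..<int n}. cis (2 * pi * of_int j / n * of_int m)) = (\<Sum>j<n. cis (2 * pi * of_int (int j) / n * of_int m))"
    by (rule sum.reindex_bij_witness[of _ int nat]) auto
  also have "\<dots> = (\<Sum>j<n. r ^ j)"
    by (intro sum.cong refl) (simp add: r_def Complex.DeMoivre mult_ac)
  also have "\<dots> = 0" using geometric_sum[OF \<open>r \<noteq> 1\<close>, of n] rn by simp
  finally show ?thesis .
qed

text \<open>The sum of characters factorises over the coordinates, and a coordinate of \<open>w\<close> that is not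
divisible by \<open>n\<close> yields a vanishing sum of roots of unity.\<close>

lemma torus_cos_orthogonality:
  fixes w :: "int ^ 'd"
  assumes n: "n > 0"
  shows "(\<Sum>\<xi>\<in>torus n. cos (phase (freq n \<xi>) w)) = (if \<forall>i. int n dvd w $ i then real n ^ CARD('d) else 0)"
proof (cases "\<forall>i. int n dvd w $ i")
  case True
  have "cos (phase (freq n \<xi>) w) = 1" for \<xi> :: "int ^ 'd"
  proof -
    have "\<exists>k. w $ i = int n * k" for i using True by (auto elim: dvdE)
    then obtain k where k: "\<And>i. w $ i = int n * k i" by metis
    have "phase (freq n \<xi>) w = of_int (\<Sum>i\<in>UNIV. \<xi> $ i * k i) * 2 * pi"
      using n by (simp add: phase_def freq_def k sum_distrib_left sum_distrib_right mult_ac)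
    then show ?thesis using cos_one_2pi_int by blast
  qed
  then show ?thesis using True by (simp add: card_torus)
next
  case False
  then obtain i0 where i0: "\<not> int n dvd w $ i0" by auto
  have "cis (phase (freq n \<xi>) w) = (\<Prod>i\<in>UNIV. cis (2 * pi * of_int (\<xi> $ i) / n * of_int (w $ i)))" for \<xi> :: "int ^ 'd"
    unfolding phase_def freq_def by (induction rule: infinite_finite_induct[of _ UNIV]) (auto simp flip: cis_mult)
  then have "(\<Sum>\<xi>\<in>torus n. cis (phase (freq n \<xi>) w)) =
     (\<Sum>\<xi>\<in>torus n. \<Prod>i\<in>UNIV. cis (2 * pi * of_int (\<xi> $ i) / n * of_int (w $ i)))" by simp
  also have "\<dots> = (\<Prod>i\<in>UNIV. \<Sum>j\<in>{0..<int n}. cis (2 * pi * of_int j / n * of_int (w $ i)))"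
    by (rule sum_prod_torus)
  also have "\<dots> = 0"
    by (rule prod_zero) (use sum_roots_of_unity[OF n i0] in auto)
  finally have "Re (\<Sum>\<xi>\<in>torus n. cis (phase (freq n \<xi>) w)) = 0" by simp
  then show ?thesis using i0 by auto
qed

text \<open>Being at \<open>y\<close> is a congruence for the lattice walk, whose indicator is an average of
characters; \<open>lattice_walk_cos\<close> evaluates the expectation of each.\<close>

lemma torus_walk_fourier:
  fixes x y :: "int ^ 'd"
  assumes n: "n \<ge> 3" and x: "x \<in> torus n" and y: "y \<in> torus n"
  shows "pmf (walk_pmf (torus_nbrs n) x k) y =
    (\<Sum>\<xi>\<in>torus n. mean_cos (freq n \<xi>) ^ k * cos (phase (freq n \<xi>) (x - y))) / real n ^ CARD('d)"
proof -
  let ?p = "walk_pmf lattice_nbrs (0 :: int ^ 'd) k"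
  have "pmf (walk_pmf (torus_nbrs n) x k) y = measure ?p {w. torus_proj n (x + w) = y}"
    unfolding walk_torus_eq_map_lattice[OF n x] pmf_map by (simp add: vimage_def)
  also have "\<dots> = measure_pmf.expectation ?p (indicator {w. torus_proj n (x + w) = y})" by simp
  also have "\<dots> = measure_pmf.expectation ?p (\<lambda>w. (\<Sum>\<xi>\<in>torus n. cos (phase (freq n \<xi>) w + phase (freq n \<xi>) (x - y))) / real n ^ CARD('d))"
  proof (intro Bochner_Integration.integral_cong refl)
    fix w
    have "torus_proj n (x + w) = y \<longleftrightarrow> (\<forall>i. int n dvd (w + (x - y)) $ i)"
      using torus_proj_eq_iff[OF y, of "x + w"] n by (simp add: algebra_simps)
    then show "indicator {w. torus_proj n (x + w) = y} w =
       (\<Sum>\<xi>\<in>torus n. cos (phase (freq n \<xi>) w + phase (freq n \<xi>) (x - y))) / real n ^ CARD('d)"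
      using n torus_cos_orthogonality[of n "w + (x - y)"] unfolding phase_add[symmetric] by (simp add: indicator_def)
  qed
  also have "\<dots> = (\<Sum>\<xi>\<in>torus n. measure_pmf.expectation ?p (\<lambda>w. cos (phase (freq n \<xi>) w + phase (freq n \<xi>) (x - y)))) / real n ^ CARD('d)"
    by (subst integral_divide_zero, subst Bochner_Integration.integral_sum)
      (auto intro: integrable_measure_pmf_finite finite_set_walk_lattice)
  finally show ?thesis by (simp add: lattice_walk_cos)
qed

text \<open>A walk of fewer than \<open>n\<close> steps is too short to close up by winding around the torus.\<close>

lemma lattice_return_eq_torus_return:
  assumes n: "n \<ge> 3" and k: "k < n"
  shows "pmf (walk_pmf lattice_nbrs (0 :: int ^ 'd) k) 0 = pmf (walk_pmf (torus_nbrs n) (0 :: int ^ 'd) k) 0"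
proof -
  let ?p = "walk_pmf lattice_nbrs (0 :: int ^ 'd) k"
  have 0: "(0 :: int ^ 'd) \<in> torus n" using n by (simp add: torus_def)
  have "pmf (walk_pmf (torus_nbrs n) (0 :: int ^ 'd) k) 0 = measure ?p {w. torus_proj n (0 + w) = 0}"
    unfolding walk_torus_eq_map_lattice[OF n 0] pmf_map by (simp add: vimage_def)
  also have "\<dots> = measure ?p {0}"
  proof (rule measure_pmf.finite_measure_eq_AE)
    show "AE w in ?p. (w \<in> {w. torus_proj n (0 + w) = 0}) = (w \<in> {0})"
    proof (rule AE_pmfI)
      fix w assume w: "w \<in> set_pmf ?p"
      have "w $ i = 0" if "int n dvd w $ i" for i
        using dvd_imp_le_int[OF _ that] lattice_walk_range[OF w, of i] k by fastforce
      then show "(w \<in> {w. torus_proj n (0 + w) = 0}) = (w \<in> {0})"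
        using torus_proj_eq_iff[OF 0, of w] n by (auto simp: vec_eq_iff)
    qed
  qed auto
  finally show ?thesis by (simp add: measure_pmf_single)
qed

lemma torus_walk_far:
  assumes n: "n \<ge> 3" and x: "x \<in> torus n"
    and far: "\<And>w. \<forall>i. \<bar>w $ i\<bar> \<le> int k \<Longrightarrow> torus_proj n (x + w) \<noteq> y"
  shows "pmf (walk_pmf (torus_nbrs n) x k) y = 0"
proof -
  have "y \<notin> set_pmf (walk_pmf (torus_nbrs n) x k)"
    unfolding walk_torus_eq_map_lattice[OF n x] using far lattice_walk_range by fastforce
  then show ?thesis by (simp add: set_pmf_iff)
qed

section \<open>Fourier series of the Green's function on the torus\<close>

lemma integral_exp_decay:
  fixes a :: real
  assumes "a > 0"
  shows "integrable lborel (\<lambda>t. indicator {0..} t * exp (- t * a))"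
    and "(LINT t|lborel. indicator {0..} t * exp (- t * a)) = 1 / a"
proof -
  have "has_bochner_integral lborel (exponential_density a) 1"
  proof (rule has_bochner_integral_nn_integral)
    have "emeasure (density lborel (exponential_density a)) UNIV = 1"
      using prob_space.emeasure_space_1[OF prob_space_exponential_density[OF assms]] by simp
    then show "(\<integral>\<^sup>+x. ennreal (exponential_density a x) \<partial>lborel) = ennreal 1"
      by (simp add: emeasure_density)
  qed (use assms in \<open>auto simp: exponential_density_nonneg\<close>)
  moreover have "indicator {0..} t * exp (- t * a) = exponential_density a t / a" for t
    using assms by (auto simp: exponential_density_def indicator_def)
  ultimately show "integrable lborel (\<lambda>t. indicator {0..} t * exp (- t * a))"
    and "(LINT t|lborel. indicator {0..} t * exp (- t * a)) = 1 / a"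
    by (auto simp: has_bochner_integral_iff)
qed

text \<open>Jordan's inequality: the sine is concave on \<open>[0, \<pi>]\<close> and thus lies above its chord.\<close>

lemma two_mult_le_sin_pi:
  assumes "0 \<le> t" "t \<le> 1 / 2"
  shows "2 * t \<le> sin (pi * t)"
proof -
  have "convex_on {0..pi} (\<lambda>x. - sin x)"
    by (rule f''_ge0_imp_convex[where f'="\<lambda>x. - cos x" and f''=sin])
      (auto intro!: derivative_eq_intros sin_ge_zero)
  from convex_onD[OF this, of "2 * t" 0 "pi/2"] show ?thesis
    using assms pi_gt_zero by (simp add: field_simps)
qed

lemma dist_int_le_sin_pi:
  assumes "0 \<le> t" "t \<le> 1"
  shows "2 * min t (1 - t) \<le> sin (pi * t)"
proof (cases "t \<le> 1 / 2")
  case True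
  then show ?thesis using two_mult_le_sin_pi[of t] assms by simp
next
  case False
  have "sin (pi * (1 - t)) = sin (pi * t)" by (simp add: right_diff_distrib sin_diff)
  then show ?thesis using two_mult_le_sin_pi[of "1 - t"] assms False by simp
qed

lemma mean_cos_abs_le_1: "\<bar>mean_cos \<theta>\<bar> \<le> 1"
proof -
  have "\<bar>\<Sum>i\<in>UNIV. cos (\<theta> i)\<bar> \<le> (\<Sum>i\<in>(UNIV :: 'a set). 1)"
    by (rule order_trans[OF sum_abs sum_mono]) simp
  then show ?thesis by (simp add: mean_cos_def abs_divide)
qed

text \<open>The spectral gap.  One nonzero coordinate \<open>\<xi>\<^sub>i\<close> already gives
\<open>1 - cos (2 \<pi> \<xi>\<^sub>i / n) = 2 sin\<^sup>2 (\<pi> \<xi>\<^sub>i / n) \<ge> 8 / n\<^sup>2\<close>, because \<open>\<xi>\<^sub>i / n\<close> keeps distance \<open>1 / n\<close> from the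
integers.\<close>

lemma mean_cos_gap:
  fixes \<xi> :: "int ^ 'd"
  assumes \<xi>: "\<xi> \<in> torus n" "\<xi> \<noteq> 0"
  shows "8 / (CARD('d) * real n ^ 2) \<le> 1 - mean_cos (freq n \<xi>)"
proof -
  obtain i where i: "\<xi> $ i \<noteq> 0" using \<xi> by (auto simp: vec_eq_iff)
  have r: "1 \<le> \<xi> $ i" "\<xi> $ i \<le> int n - 1" using \<xi> i by (auto simp: torus_def) (metis less_le int_one_le_iff_zero_less)
  then have n: "n > 0" by linarith
  define t where "t = real_of_int (\<xi> $ i) / n"
  have "1 \<le> real_of_int (\<xi> $ i)" using r by simp
  moreover have "real_of_int (\<xi> $ i) \<le> real_of_int (int n - 1)" using r by (simp only: of_int_le_iff)
  ultimately have x: "1 \<le> real_of_int (\<xi> $ i)" "1 \<le> real n - real_of_int (\<xi> $ i)" by simp_all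
  have "1 - t = (real n - real_of_int (\<xi> $ i)) / n" using n by (simp add: t_def diff_divide_distrib)
  then have t: "1 / n \<le> t" "1 / n \<le> 1 - t"
    using divide_right_mono[OF x(1), of n] divide_right_mono[OF x(2), of n] by (simp_all add: t_def)
  have "0 < 1 / real n" using n by simp
  then have t01: "0 \<le> t" "t \<le> 1" using t by linarith+
  have "2 * (1 / n) \<le> sin (pi * t)" using dist_int_le_sin_pi[OF t01] t by (simp add: min_def split: if_splits)
  then have "(2 / n)\<^sup>2 \<le> (sin (pi * t))\<^sup>2" by (intro power_mono) auto
  moreover have "1 - cos (freq n \<xi> i) = 2 * (sin (pi * t))\<^sup>2"
    using cos_double_sin[of "pi * t"] by (simp add: freq_def t_def mult.assoc)
  ultimately have 1: "8 / real n ^ 2 \<le> 1 - cos (freq n \<xi> i)" by (simp add: power_divide)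
  have "1 - cos (freq n \<xi> i) \<le> (\<Sum>i\<in>UNIV. 1 - cos (freq n \<xi> i))"
    by (rule member_le_sum) auto
  also have "\<dots> = CARD('d) * (1 - mean_cos (freq n \<xi>))"
    by (simp add: mean_cos_def sum_subtractf right_diff_distrib)
  finally have "8 / real n ^ 2 \<le> CARD('d) * (1 - mean_cos (freq n \<xi>))" using 1 by linarith
  then have "8 / real n ^ 2 / CARD('d) \<le> 1 - mean_cos (freq n \<xi>)"
    by (subst divide_le_eq) (simp add: mult.commute)
  then show ?thesis by (simp add: mult.commute)
qed

text \<open>Summing the transition probabilities with Poisson weights turns \<open>mean_cos\<^sup>k\<close> into
\<open>exp (- t (1 - mean_cos))\<close>.  The frequency \<open>0\<close> contributes the constant \<open>1 / N\<close>, which is what the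
zero-average Green's function subtracts, and the other exponentials are integrated in time.\<close>

lemma green_torus_fourier:
  fixes x y :: "int ^ 'd"
  assumes n: "n \<ge> 3" and x: "x \<in> torus n" and y: "y \<in> torus n"
  shows "green_torus n x y =
    (\<Sum>\<xi>\<in>torus n - {0}. cos (phase (freq n \<xi>) (x - y)) / (1 - mean_cos (freq n \<xi>))) / real n ^ CARD('d)"
proof -
  let ?N = "real n ^ CARD('d)"
  let ?c = "\<lambda>\<xi> :: int ^ 'd. cos (phase (freq n \<xi>) (x - y))" and ?m = "\<lambda>\<xi> :: int ^ 'd. mean_cos (freq n \<xi>)"
  have heat: "measure (ctsrw (torus_nbrs n) x) {p \<in> space (ctsrw (torus_nbrs n) x). ctsrw_at t p = y} - 1 / ?N =
     (\<Sum>\<xi>\<in>torus n - {0}. ?c \<xi> * exp (- t * (1 - ?m \<xi>))) / ?N" if t: "0 \<le> t" for t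
  proof -
    have 1: "(\<lambda>k. exp (- t) * t ^ k / fact k * pmf (walk_pmf (torus_nbrs n) x k) y) sums
      ((\<Sum>\<xi>\<in>torus n. ?c \<xi> * exp (- t * (1 - ?m \<xi>))) / ?N)"
    proof -
      have "(\<lambda>k. ?c \<xi> * (exp (- t) * ((t * ?m \<xi>) ^ k /\<^sub>R fact k))) sums (?c \<xi> * (exp (- t) * exp (t * ?m \<xi>)))" for \<xi>
        by (intro sums_mult exp_converges)
      then have "(\<lambda>k. (\<Sum>\<xi>\<in>torus n. ?c \<xi> * (exp (- t) * ((t * ?m \<xi>) ^ k /\<^sub>R fact k))) / ?N) sums
         ((\<Sum>\<xi>\<in>torus n. ?c \<xi> * (exp (- t) * exp (t * ?m \<xi>))) / ?N)"
        by (intro sums_divide sums_sum)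
      moreover have "exp (- t) * exp (t * ?m \<xi>) = exp (- t * (1 - ?m \<xi>))" for \<xi>
        by (simp add: algebra_simps flip: exp_add)
      moreover have "(\<Sum>\<xi>\<in>torus n. ?c \<xi> * (exp (- t) * ((t * ?m \<xi>) ^ k /\<^sub>R fact k))) / ?N =
         exp (- t) * t ^ k / fact k * pmf (walk_pmf (torus_nbrs n) x k) y" for k
        unfolding torus_walk_fourier[OF n x y]
        by (simp add: sum_distrib_left sum_divide_distrib power_mult_distrib divide_inverse mult_ac)
      ultimately show ?thesis by simp
    qed
    have "measure (ctsrw (torus_nbrs n) x) {p \<in> space (ctsrw (torus_nbrs n) x). ctsrw_at t p = y} =
      (\<Sum>\<xi>\<in>torus n. ?c \<xi> * exp (- t * (1 - ?m \<xi>))) / ?N"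
      by (rule sums_unique2[OF ctsrw_at_sums[OF t] 1])
    also have "(\<Sum>\<xi>\<in>torus n. ?c \<xi> * exp (- t * (1 - ?m \<xi>))) = ?c 0 * exp (- t * (1 - ?m 0)) + 
       (\<Sum>\<xi>\<in>torus n - {0}. ?c \<xi> * exp (- t * (1 - ?m \<xi>)))"
      using n by (intro sum.remove finite_torus) (simp add: torus_def)
    also have "?c 0 * exp (- t * (1 - ?m 0)) = 1"
      by (simp add: phase_def freq_def mean_cos_def)
    finally show ?thesis by (simp add: add_divide_distrib)
  qed
  have pos: "0 < 1 - ?m \<xi>" if "\<xi> \<in> torus n - {0}" for \<xi>
  proof -
    have "0 < 8 / (CARD('d) * real n ^ 2)" using n by simp
    also have "\<dots> \<le> 1 - ?m \<xi>" using mean_cos_gap[of \<xi> n] that by blast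
    finally show ?thesis .
  qed
  have "green_torus n x y = (LINT t|lborel. (\<Sum>\<xi>\<in>torus n - {0}. ?c \<xi> / ?N * (indicator {0..} t * exp (- t * (1 - ?m \<xi>)))))"
    unfolding green_torus_def set_lebesgue_integral_def
  proof (intro Bochner_Integration.integral_cong refl)
    fix t :: real
    show "indicator {0..} t *\<^sub>R (measure (ctsrw (torus_nbrs n) x) {p \<in> space (ctsrw (torus_nbrs n) x). ctsrw_at t p = y} - 1 / ?N) =
       (\<Sum>\<xi>\<in>torus n - {0}. ?c \<xi> / ?N * (indicator {0..} t * exp (- t * (1 - ?m \<xi>))))"
    proof (cases "0 \<le> t")
      case True
      then show ?thesis unfolding heat[OF True] by (simp add: sum_divide_distrib)
    qed simp
  qed
  also have "\<dots> = (\<Sum>\<xi>\<in>torus n - {0}. ?c \<xi> / ?N * (1 / (1 - ?m \<xi>)))"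
    using integral_exp_decay[OF pos] by (subst Bochner_Integration.integral_sum) (auto simp: mult.commute)
  finally show ?thesis by (simp add: sum_divide_distrib mult.commute)
qed

section \<open>Decay of the heat kernel\<close>

text \<open>Comparison with the integral of \<open>1 / (1 + a x\<^sup>2)\<close>, that is, with the arctangent.\<close>

lemma sum_inverse_quadratic:
  fixes a :: real
  assumes a: "a > 0" and T: "finite T"
  shows "(\<Sum>l\<in>T. 1 / (1 + a * (real l)\<^sup>2)) \<le> 1 + pi / (2 * sqrt a)"
proof -
  let ?f = "\<lambda>l. 1 / (1 + a * (real l)\<^sup>2)"
  have f0: "0 \<le> ?f l" for l using a by (auto intro!: divide_nonneg_nonneg add_nonneg_nonneg)
  have step: "?f (Suc l) \<le> arctan (sqrt a * real (Suc l)) / sqrt a - arctan (sqrt a * real l) / sqrt a" for l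
  proof -
    have "\<exists>z. z > real l \<and> z < real (Suc l) \<and>
      arctan (sqrt a * real (Suc l)) / sqrt a - arctan (sqrt a * real l) / sqrt a = (real (Suc l) - real l) * (1 / (1 + a * z\<^sup>2))"
      using a by (intro MVT2) (auto intro!: derivative_eq_intros simp: power_mult_distrib divide_inverse)
    then obtain z where z: "real l < z" "z < real (Suc l)"
      and eq: "arctan (sqrt a * real (Suc l)) / sqrt a - arctan (sqrt a * real l) / sqrt a = 1 / (1 + a * z\<^sup>2)" by auto
    have "z\<^sup>2 \<le> (real (Suc l))\<^sup>2" using z by (intro power_mono) auto
    then have "1 / (1 + a * (real (Suc l))\<^sup>2) \<le> 1 / (1 + a * z\<^sup>2)"
      using a by (intro divide_left_mono add_left_mono mult_left_mono mult_pos_pos) (auto intro: add_pos_nonneg)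
    then show ?thesis using eq by simp
  qed
  have tele: "(\<Sum>l<Suc M. ?f l) \<le> 1 + arctan (sqrt a * real M) / sqrt a" for M
  proof (induction M)
    case (Suc M)
    have "(\<Sum>l<Suc (Suc M). ?f l) = (\<Sum>l<Suc M. ?f l) + ?f (Suc M)" by (rule sum.lessThan_Suc)
    then show ?case using Suc.IH step[of M] by linarith
  qed simp
  obtain M where M: "T \<subseteq> {..<Suc M}"
    using T finite_nat_iff_bounded[of T] by (meson lessThan_subset_iff less_imp_le_nat lessI order_trans)
  have "(\<Sum>l\<in>T. ?f l) \<le> (\<Sum>l<Suc M. ?f l)" by (rule sum_mono2) (use M f0 in auto)
  also note tele[of M]
  also have "arctan (sqrt a * real M) / sqrt a \<le> (pi / 2) / sqrt a"
    using a arctan_ubound[of "sqrt a * real M"] by (intro divide_right_mono) auto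
  finally show ?thesis by simp
qed

text \<open>On each side of \<open>v\<close> the integer parts of the distances \<open>\<bar>j - v\<bar>\<close> are pairwise distinct, so
each side is bounded by a sum over distinct natural numbers.\<close>

lemma sum_inverse_quadratic_shifted:
  fixes a v :: real
  assumes a: "a > 0"
  shows "(\<Sum>j<n. 1 / (1 + a * (real j - v)\<^sup>2)) \<le> 2 + pi / sqrt a"
proof -
  let ?g = "\<lambda>j. 1 / (1 + a * (real j - v)\<^sup>2)" and ?f = "\<lambda>l. 1 / (1 + a * (real l)\<^sup>2)"
  have half: "(\<Sum>j\<in>S. ?g j) \<le> 1 + pi / (2 * sqrt a)"
    if S: "finite S" and inj: "inj_on l S" and le: "\<And>j. j \<in> S \<Longrightarrow> real (l j) \<le> \<bar>real j - v\<bar>" for S and l :: "nat \<Rightarrow> nat"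
  proof -
    have "(\<Sum>j\<in>S. ?g j) \<le> (\<Sum>j\<in>S. ?f (l j))"
    proof (rule sum_mono)
      fix j assume "j \<in> S"
      then have "(real (l j))\<^sup>2 \<le> (real j - v)\<^sup>2" using le[of j] by (simp add: abs_le_square_iff[symmetric])
      then show "?g j \<le> ?f (l j)"
        using a by (intro divide_left_mono add_left_mono mult_left_mono mult_pos_pos) (auto intro: add_pos_nonneg)
    qed
    also have "\<dots> = (\<Sum>l\<in>l ` S. ?f l)" using inj by (simp add: sum.reindex)
    also have "\<dots> \<le> 1 + pi / (2 * sqrt a)" using S by (intro sum_inverse_quadratic[OF a]) auto
    finally show ?thesis .
  qed
  define S1 where "S1 = {j. j < n \<and> v \<le> real j}"
  define S2 where "S2 = {j. j < n \<and> real j < v}"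
  have fin: "finite S1" "finite S2" by (auto simp: S1_def S2_def)
  have 1: "(\<Sum>j\<in>S1. ?g j) \<le> 1 + pi / (2 * sqrt a)"
  proof (rule half[where l="\<lambda>j. nat (int j + \<lfloor>- v\<rfloor>)"])
    have nn: "0 \<le> int j + \<lfloor>- v\<rfloor>" if "j \<in> S1" for j
      using that by (simp add: S1_def) linarith
    show "inj_on (\<lambda>j. nat (int j + \<lfloor>- v\<rfloor>)) S1"
      by (rule inj_onI) (use nn in \<open>simp add: eq_nat_nat_iff\<close>)
    show "real (nat (int j + \<lfloor>- v\<rfloor>)) \<le> \<bar>real j - v\<bar>" if "j \<in> S1" for j
      using nn[OF that] by simp linarith
  qed (rule fin)
  have 2: "(\<Sum>j\<in>S2. ?g j) \<le> 1 + pi / (2 * sqrt a)"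
  proof (rule half[where l="\<lambda>j. nat (\<lfloor>v\<rfloor> - int j)"])
    have nn: "0 \<le> \<lfloor>v\<rfloor> - int j" if "j \<in> S2" for j
      using that by (simp add: S2_def le_floor_iff)
    show "inj_on (\<lambda>j. nat (\<lfloor>v\<rfloor> - int j)) S2"
      by (rule inj_onI) (use nn in \<open>simp add: eq_nat_nat_iff\<close>)
    show "real (nat (\<lfloor>v\<rfloor> - int j)) \<le> \<bar>real j - v\<bar>" if "j \<in> S2" for j
      using nn[OF that] by simp linarith
  qed (rule fin)
  have "{..<n} = S1 \<union> S2" by (auto simp: S1_def S2_def)
  moreover have "S1 \<inter> S2 = {}" by (auto simp: S1_def S2_def)
  ultimately have "(\<Sum>j<n. ?g j) = (\<Sum>j\<in>S1. ?g j) + (\<Sum>j\<in>S2. ?g j)"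
    using fin by (simp add: sum.union_disjoint)
  then show ?thesis using 1 2 by (simp add: field_simps)
qed

text \<open>The points \<open>0\<close>, \<open>1/2\<close> and \<open>1\<close> are the zeros of \<open>sin (2 \<pi> y)\<close> in the unit interval.\<close>

lemma sin_double_lower:
  fixes y :: real
  assumes "0 \<le> y" "y \<le> 1"
  obtains z where "z \<in> {0, 1/2, 1}" "4 * \<bar>y - z\<bar> \<le> \<bar>sin (2 * pi * y)\<bar>"
proof (cases "y \<le> 1 / 2")
  case True
  have "2 * min (2 * y) (1 - 2 * y) \<le> \<bar>sin (2 * pi * y)\<bar>"
    using dist_int_le_sin_pi[of "2 * y"] assms True by (simp add: mult_ac)
  then show ?thesis using that[of 0] that[of "1/2"] assms True by (auto simp: min_def abs_if split: if_splits)
next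
  case False
  have "sin (pi * (2 * y - 1)) = - sin (2 * pi * y)"
    by (simp add: right_diff_distrib sin_diff mult_ac)
  then have "2 * min (2 * y - 1) (1 - (2 * y - 1)) \<le> \<bar>sin (2 * pi * y)\<bar>"
    using dist_int_le_sin_pi[of "2 * y - 1"] assms False by simp
  then show ?thesis using that[of 1] that[of "1/2"] assms False by (auto simp: min_def abs_if split: if_splits)
qed

text \<open>A one-dimensional heat kernel on the diagonal, with \<open>\<bar>cos\<bar>\<close> in place of \<open>cos\<close>: the discrete-time
walk may be periodic, so frequencies close to half a period decay as slowly as those close to \<open>0\<close>.\<close>

definition heat_1d :: "nat \<Rightarrow> real \<Rightarrow> real" where
  "heat_1d n s = (\<Sum>j\<in>{0..<int n}. exp (- s * (1 - \<bar>cos (2 * pi * of_int j / n)\<bar>))) / n"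

text \<open>From \<open>1 - \<bar>cos \<theta>\<bar> \<ge> sin\<^sup>2 \<theta> / 2\<close>, the exponent is at least \<open>8 s (y - z)\<^sup>2\<close> for \<open>y = j / n\<close> and a
suitable zero \<open>z\<close> of the sine; then \<open>exp (- x) \<le> 1 / (1 + x)\<close> reduces the sum to three shifted sums of
inverse quadratics.\<close>

lemma heat_1d_bounds:
  assumes n: "n > 0" and s: "s > 0"
  shows "0 \<le> heat_1d n s" "heat_1d n s \<le> 1" "heat_1d n s \<le> 6 / n + 4 / sqrt s"
proof -
  show "0 \<le> heat_1d n s" by (simp add: heat_1d_def sum_nonneg)
  have "(\<Sum>j\<in>{0..<int n}. exp (- s * (1 - \<bar>cos (2 * pi * of_int j / n)\<bar>))) \<le> (\<Sum>j\<in>{0..<int n}. 1)"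
    using s by (intro sum_mono) auto
  then show "heat_1d n s \<le> 1" using n by (simp add: heat_1d_def)
  define a where "a = 8 * s / (real n)\<^sup>2"
  have a: "a > 0" using n s by (simp add: a_def)
  let ?Z = "{0, 1/2, 1} :: real set"
  let ?g = "\<lambda>(z :: real) (j :: nat). 1 / (1 + a * (real j - n * z)\<^sup>2)"
  have g0: "0 \<le> ?g z j" for z j using a by (auto intro!: divide_nonneg_nonneg add_nonneg_nonneg)
  have site: "exp (- s * (1 - \<bar>cos (2 * pi * real j / n)\<bar>)) \<le> (\<Sum>z\<in>?Z. ?g z j)" if j: "j < n" for j
  proof -
    define y where "y = real j / n"
    have y: "0 \<le> y" "y \<le> 1" using j by (auto simp: y_def)
    obtain z where z: "z \<in> ?Z" "4 * \<bar>y - z\<bar> \<le> \<bar>sin (2 * pi * y)\<bar>"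
      by (rule sin_double_lower[OF y])
    define c where "c = \<bar>cos (2 * pi * y)\<bar>"
    have c: "0 \<le> c" "c \<le> 1" by (auto simp: c_def)
    have "(4 * \<bar>y - z\<bar>)\<^sup>2 \<le> \<bar>sin (2 * pi * y)\<bar>\<^sup>2" using z(2) by (intro power_mono) auto
    also have "\<dots> = 1 - c\<^sup>2" by (simp add: c_def sin_squared_eq)
    also have "\<dots> = (1 - c) * (1 + c)" by (simp add: power2_eq_square algebra_simps)
    also have "\<dots> \<le> (1 - c) * 2" using c by (intro mult_left_mono) auto
    finally have "8 * (y - z)\<^sup>2 \<le> 1 - c" by (simp add: power_mult_distrib)
    then have "s * (8 * (y - z)\<^sup>2) \<le> s * (1 - c)" using s by (intro mult_left_mono) auto
    moreover have "a * (real j - n * z)\<^sup>2 = s * (8 * (y - z)\<^sup>2)"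
    proof -
      have "real j - n * z = n * (y - z)" using n by (simp add: y_def algebra_simps)
      then show ?thesis using n by (simp add: a_def power_mult_distrib)
    qed
    ultimately have e: "a * (real j - n * z)\<^sup>2 \<le> s * (1 - c)" by simp
    have e0: "0 \<le> a * (real j - n * z)\<^sup>2" using a by simp
    have "1 + a * (real j - n * z)\<^sup>2 \<le> exp (s * (1 - c))"
      using e exp_ge_add_one_self[of "s * (1 - c)"] by linarith
    then have "1 / exp (s * (1 - c)) \<le> ?g z j"
      using e0 by (intro divide_left_mono mult_pos_pos) auto
    also have "\<dots> \<le> (\<Sum>z\<in>?Z. ?g z j)" by (rule member_le_sum[OF z(1)]) (use g0 in auto)
    finally show ?thesis by (simp add: exp_minus c_def y_def inverse_eq_divide)
  qed
  have "(\<Sum>j\<in>{0..<int n}. exp (- s * (1 - \<bar>cos (2 * pi * of_int j / n)\<bar>))) =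
     (\<Sum>j<n. exp (- s * (1 - \<bar>cos (2 * pi * real j / n)\<bar>)))"
    by (rule sum.reindex_bij_witness[of _ int nat]) auto
  also have "\<dots> \<le> (\<Sum>j<n. (\<Sum>z\<in>?Z. ?g z j))" using site by (intro sum_mono) auto
  also have "\<dots> = (\<Sum>z\<in>?Z. (\<Sum>j<n. ?g z j))" by (rule sum.swap)
  also have "\<dots> \<le> (\<Sum>z\<in>?Z. 2 + pi / sqrt a)"
    by (intro sum_mono sum_inverse_quadratic_shifted[OF a])
  also have "\<dots> = 6 + 3 * pi / sqrt a" by simp
  finally have "heat_1d n s \<le> (6 + 3 * pi / sqrt a) / n" by (simp add: heat_1d_def divide_right_mono)
  also have "\<dots> = 6 / n + (3 * pi / sqrt 8) / sqrt s"
    using n s by (simp add: a_def real_sqrt_divide real_sqrt_mult field_simps)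
  also have "3 * pi / sqrt 8 \<le> 4"
  proof -
    have "(3 * pi) \<le> 4 * sqrt 8"
    proof -
      have "2.8 \<le> sqrt 8" by (rule real_le_rsqrt) (simp add: power2_eq_square)
      moreover have "pi \<le> 3.2" using pi_approx by simp
      ultimately show ?thesis by simp
    qed
    then show ?thesis by (simp add: divide_le_eq)
  qed
  then have "(3 * pi / sqrt 8) / sqrt s \<le> 4 / sqrt s" using s by (intro divide_right_mono) auto
  finally show "heat_1d n s \<le> 6 / n + 4 / sqrt s" by simp
qed

text \<open>The Fourier sum of the \<open>k\<close>-step transition probability with all signs removed; it dominates
these probabilities for every pair of points.  The first argument carries the dimension.\<close>

definition heat_abs :: "'d::finite itself \<Rightarrow> nat \<Rightarrow> nat \<Rightarrow> real" where
  "heat_abs _ n k = (\<Sum>\<xi>\<in>torus n. \<bar>mean_cos (freq n (\<xi> :: int ^ 'd))\<bar> ^ k) / real n ^ CARD('d)"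

text \<open>The coordinates of the discrete-time walk are dependent, but
\<open>\<bar>mean_cos \<theta>\<bar>\<^sup>k \<le> exp (- (k/d) \<Sum>\<^sub>i (1 - \<bar>cos \<theta>\<^sub>i\<bar>))\<close> factorises over the coordinates.\<close>

lemma heat_abs_le_power:
  "heat_abs TYPE('d::finite) n k \<le> heat_1d n (k / CARD('d)) ^ CARD('d)"
proof -
  let ?s = "real k / CARD('d)"
  have "\<bar>mean_cos (freq n \<xi>)\<bar> ^ k \<le> (\<Prod>i\<in>UNIV. exp (- ?s * (1 - \<bar>cos (2 * pi * of_int (\<xi> $ i) / n)\<bar>)))"
    for \<xi> :: "int ^ 'd"
  proof -
    let ?S = "\<Sum>i\<in>UNIV. 1 - \<bar>cos (freq n \<xi> i)\<bar>"
    have "\<bar>mean_cos (freq n \<xi>)\<bar> \<le> (\<Sum>i\<in>UNIV. \<bar>cos (freq n \<xi> i)\<bar>) / CARD('d)"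
      unfolding mean_cos_def abs_divide by (intro divide_mono) auto
    also have "\<dots> = 1 - ?S / CARD('d)"
      by (simp add: sum_subtractf diff_divide_distrib)
    also have "\<dots> \<le> exp (- (?S / CARD('d)))" using exp_ge_add_one_self[of "- (?S / CARD('d))"] by simp
    finally have "\<bar>mean_cos (freq n \<xi>)\<bar> ^ k \<le> exp (- (?S / CARD('d))) ^ k" by (intro power_mono) auto
    also have "\<dots> = exp (\<Sum>i\<in>UNIV. - ?s * (1 - \<bar>cos (freq n \<xi> i)\<bar>))"
      by (simp add: exp_of_nat_mult[symmetric] sum_distrib_left sum_divide_distrib sum_negf)
    finally show ?thesis by (simp add: exp_sum freq_def)
  qed
  then have "(\<Sum>\<xi>\<in>torus n. \<bar>mean_cos (freq n (\<xi> :: int ^ 'd))\<bar> ^ k) \<le>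
     (\<Sum>\<xi>\<in>torus n. (\<Prod>i\<in>UNIV. exp (- ?s * (1 - \<bar>cos (2 * pi * of_int ((\<xi> :: int ^ 'd) $ i) / n)\<bar>))))"
    by (intro sum_mono)
  also have "\<dots> = (\<Sum>j\<in>{0..<int n}. exp (- ?s * (1 - \<bar>cos (2 * pi * of_int j / n)\<bar>))) ^ CARD('d)"
    by (subst sum_prod_torus) simp
  finally show ?thesis unfolding heat_abs_def heat_1d_def power_divide by (intro divide_right_mono) auto
qed

text \<open>Each one-dimensional factor is at most \<open>1\<close>, so three of the at least three factors may be
kept: the summable rate \<open>k\<^sup>-\<^sup>3\<^sup>/\<^sup>2\<close> is enough in every dimension.\<close>

lemma heat_abs_decay:
  assumes d: "CARD('d::finite) \<ge> 3"
  obtains C where "C > 0" "\<And>n k. n > 0 \<Longrightarrow> k > 0 \<Longrightarrow>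
    heat_abs TYPE('d) n k \<le> C * (1 / real n ^ 3 + 1 / (k * sqrt k))"
proof
  let ?d = "real CARD('d)"
  let ?C = "4 * (216 + 64 * (?d * sqrt ?d))"
  show "?C > 0" by (simp add: add_pos_nonneg)
  fix n k :: nat assume n: "n > 0" and k: "k > 0"
  define h where "h = heat_1d n (k / ?d)"
  have s: "0 < k / ?d" using k by simp
  note h = heat_1d_bounds[OF n s, folded h_def]
  have "heat_abs TYPE('d) n k \<le> h ^ CARD('d)" unfolding h_def by (rule heat_abs_le_power)
  also have "\<dots> \<le> h ^ 3" by (rule power_decreasing[OF d h(1,2)])
  also have "\<dots> \<le> (6 / n + 4 / sqrt (k / ?d)) ^ 3" by (rule power_mono[OF h(3,1)])
  also have "\<dots> \<le> 4 * ((6 / n) ^ 3 + (4 / sqrt (k / ?d)) ^ 3)"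
  proof -
    have "(x + y) ^ 3 \<le> 4 * (x ^ 3 + y ^ 3)" if "0 \<le> x" "0 \<le> y" for x y :: real
    proof -
      have "0 \<le> 3 * (x + y) * (x - y)\<^sup>2" using that by simp
      also have "\<dots> = 4 * (x ^ 3 + y ^ 3) - (x + y) ^ 3" by (simp add: power2_eq_square power3_eq_cube algebra_simps)
      finally show ?thesis by simp
    qed
    then show ?thesis by simp
  qed
  also have "(6 / n) ^ 3 = 216 * (1 / real n ^ 3)" by (simp add: power_divide)
  also have "(4 / sqrt (k / ?d)) ^ 3 = 64 * (?d * sqrt ?d) * (1 / (k * sqrt k))"
    using k by (simp add: real_sqrt_divide power_divide power3_eq_cube field_simps)
  also have "4 * (216 * (1 / real n ^ 3) + 64 * (?d * sqrt ?d) * (1 / (k * sqrt k))) \<le>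
     ?C * (1 / real n ^ 3 + 1 / (k * sqrt k))"
    using n k by (simp add: algebra_simps add_increasing2)
  finally show "heat_abs TYPE('d) n k \<le> ?C * (1 / real n ^ 3 + 1 / (k * sqrt k))" .
qed

section \<open>Uniform estimates for the Green's functions\<close>

text \<open>For \<open>x \<ge> 0\<close> the geometric series for \<open>1 / (1 - x)\<close> is cut off at \<open>K\<close>, where the power has become
exponentially small.  For \<open>x < 0\<close> the denominator exceeds \<open>1\<close> and one term is enough, which settles the
eigenvalues near \<open>-1\<close>.\<close>

lemma power_div_le_geometric_sum:
  fixes x c :: real
  assumes x: "-1 \<le> x" and c: "0 < c" "c \<le> 1 - x" and mK: "m < K"
  shows "\<bar>x\<bar> ^ m / (1 - x) \<le> (\<Sum>k=m..<K. \<bar>x\<bar> ^ k) + exp (- real K * c) / c"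
proof (cases "0 \<le> x")
  case True
  have x1: "0 < 1 - x" using c by linarith
  have "x ^ m / (1 - x) = (\<Sum>k=m..<K. x ^ k) + x ^ K / (1 - x)"
  proof -
    have "(\<Sum>k=m..<K. x ^ k) * (1 - x) = x ^ m - x ^ K"
      using mK by (induction K) (auto simp: less_Suc_eq algebra_simps)
    then have "(\<Sum>k=m..<K. x ^ k) = (x ^ m - x ^ K) / (1 - x)" using x1 by (simp add: field_simps)
    then show ?thesis by (simp add: diff_divide_distrib)
  qed
  also have "x ^ K / (1 - x) \<le> exp (- real K * c) / c"
  proof (rule frac_le)
    have "x \<le> exp (- c)" using exp_ge_add_one_self[of "- c"] c by linarith
    then have "x ^ K \<le> exp (- c) ^ K" using True by (intro power_mono) auto
    then show "x ^ K \<le> exp (- real K * c)" by (simp add: exp_of_nat_mult[symmetric])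
  qed (use c in auto)
  finally show ?thesis using True by simp
next
  case False
  then have "\<bar>x\<bar> ^ m / (1 - x) \<le> \<bar>x\<bar> ^ m / 1" by (intro divide_left_mono) auto
  also have "\<dots> \<le> (\<Sum>k=m..<K. \<bar>x\<bar> ^ k)" using member_le_sum[of m "{m..<K}" "\<lambda>k. \<bar>x\<bar> ^ k"] mK by simp
  also have "\<dots> \<le> (\<Sum>k=m..<K. \<bar>x\<bar> ^ k) + exp (- real K * c) / c" using c by simp
  finally show ?thesis .
qed

text \<open>The terms are dominated by the telescoping differences of \<open>6 / sqrt k\<close>.\<close>

lemma sum_three_halves_tail:
  fixes m K :: nat
  assumes m: "m \<ge> 1"
  shows "(\<Sum>k=m..<K. 1 / (k * sqrt k)) \<le> 6 / sqrt m"
proof -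
  have step: "1 / (k * sqrt k) \<le> 6 / sqrt k - 6 / sqrt (Suc k)" if k: "k \<ge> 1" for k :: nat
  proof -
    define a b where "a = sqrt k" and "b = sqrt (Suc k)"
    have a: "a \<ge> 1" and b: "b > 0" and ab: "b\<^sup>2 = a\<^sup>2 + 1" and ka: "real k = a\<^sup>2"
      using k by (auto simp: a_def b_def)
    have "1 \<le> a\<^sup>2" using a by simp
    then have "b\<^sup>2 \<le> (2 * a)\<^sup>2" using ab by (simp add: power_mult_distrib)
    then have b2: "b \<le> 2 * a" using a by (auto intro: power2_le_imp_le)
    have "b * (a + b) \<le> 6 * a\<^sup>2"
    proof -
      have "a * b \<le> a * (2 * a)" using b2 a by (intro mult_left_mono) auto
      moreover have "1 \<le> a\<^sup>2" using a by simp
      ultimately show ?thesis using ab by (simp add: power2_eq_square algebra_simps)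
    qed
    then have "6 / (a * (6 * a\<^sup>2)) \<le> 6 / (a * (b * (a + b)))"
      using a b by (intro divide_left_mono mult_left_mono mult_pos_pos) auto
    then have *: "1 / (a\<^sup>2 * a) \<le> 6 / (a * (b * (a + b)))" by (simp add: mult.commute)
    have "(b - a) * (a + b) = 1" using ab by (simp add: power2_eq_square algebra_simps)
    then have e: "b - a = 1 / (a + b)" using a b by (simp add: field_simps)
    have "6 / a - 6 / b = 6 * (b - a) / (a * b)" using a b by (simp add: field_simps)
    then have "6 / a - 6 / b = 6 / (a * (b * (a + b)))" unfolding e by (simp add: mult_ac)
    then show ?thesis using * unfolding a_def[symmetric] b_def[symmetric] unfolding ka by simp
  qed
  have "(\<Sum>k=m..<K. 1 / (k * sqrt k)) \<le> 6 / sqrt m - 6 / sqrt K" if "m \<le> K"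
    using that
  proof (induction K rule: dec_induct)
    case (step n)
    then show ?case using \<open>\<And>k. 1 \<le> k \<Longrightarrow> _\<close>[of n] m by simp
  qed simp
  moreover have "6 / sqrt m - 6 / sqrt K \<le> 6 / sqrt m" by simp
  ultimately show ?thesis by (cases "m \<le> K") (auto intro: order_trans)
qed

text \<open>In Fourier space the first \<open>m\<close> transition probabilities replace \<open>1 / (1 - mean_cos)\<close> by
\<open>mean_cos\<^sup>m / (1 - mean_cos)\<close>.  The geometric expansion is cut off at a time \<open>K\<close> of order
\<open>n\<^sup>5\<^sup>/\<^sup>2\<close>.  This is much longer than the relaxation time \<open>n\<^sup>2\<close>, so the rest is exponentially
small, yet short enough for the contribution \<open>K / n\<^sup>3\<close> of the equilibrium to be of order
\<open>1 / sqrt n\<close>.\<close>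

lemma green_torus_partial_sum:
  assumes d: "CARD('d::finite) \<ge> 3"
  obtains C where "C > 0" "\<And>n m x y. n \<ge> 3 \<Longrightarrow> 1 \<le> m \<Longrightarrow> m \<le> n \<Longrightarrow> x \<in> torus n \<Longrightarrow> y \<in> torus n \<Longrightarrow>
    \<bar>green_torus n x (y :: int ^ 'd) - (\<Sum>k<m. pmf (walk_pmf (torus_nbrs n) x k) y)\<bar> \<le> C / sqrt m"
proof -
  obtain C0 where C0: "C0 > 0" "\<And>n k. n > 0 \<Longrightarrow> k > 0 \<Longrightarrow>
    heat_abs TYPE('d) n k \<le> C0 * (1 / real n ^ 3 + 1 / (k * sqrt k))"
    using heat_abs_decay[OF d] by blast
  define c where "c = 8 / real CARD('d)"
  have c: "c > 0" by (simp add: c_def)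
  have "(\<lambda>n. real n ^ 2 * sqrt n * exp (- c * sqrt n) / c) \<longlonglongrightarrow> 0"
    using c by real_asymp
  then have "Bseq (\<lambda>n. real n ^ 2 * sqrt n * exp (- c * sqrt n) / c)"
    by (auto intro!: convergent_imp_Bseq simp: convergent_def)
  then obtain C1 where C1: "C1 > 0" "\<And>n. norm (real n ^ 2 * sqrt n * exp (- c * sqrt n) / c) \<le> C1"
    by (auto simp: Bseq_def)
  show ?thesis
  proof (rule that[of "1 + 8 * C0 + C1"])
    show "0 < 1 + 8 * C0 + C1" using C0 C1 by simp
    fix n m :: nat and x y :: "int ^ 'd"
    assume n: "n \<ge> 3" and m: "1 \<le> m" "m \<le> n" and x: "x \<in> torus n" and y: "y \<in> torus n"
    let ?N = "real n ^ CARD('d)" and ?S = "torus n - {0 :: int ^ 'd}"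
    let ?c = "\<lambda>\<xi> :: int ^ 'd. cos (phase (freq n \<xi>) (x - y))" and ?m = "\<lambda>\<xi> :: int ^ 'd. mean_cos (freq n \<xi>)"
    have N: "?N > 0" using n by simp
    have gap: "c / real n ^ 2 \<le> 1 - ?m \<xi>" "0 < c / real n ^ 2" if "\<xi> \<in> ?S" for \<xi>
      using mean_cos_gap[of \<xi> n] that n c by (auto simp: c_def)
    have zero: "0 \<in> (torus n :: (int ^ 'd) set)" using n by (simp add: torus_def)
    have fin: "finite (torus n :: (int ^ 'd) set)" by (rule finite_torus)
    have "(\<Sum>k<m. pmf (walk_pmf (torus_nbrs n) x k) y) =
      (\<Sum>\<xi>\<in>torus n. ?c \<xi> * (\<Sum>k<m. ?m \<xi> ^ k)) / ?N"
      unfolding torus_walk_fourier[OF n x y] sum_divide_distrib[symmetric]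
      by (subst sum.swap) (simp add: sum_distrib_left sum_distrib_right mult.commute)
    also have "(\<Sum>\<xi>\<in>torus n. ?c \<xi> * (\<Sum>k<m. ?m \<xi> ^ k)) = m + (\<Sum>\<xi>\<in>?S. ?c \<xi> * (\<Sum>k<m. ?m \<xi> ^ k))"
    proof -
      have "?c 0 * (\<Sum>k<m. ?m 0 ^ k) = m" by (simp add: phase_def freq_def mean_cos_def)
      then show ?thesis by (simp add: sum.remove[OF fin zero])
    qed
    finally have P: "(\<Sum>k<m. pmf (walk_pmf (torus_nbrs n) x k) y) =
        m / ?N + (\<Sum>\<xi>\<in>?S. ?c \<xi> * (\<Sum>k<m. ?m \<xi> ^ k)) / ?N" by (simp add: add_divide_distrib)
    have geo: "?c \<xi> / (1 - ?m \<xi>) - ?c \<xi> * (\<Sum>k<m. ?m \<xi> ^ k) = ?c \<xi> * (?m \<xi> ^ m / (1 - ?m \<xi>))" if "\<xi> \<in> ?S" for \<xi>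
    proof -
      have ne: "?m \<xi> \<noteq> 1" using gap[OF that] by auto
      have "(\<Sum>k<m. ?m \<xi> ^ k) = (1 - ?m \<xi> ^ m) / (1 - ?m \<xi>)"
        using ne by (simp add: sum_gp_strict)
      then show ?thesis by (simp only: right_diff_distrib diff_divide_distrib) simp
    qed
    have "green_torus n x y - (\<Sum>k<m. pmf (walk_pmf (torus_nbrs n) x k) y) =
      (\<Sum>\<xi>\<in>?S. ?c \<xi> * (?m \<xi> ^ m / (1 - ?m \<xi>))) / ?N - m / ?N"
    proof -
      have "(\<Sum>\<xi>\<in>?S. ?c \<xi> / (1 - ?m \<xi>)) - (\<Sum>\<xi>\<in>?S. ?c \<xi> * (\<Sum>k<m. ?m \<xi> ^ k)) =
         (\<Sum>\<xi>\<in>?S. ?c \<xi> * (?m \<xi> ^ m / (1 - ?m \<xi>)))"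
        unfolding sum_subtractf[symmetric] by (rule sum.cong[OF refl geo])
      moreover have "a / ?N - (m / ?N + b / ?N) = (a - b) / ?N - m / ?N" for a b
        by (simp add: diff_divide_distrib)
      ultimately show ?thesis unfolding P green_torus_fourier[OF n x y] by (simp only:)
    qed
    then have "\<bar>green_torus n x y - (\<Sum>k<m. pmf (walk_pmf (torus_nbrs n) x k) y)\<bar> \<le>
      \<bar>(\<Sum>\<xi>\<in>?S. ?c \<xi> * (?m \<xi> ^ m / (1 - ?m \<xi>))) / ?N\<bar> + m / ?N"
      using abs_triangle_ineq4[of "(\<Sum>\<xi>\<in>?S. ?c \<xi> * (?m \<xi> ^ m / (1 - ?m \<xi>))) / ?N" "m / ?N"] N by simp
    also have "m / ?N \<le> 1 / sqrt m"
    proof -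
      have "sqrt m \<le> m" using m by (intro real_le_lsqrt) (auto simp: power2_eq_square)
      then have "m * sqrt m \<le> real n * real n" using m by (intro mult_mono) auto
      also have "\<dots> \<le> real n ^ 3" using n by (simp add: power3_eq_cube)
      also have "\<dots> \<le> ?N" using n d by (intro power_increasing) auto
      finally show ?thesis using m N by (simp add: field_simps)
    qed
    also have "\<bar>(\<Sum>\<xi>\<in>?S. ?c \<xi> * (?m \<xi> ^ m / (1 - ?m \<xi>))) / ?N\<bar> \<le> (8 * C0 + C1) / sqrt m"
    proof -
      define K where "K = nat \<lceil>real n ^ 2 * sqrt n\<rceil>"
      have K1: "real n ^ 2 * sqrt n \<le> K" unfolding K_def by (rule real_nat_ceiling_ge)
      have sq: "1 \<le> sqrt n" using n by simp
      have n2: "real n < real n ^ 2" using n by (simp add: power2_eq_square)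
      have n2s: "real n ^ 2 \<le> real n ^ 2 * sqrt n" using mult_left_mono[OF sq, of "real n ^ 2"] by simp
      have big: "1 \<le> real n ^ 2 * sqrt n" using n n2 n2s by linarith
      have K2: "K \<le> 2 * (real n ^ 2 * sqrt n)" unfolding K_def using big by linarith
      have mK: "m < K"
      proof -
        have "real m < real K" using m n2 n2s K1 by linarith
        then show ?thesis by simp
      qed
      let ?r = "exp (- real K * (c / real n ^ 2)) / (c / real n ^ 2)"
      have "\<bar>\<Sum>\<xi>\<in>?S. ?c \<xi> * (?m \<xi> ^ m / (1 - ?m \<xi>))\<bar> \<le> (\<Sum>\<xi>\<in>?S. \<bar>?m \<xi>\<bar> ^ m / (1 - ?m \<xi>))"
      proof (rule order_trans[OF sum_abs sum_mono])
        fix \<xi> assume "\<xi> \<in> ?S"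
        then have pos: "0 < 1 - ?m \<xi>" using gap[of \<xi>] by linarith
        have "\<bar>?c \<xi>\<bar> * (\<bar>?m \<xi>\<bar> ^ m / (1 - ?m \<xi>)) \<le> 1 * (\<bar>?m \<xi>\<bar> ^ m / (1 - ?m \<xi>))"
          using pos by (intro mult_right_mono) auto
        then show "\<bar>?c \<xi> * (?m \<xi> ^ m / (1 - ?m \<xi>))\<bar> \<le> \<bar>?m \<xi>\<bar> ^ m / (1 - ?m \<xi>)"
          using pos by (simp add: abs_mult abs_divide power_abs)
      qed
      also have "\<dots> \<le> (\<Sum>\<xi>\<in>?S. (\<Sum>k=m..<K. \<bar>?m \<xi>\<bar> ^ k) + ?r)"
        using mean_cos_abs_le_1 gap mK
        by (intro sum_mono power_div_le_geometric_sum) (auto simp: abs_le_iff minus_le_iff)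
      also have "\<dots> \<le> (\<Sum>\<xi>\<in>torus n. (\<Sum>k=m..<K. \<bar>?m \<xi>\<bar> ^ k) + ?r)"
        using c n by (intro sum_mono2 fin) (auto intro!: add_nonneg_nonneg sum_nonneg)
      also have "\<dots> = (\<Sum>k=m..<K. \<Sum>\<xi>\<in>torus n. \<bar>?m \<xi>\<bar> ^ k) + ?N * (?r)"
        by (simp add: sum.distrib card_torus) (rule sum.swap)
      finally have "\<bar>\<Sum>\<xi>\<in>?S. ?c \<xi> * (?m \<xi> ^ m / (1 - ?m \<xi>))\<bar> / ?N \<le>
         ((\<Sum>k=m..<K. \<Sum>\<xi>\<in>torus n. \<bar>?m \<xi>\<bar> ^ k) + ?N * (?r)) / ?N"
        using N by (intro divide_right_mono) auto
      also have "\<dots> = (\<Sum>k=m..<K. heat_abs TYPE('d) n k) + ?r"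
        using N by (simp add: heat_abs_def add_divide_distrib sum_divide_distrib)
      also have "\<dots> \<le> 8 * C0 / sqrt m + C1 / sqrt m"
      proof (rule add_mono)
        have "(\<Sum>k=m..<K. heat_abs TYPE('d) n k) \<le> (\<Sum>k=m..<K. C0 * (1 / real n ^ 3 + 1 / (k * sqrt k)))"
          using C0(2) n m by (intro sum_mono) auto
        also have "\<dots> = C0 * ((K - m) / real n ^ 3 + (\<Sum>k=m..<K. 1 / (k * sqrt k)))"
          using mK by (simp add: sum.distrib sum_distrib_left distrib_left)
        also have "\<dots> \<le> C0 * (2 / sqrt m + 6 / sqrt m)"
        proof (intro mult_left_mono add_mono sum_three_halves_tail m)
          have "(K - m) / real n ^ 3 \<le> K / real n ^ 3" by (intro divide_right_mono) auto
          also have "\<dots> \<le> 2 * (real n ^ 2 * sqrt n) / real n ^ 3" using K2 by (intro divide_right_mono) auto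
          also have "\<dots> = 2 / sqrt n" using n by (simp add: field_simps power2_eq_square power3_eq_cube)
          also have "\<dots> \<le> 2 / sqrt m" using m by (intro divide_left_mono) auto
          finally show "(K - m) / real n ^ 3 \<le> 2 / sqrt m" .
        qed (use C0 in auto)
        also have "\<dots> = 8 * C0 / sqrt m" by (simp add: field_simps)
        finally show "(\<Sum>k=m..<K. heat_abs TYPE('d) n k) \<le> 8 * C0 / sqrt m" .
        have "sqrt n * c \<le> K * (c / real n ^ 2)"
        proof -
          have "(real n ^ 2 * sqrt n) * (c / real n ^ 2) \<le> K * (c / real n ^ 2)"
            using K1 c by (intro mult_right_mono) auto
          then show ?thesis using n by simp
        qed
        then have "?r \<le> exp (- c * sqrt n) / (c / real n ^ 2)"
          using c by (intro divide_right_mono) (auto simp: mult.commute)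
        also have "\<dots> = (real n ^ 2 * sqrt n * exp (- c * sqrt n) / c) / sqrt n"
          using n c by (simp add: field_simps)
        also have "\<dots> \<le> C1 / sqrt n"
          using C1(2)[of n] c by (intro divide_right_mono) (auto simp: abs_le_iff)
        also have "\<dots> \<le> C1 / sqrt m" using m C1 by (intro divide_left_mono) auto
        finally show "?r \<le> C1 / sqrt m" .
      qed
      finally show ?thesis using N by (simp add: abs_divide add_divide_distrib)
    qed
    finally show "\<bar>green_torus n x y - (\<Sum>k<m. pmf (walk_pmf (torus_nbrs n) x k) y)\<bar> \<le> (1 + 8 * C0 + C1) / sqrt m"
      by (simp add: add_divide_distrib)
  qed
qed

text \<open>The \<open>k\<close>-step return probability on the lattice equals that on the torus of side \<open>k + 3\<close>, which
transfers the decay \<open>k\<^sup>-\<^sup>3\<^sup>/\<^sup>2\<close> to the lattice.\<close>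

lemma green_lattice_partial_sum:
  assumes d: "CARD('d::finite) \<ge> 3"
  obtains C where "C > 0" "summable (\<lambda>k. pmf (walk_pmf lattice_nbrs (0 :: int ^ 'd) k) 0)"
    "\<And>m. 1 \<le> m \<Longrightarrow> \<bar>green_lattice (0 :: int ^ 'd) 0 - (\<Sum>k<m. pmf (walk_pmf lattice_nbrs (0 :: int ^ 'd) k) 0)\<bar> \<le> C / sqrt m"
proof -
  obtain C0 where C0: "C0 > 0" "\<And>n k. n > 0 \<Longrightarrow> k > 0 \<Longrightarrow>
    heat_abs TYPE('d) n k \<le> C0 * (1 / real n ^ 3 + 1 / (k * sqrt k))"
    using heat_abs_decay[OF d] by blast
  define p where "p = (\<lambda>k. pmf (walk_pmf lattice_nbrs (0 :: int ^ 'd) k) 0)"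
  have p0: "0 \<le> p k" for k by (simp add: p_def)
  have pk: "p k \<le> 2 * C0 * (1 / (k * sqrt k))" if k: "k > 0" for k
  proof -
    let ?n = "k + 3"
    have z: "0 \<in> (torus ?n :: (int ^ 'd) set)" by (simp add: torus_def)
    have "p k = (\<Sum>\<xi>\<in>torus ?n. mean_cos (freq ?n (\<xi> :: int ^ 'd)) ^ k) / real ?n ^ CARD('d)"
      unfolding p_def lattice_return_eq_torus_return[of ?n k, simplified] torus_walk_fourier[OF _ z z, simplified]
      by (simp add: phase_def)
    also have "\<dots> \<le> heat_abs TYPE('d) ?n k"
      unfolding heat_abs_def
      by (intro divide_right_mono sum_mono) (auto simp flip: power_abs)
    also have "\<dots> \<le> C0 * (1 / real ?n ^ 3 + 1 / (k * sqrt k))" by (rule C0(2)) (use k in auto)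
    also have "\<dots> \<le> C0 * (1 / (k * sqrt k) + 1 / (k * sqrt k))"
    proof (intro mult_left_mono add_right_mono divide_left_mono)
      have "sqrt k \<le> k" using k by (intro real_le_lsqrt) (auto simp: power2_eq_square)
      then have "k * sqrt k \<le> real ?n * real ?n" by (intro mult_mono) auto
      also have "\<dots> \<le> real ?n ^ 3" by (simp add: power3_eq_cube)
      finally show "k * sqrt k \<le> real ?n ^ 3" .
    qed (use k C0 in auto)
    also have "\<dots> = 2 * C0 * (1 / (k * sqrt k))" by simp
    finally show ?thesis .
  qed
  have tail: "(\<Sum>k=m..<K. p k) \<le> 12 * C0 / sqrt m" if m: "1 \<le> m" for m K
  proof -
    have "(\<Sum>k=m..<K. p k) \<le> (\<Sum>k=m..<K. 2 * C0 * (1 / (k * sqrt k)))"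
      using m by (intro sum_mono pk) auto
    also have "\<dots> \<le> 2 * C0 * (6 / sqrt m)"
      unfolding sum_distrib_left[symmetric] using C0 sum_three_halves_tail[OF m, of K] by (intro mult_left_mono) auto
    finally show ?thesis by simp
  qed
  have part: "(\<Sum>k<K. p k) \<le> (\<Sum>k<m. p k) + 12 * C0 / sqrt m" if m: "1 \<le> m" for m K
  proof (cases "m \<le> K")
    case True
    have "(\<Sum>k<K. p k) = (\<Sum>k<m. p k) + (\<Sum>k=m..<K. p k)"
      using sum.atLeastLessThan_concat[of 0 m K p] True by (simp add: atLeast0LessThan)
    then show ?thesis using tail[OF m, of K] by simp
  next
    case False
    then have "(\<Sum>k<K. p k) \<le> (\<Sum>k<m. p k)" using p0 by (intro sum_mono2) auto
    then show ?thesis using C0 by (simp add: add_increasing2)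
  qed
  have summ: "summable p" by (rule summableI_nonneg_bounded[OF p0 part[of 1]]) simp
  have g: "green_lattice (0 :: int ^ 'd) 0 = (\<Sum>k. p k)"
    unfolding green_lattice_def p_def srw_marginal ..
  show ?thesis
  proof (rule that[of "12 * C0"])
    show "12 * C0 > 0" using C0 by simp
    show "summable (\<lambda>k. pmf (walk_pmf lattice_nbrs (0 :: int ^ 'd) k) 0)" using summ by (simp add: p_def)
    fix m :: nat assume m: "1 \<le> m"
    have "(\<Sum>k. p k) \<le> (\<Sum>k<m. p k) + 12 * C0 / sqrt m" by (rule suminf_le_const[OF summ part[OF m]])
    moreover have "(\<Sum>k<m. p k) \<le> (\<Sum>k. p k)" by (rule sum_le_suminf[OF summ]) (auto simp: p0)
    ultimately show "\<bar>green_lattice (0 :: int ^ 'd) 0 - (\<Sum>k<m. pmf (walk_pmf lattice_nbrs (0 :: int ^ 'd) k) 0)\<bar> \<le> 12 * C0 / sqrt m"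
      unfolding g by (simp add: p_def)
  qed
qed

lemma green_torus_diag:
  fixes x :: "int ^ 'd"
  assumes n: "n \<ge> 3" and x: "x \<in> torus n"
  shows "green_torus n x x = green_torus n (0 :: int ^ 'd) 0"
proof -
  have 0: "(0 :: int ^ 'd) \<in> torus n" using n by (simp add: torus_def)
  show ?thesis by (simp add: green_torus_fourier[OF n x x] green_torus_fourier[OF n 0 0])
qed

text \<open>In \<open>G(x,x) - G(x,y)\<close> every Fourier term is nonnegative and at least \<open>(1 - cos) / 2\<close>, as
\<open>1 - mean_cos \<le> 2\<close>; off the diagonal the cosines sum to zero.\<close>

lemma green_torus_offdiag_gap:
  fixes x y :: "int ^ 'd"
  assumes n: "n \<ge> 3" and x: "x \<in> torus n" and y: "y \<in> torus n" and xy: "x \<noteq> y"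
  shows "green_torus n x y \<le> green_torus n (0 :: int ^ 'd) 0 - 1 / 2"
proof -
  let ?N = "real n ^ CARD('d)" and ?S = "torus n - {0 :: int ^ 'd}"
  let ?c = "\<lambda>\<xi> :: int ^ 'd. cos (phase (freq n \<xi>) (x - y))" and ?m = "\<lambda>\<xi> :: int ^ 'd. mean_cos (freq n \<xi>)"
  have N: "?N > 0" using n by simp
  have zero: "0 \<in> (torus n :: (int ^ 'd) set)" using n by (simp add: torus_def)
  have "\<not> (\<forall>i. int n dvd (x - y) $ i)"
    using torus_proj_eq_iff[OF y, of x] torus_proj_id[OF x] xy by simp
  then have sum0: "(\<Sum>\<xi>\<in>torus n. ?c \<xi>) = 0"
    using torus_cos_orthogonality[of n "x - y"] n by simp
  have "?N / 2 = (\<Sum>\<xi>\<in>torus n. (1 - ?c \<xi>) / 2)"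
    using sum0 by (simp add: sum_subtractf diff_divide_distrib sum_divide_distrib[symmetric] card_torus)
  also have "\<dots> = (\<Sum>\<xi>\<in>?S. (1 - ?c \<xi>) / 2)"
    by (subst sum.remove[OF finite_torus zero]) (simp add: phase_def freq_def)
  also have "\<dots> \<le> (\<Sum>\<xi>\<in>?S. (1 - ?c \<xi>) / (1 - ?m \<xi>))"
  proof (intro sum_mono divide_left_mono)
    fix \<xi> assume \<xi>: "\<xi> \<in> ?S"
    have "0 < 8 / (CARD('d) * real n ^ 2)" using n by simp
    also have "\<dots> \<le> 1 - ?m \<xi>" using mean_cos_gap[of \<xi> n] \<xi> by blast
    finally show "0 < 2 * (1 - ?m \<xi>)" by simp
    show "1 - ?m \<xi> \<le> 2" using mean_cos_abs_le_1[of "freq n \<xi>"] by (simp add: abs_le_iff)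
  qed simp
  also have "\<dots> = ?N * (green_torus n x x - green_torus n x y)"
    unfolding green_torus_fourier[OF n x x] green_torus_fourier[OF n x y]
    using N by (simp add: phase_def diff_divide_distrib sum_subtractf right_diff_distrib)
  finally have "1 / 2 \<le> green_torus n x x - green_torus n x y" using N by simp
  then show ?thesis using green_torus_diag[OF n x] by simp
qed

lemma green_lattice_ge_1:
  assumes "CARD('d::finite) \<ge> 3"
  shows "1 \<le> green_lattice (0 :: int ^ 'd) 0"
proof -
  have s: "summable (\<lambda>k. pmf (walk_pmf lattice_nbrs (0 :: int ^ 'd) k) 0)"
    using green_lattice_partial_sum[OF assms] by metis
  have "(\<Sum>k<1. pmf (walk_pmf lattice_nbrs (0 :: int ^ 'd) k) 0) \<le> (\<Sum>k. pmf (walk_pmf lattice_nbrs (0 :: int ^ 'd) k) 0)"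
    by (rule sum_le_suminf[OF s]) auto
  then show ?thesis unfolding green_lattice_def srw_marginal by simp
qed

definition torus_box :: "nat \<Rightarrow> nat \<Rightarrow> int ^ 'd \<Rightarrow> (int ^ 'd) set" where
  "torus_box n m x = (\<lambda>w. torus_proj n (x + w)) ` {w. \<forall>i. \<bar>w $ i\<bar> \<le> int m}"

lemma torus_box_subset: "n > 0 \<Longrightarrow> torus_box n m x \<subseteq> torus n"
  by (auto simp: torus_box_def torus_proj_def torus_def)

lemma in_torus_box: "x \<in> torus n \<Longrightarrow> x \<in> torus_box n m x"
  unfolding torus_box_def by (rule image_eqI[of _ _ 0]) (auto simp: torus_proj_id)

text \<open>A translate of the torus of side \<open>2 m + 1\<close> parametrises the cube of radius \<open>m\<close>.\<close>

lemma card_torus_box: "card (torus_box n m (x :: int ^ 'd)) \<le> (2 * m + 1) ^ CARD('d)"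
proof -
  let ?T = "torus (2 * m + 1) :: (int ^ 'd) set"
  have "torus_box n m x \<subseteq> (\<lambda>\<xi>. torus_proj n (x + (\<xi> - (\<chi> i. int m)))) ` ?T"
  proof
    fix y assume "y \<in> torus_box n m x"
    then obtain w where w: "\<And>i. \<bar>w $ i\<bar> \<le> int m" "y = torus_proj n (x + w)"
      by (auto simp: torus_box_def)
    have "w + (\<chi> i. int m) \<in> ?T" using w(1) by (auto simp: torus_def abs_le_iff minus_le_iff) (smt (verit))+
    then show "y \<in> (\<lambda>\<xi>. torus_proj n (x + (\<xi> - (\<chi> i. int m)))) ` ?T"
      using w(2) by (intro image_eqI[of _ _ "w + (\<chi> i. int m)"]) auto
  qed
  then have "card (torus_box n m x) \<le> card ?T"
    by (rule surj_card_le[OF finite_torus])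
  then show ?thesis by (simp add: card_torus)
qed

text \<open>Within \<open>n\<close> steps torus and lattice walk have the same return probabilities, and within \<open>m\<close>
steps the walk stays in the box of radius \<open>m\<close>; in both cases the partial sums cancel or vanish and
only the error terms remain.\<close>

lemma green_torus_estimates:
  assumes d: "CARD('d::finite) \<ge> 3"
  obtains C where "C > 0"
    "\<And>n. n \<ge> 3 \<Longrightarrow> \<bar>green_torus n (0 :: int ^ 'd) 0 - green_lattice (0 :: int ^ 'd) 0\<bar> \<le> C / sqrt n"
    "\<And>n m x y. n \<ge> 3 \<Longrightarrow> 1 \<le> m \<Longrightarrow> m \<le> n \<Longrightarrow> x \<in> torus n \<Longrightarrow> (y :: int ^ 'd) \<in> torus n \<Longrightarrow>
      y \<notin> torus_box n m x \<Longrightarrow> \<bar>green_torus n x y\<bar> \<le> C / sqrt m"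
proof -
  obtain C1 where C1: "C1 > 0" "\<And>n m x y. n \<ge> 3 \<Longrightarrow> 1 \<le> m \<Longrightarrow> m \<le> n \<Longrightarrow> x \<in> torus n \<Longrightarrow> y \<in> torus n \<Longrightarrow>
    \<bar>green_torus n x (y :: int ^ 'd) - (\<Sum>k<m. pmf (walk_pmf (torus_nbrs n) x k) y)\<bar> \<le> C1 / sqrt m"
    using green_torus_partial_sum[OF d] by blast
  obtain C2 where C2: "C2 > 0"
    "\<And>m. 1 \<le> m \<Longrightarrow> \<bar>green_lattice (0 :: int ^ 'd) 0 - (\<Sum>k<m. pmf (walk_pmf lattice_nbrs (0 :: int ^ 'd) k) 0)\<bar> \<le> C2 / sqrt m"
    using green_lattice_partial_sum[OF d] by metis
  show ?thesis
  proof (rule that[of "C1 + C2"])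
    show "C1 + C2 > 0" using C1 C2 by simp
  next
    fix n :: nat assume n: "n \<ge> 3"
    have zero: "0 \<in> (torus n :: (int ^ 'd) set)" using n by (simp add: torus_def)
    have "(\<Sum>k<n. pmf (walk_pmf lattice_nbrs (0 :: int ^ 'd) k) 0) = (\<Sum>k<n. pmf (walk_pmf (torus_nbrs n) (0 :: int ^ 'd) k) 0)"
      using n by (intro sum.cong lattice_return_eq_torus_return) auto
    then show "\<bar>green_torus n (0 :: int ^ 'd) 0 - green_lattice (0 :: int ^ 'd) 0\<bar> \<le> (C1 + C2) / sqrt n"
      using C1(2)[OF n _ order_refl zero zero] C2(2)[of n] n by (simp add: add_divide_distrib)
  next
    fix n m :: nat and x y :: "int ^ 'd"
    assume n: "n \<ge> 3" and m: "1 \<le> m" "m \<le> n" and x: "x \<in> torus n" and y: "y \<in> torus n" and far: "y \<notin> torus_box n m x"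
    have "pmf (walk_pmf (torus_nbrs n) x k) y = 0" if "k < m" for k
    proof (rule torus_walk_far[OF n x])
      fix w :: "int ^ 'd" assume "\<forall>i. \<bar>w $ i\<bar> \<le> int k"
      then have "\<forall>i. \<bar>w $ i\<bar> \<le> int m" using that by (meson le_less_trans less_imp_le of_nat_less_iff)
      then show "torus_proj n (x + w) \<noteq> y" using far by (auto simp: torus_box_def)
    qed
    then have "\<bar>green_torus n x y\<bar> \<le> C1 / sqrt m" using C1(2)[OF n m x y] by simp
    also have "\<dots> \<le> (C1 + C2) / sqrt m" using C2 by (intro divide_right_mono) auto
    finally show "\<bar>green_torus n x y\<bar> \<le> (C1 + C2) / sqrt m" .
  qed
qed

section \<open>Independence from characteristic functions\<close>

text \<open>Uniqueness of characteristic functions for a signed measure: apply Levy's uniqueness theorem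
to the laws of \<open>Y\<close> under the normalised densities \<open>D\<^sup>+\<close> and \<open>D\<^sup>-\<close>, which have equal mass by the
case \<open>s = 0\<close>.\<close>

lemma signed_char_eq_zero_real:
  fixes D Y :: "'w \<Rightarrow> real"
  assumes "prob_space M"
    and [measurable]: "D \<in> borel_measurable M" "Y \<in> borel_measurable M"
    and bd: "\<And>w. w \<in> space M \<Longrightarrow> \<bar>D w\<bar> \<le> B"
    and 0: "\<And>s. (LINT w|M. complex_of_real (D w) * iexp (s * Y w)) = 0"
    and A[measurable]: "A \<in> sets borel"
  shows "(LINT w|M. D w * indicator A (Y w)) = 0"
proof -
  interpret prob_space M by fact
  define p where "p = (\<lambda>w. max 0 (D w))"
  define q where "q = (\<lambda>w. max 0 (- D w))"
  have [measurable]: "p \<in> borel_measurable M" "q \<in> borel_measurable M"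
    by (simp_all add: p_def q_def)
  have pos: "0 \<le> p w" "0 \<le> q w" for w by (simp_all add: p_def q_def)
  have bdp: "p w \<le> \<bar>B\<bar>" "q w \<le> \<bar>B\<bar>" if "w \<in> space M" for w
    using bd[OF that] by (auto simp: p_def q_def)
  have D: "D w = p w - q w" for w by (simp add: p_def q_def)
  have int: "integrable M (\<lambda>w. p w)" "integrable M (\<lambda>w. q w)"
    by (rule integrable_const_bound[of _ "\<bar>B\<bar>"]; use pos bdp in auto)+
  have intc: "integrable M (\<lambda>w. complex_of_real (p w) * iexp (s * Y w))"
       "integrable M (\<lambda>w. complex_of_real (q w) * iexp (s * Y w))" for s
    by (rule integrable_const_bound[of _ "\<bar>B\<bar>"]; use pos bdp in \<open>auto simp: norm_mult\<close>)+
  have eqc: "(LINT w|M. complex_of_real (p w) * iexp (s * Y w)) = (LINT w|M. complex_of_real (q w) * iexp (s * Y w))" for s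
    using 0[of s] Bochner_Integration.integral_diff[OF intc[of s]] by (simp add: D left_diff_distrib)
  define m where "m = (LINT w|M. p w)"
  have "complex_of_real (LINT w|M. p w) = complex_of_real (LINT w|M. q w)"
    using eqc[of 0] by (simp flip: integral_complex_of_real)
  then have mq: "m = (LINT w|M. q w)" by (simp add: m_def)
  have m0: "m \<ge> 0" by (simp add: m_def pos)
  show ?thesis
  proof (cases "m = 0")
    case True
    have "AE w in M. p w = 0" using True int pos unfolding m_def by (subst (asm) integral_nonneg_eq_0_iff_AE) auto
    moreover have "AE w in M. q w = 0" using True int pos unfolding mq by (subst (asm) integral_nonneg_eq_0_iff_AE) auto
    ultimately have "AE w in M. D w * indicator A (Y w) = 0" by eventually_elim (simp add: D)
    then show ?thesis by (rule integral_eq_zero_AE)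
  next
    case False
    then have m: "m > 0" using m0 by simp
    define R where "R = (\<lambda>f. distr (density M (\<lambda>w. ennreal (f w / m))) borel Y)"
    have R: "real_distribution (R f) \<and> (\<forall>s. char (R f) s = (LINT w|M. complex_of_real (f w) * iexp (s * Y w)) / m)
        \<and> measure (R f) A = (LINT w|M. f w * indicator A (Y w)) / m"
      if [measurable]: "f \<in> borel_measurable M" and fpos: "\<And>w. 0 \<le> f w" and fi: "integrable M f"
        and fm: "(LINT w|M. f w) = m" for f
    proof -
      let ?Q = "density M (\<lambda>w. ennreal (f w / m))"
      have "emeasure ?Q (space M) = (\<integral>\<^sup>+w. ennreal (f w / m) \<partial>M)"
        by (subst emeasure_density) (auto intro!: nn_integral_cong)
      also have "\<dots> = ennreal (LINT w|M. f w / m)"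
        using fi fpos m by (intro nn_integral_eq_integral) auto
      also have "\<dots> = 1" using fm m by simp
      finally have Q: "prob_space ?Q" by (intro prob_spaceI) simp
      interpret Q: prob_space ?Q by fact
      have "real_distribution (R f)"
        unfolding R_def by (rule Q.real_distribution_distr) simp
      moreover have "char (R f) s = (LINT w|M. complex_of_real (f w) * iexp (s * Y w)) / m" for s
      proof -
        have "char (R f) s = (LINT w|?Q. iexp (s * Y w))"
          unfolding char_def R_def by (subst integral_distr) auto
        also have "\<dots> = (LINT w|M. (f w / m) *\<^sub>R iexp (s * Y w))"
          using fpos m by (subst integral_density) auto
        also have "\<dots> = (LINT w|M. complex_of_real (f w) * iexp (s * Y w) / m)"
          by (simp add: scaleR_conv_of_real)
        also have "\<dots> = (LINT w|M. complex_of_real (f w) * iexp (s * Y w)) / m" by simp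
        finally show ?thesis .
      qed
      moreover have "measure (R f) A = (LINT w|M. f w * indicator A (Y w)) / m"
      proof -
        have "measure (R f) A = (LINT x|R f. indicator A x)" by (simp add: R_def)
        also have "\<dots> = (LINT w|?Q. indicator A (Y w))"
          unfolding R_def by (subst integral_distr) auto
        also have "\<dots> = (LINT w|M. (f w / m) *\<^sub>R indicator A (Y w))"
          using fpos m by (subst integral_density) auto
        also have "\<dots> = (LINT w|M. f w * indicator A (Y w) / m)" by simp
        finally show ?thesis by simp
      qed
      ultimately show ?thesis by blast
    qed
    have "R p = R q"
      using R[of p] R[of q] int pos eqc mq m_def by (intro Levy_uniqueness) auto
    then have "(LINT w|M. p w * indicator A (Y w)) = (LINT w|M. q w * indicator A (Y w))"
      using R[of p] R[of q] int pos mq m_def m by auto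
    moreover have "integrable M (\<lambda>w. p w * indicator A (Y w))" "integrable M (\<lambda>w. q w * indicator A (Y w))"
      by (rule integrable_const_bound[of _ "\<bar>B\<bar>"]; use pos bdp in \<open>auto simp: indicator_def\<close>)+
    ultimately show ?thesis by (simp add: D left_diff_distrib)
  qed
qed

text \<open>Conjugation together with \<open>s \<mapsto> - s\<close> shows that the hypothesis passes to the real and the
imaginary part of \<open>D\<close>.\<close>

lemma signed_char_eq_zero:
  fixes D :: "'w \<Rightarrow> complex" and Y :: "'w \<Rightarrow> real"
  assumes "prob_space M"
    and [measurable]: "D \<in> borel_measurable M" "Y \<in> borel_measurable M"
    and bd: "\<And>w. w \<in> space M \<Longrightarrow> norm (D w) \<le> B"
    and 0: "\<And>s. (LINT w|M. D w * iexp (s * Y w)) = 0"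
    and A[measurable]: "A \<in> sets borel"
  shows "(LINT w|M. D w * indicator A (Y w)) = 0"
proof -
  interpret prob_space M by fact
  have int: "integrable M (\<lambda>w. D w * iexp (s * Y w))" for s
    by (rule integrable_const_bound[of _ "B"]; use bd in \<open>auto simp: norm_mult\<close>)
  have [measurable]: "cnj \<in> borel_measurable borel"
    by (intro borel_measurable_continuous_onI continuous_intros)
  have intcn: "integrable M (\<lambda>w. cnj (D w) * iexp (s * Y w))" for s
    by (rule integrable_const_bound[of _ "B"]; use bd in \<open>auto simp: norm_mult\<close>)
  have cn: "(LINT w|M. cnj (D w) * iexp (s * Y w)) = 0" for s
  proof -
    have "(LINT w|M. cnj (D w) * iexp (s * Y w)) = (LINT w|M. cnj (D w * iexp ((-s) * Y w)))"
      by (intro Bochner_Integration.integral_cong) (auto simp: exp_cnj)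
    also have "\<dots> = cnj (LINT w|M. D w * iexp ((-s) * Y w))" by (rule Bochner_Integration.integral_cnj)
    finally show ?thesis using 0[of "-s"] by simp
  qed
  have re: "(LINT w|M. complex_of_real (Re (D w)) * iexp (s * Y w)) = 0" for s
  proof -
    have "(LINT w|M. complex_of_real (Re (D w)) * iexp (s * Y w)) =
       (LINT w|M. (D w * iexp (s * Y w) + cnj (D w) * iexp (s * Y w)) / 2)"
      by (intro Bochner_Integration.integral_cong) (auto simp: complex_eq_iff algebra_simps)
    also have "\<dots> = 0" using 0[of s] cn[of s] int intcn by simp
    finally show ?thesis .
  qed
  have im: "(LINT w|M. complex_of_real (Im (D w)) * iexp (s * Y w)) = 0" for s
  proof -
    have "(LINT w|M. complex_of_real (Im (D w)) * iexp (s * Y w)) =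
       (LINT w|M. (D w * iexp (s * Y w) - cnj (D w) * iexp (s * Y w)) / (2 * \<i>))"
    proof (intro Bochner_Integration.integral_cong refl)
      fix w
      have "complex_of_real (Im (D w)) = (D w - cnj (D w)) / (2 * \<i>)"
        by (simp add: complex_eq_iff)
      then show "complex_of_real (Im (D w)) * iexp (s * Y w) =
          (D w * iexp (s * Y w) - cnj (D w) * iexp (s * Y w)) / (2 * \<i>)"
        by (simp only: left_diff_distrib times_divide_eq_left)
    qed
    also have "\<dots> = 0" using 0[of s] cn[of s] int intcn by simp
    finally show ?thesis .
  qed
  have iA: "integrable M (\<lambda>w. D w * indicator A (Y w))"
    by (rule integrable_const_bound[of _ "\<bar>B\<bar>"]; use bd in \<open>fastforce simp: norm_mult indicator_def intro: order_trans[OF _ abs_ge_self]\<close>)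
  have "(LINT w|M. Re (D w) * indicator A (Y w)) = 0"
    by (rule signed_char_eq_zero_real[OF \<open>prob_space M\<close>, where B=B])
      (use bd re in \<open>auto intro: order_trans[OF abs_Re_le_cmod]\<close>)
  moreover have "(LINT w|M. Im (D w) * indicator A (Y w)) = 0"
    by (rule signed_char_eq_zero_real[OF \<open>prob_space M\<close>, where B=B])
      (use bd im in \<open>auto intro: order_trans[OF abs_Im_le_cmod]\<close>)
  moreover have "Re (D w * indicator A (Y w)) = Re (D w) * indicator A (Y w)"
    "Im (D w * indicator A (Y w)) = Im (D w) * indicator A (Y w)" for w
    by (auto simp: indicator_def)
  ultimately show ?thesis
    using integral_Re[OF iA] integral_Im[OF iA] by (simp add: complex_eq_iff)
qed

lemma iexp_add: "iexp (a + b) = iexp a * iexp b"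
  by (simp add: distrib_left exp_add)

text \<open>A form of independence of \<open>X\<close> and the vector \<open>Y\<close>.  By \<open>signed_char_eq_zero\<close> an exponential of
one real variable may be exchanged for an indicator function of it while all other factors are kept
as a complex density.  Doing so first for \<open>X\<close> and then successively for the coordinates of \<open>Y\<close>
avoids a uniqueness theorem for characteristic functions in several dimensions.\<close>

lemma char_factor_imp_product_factor:
  fixes X :: "'w \<Rightarrow> real" and Y :: "'v \<Rightarrow> 'w \<Rightarrow> real"
  assumes "prob_space M" and J: "finite J"
    and X[measurable]: "X \<in> borel_measurable M"
    and Y[measurable]: "\<And>j. j \<in> J \<Longrightarrow> Y j \<in> borel_measurable M"
    and fac: "\<And>t c. (LINT w|M. iexp (t * X w + (\<Sum>j\<in>J. c j * Y j w))) =
        (LINT w|M. iexp (t * X w)) * (LINT w|M. iexp (\<Sum>j\<in>J. c j * Y j w))"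
    and A[measurable]: "A \<in> sets borel" and B[measurable]: "\<And>j. j \<in> J \<Longrightarrow> B j \<in> sets borel"
  shows "(LINT w|M. indicator A (X w) * (\<Prod>j\<in>J. 1 - s * indicator (B j) (Y j w))) =
    (LINT w|M. indicator A (X w)) * (LINT w|M. (\<Prod>j\<in>J. 1 - s * indicator (B j) (Y j w)) :: real)"
proof -
  interpret prob_space M by fact
  define a where "a = (LINT w|M. indicator A (X w) :: real)"
  define Z where "Z = (\<lambda>w. indicator A (X w) - a)"
  have [measurable]: "Z \<in> borel_measurable M" by (simp add: Z_def)
  have ab: "0 \<le> a" "a \<le> 1"
  proof -
    show "0 \<le> a" by (simp add: a_def)
    have "a \<le> (LINT w|M. 1)" unfolding a_def
      by (intro integral_mono integrable_const_bound[of _ 1]) (auto simp: indicator_def)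
    then show "a \<le> 1" by (simp add: prob_space)
  qed
  have Zb: "\<bar>Z w\<bar> \<le> 1" for w using ab by (auto simp: Z_def indicator_def)
  define P where "P = (\<lambda>K w. (\<Prod>j\<in>K. 1 - s * indicator (B j) (Y j w)) :: real)"
  have P[measurable]: "P K \<in> borel_measurable M" if "K \<subseteq> J" for K
    unfolding P_def using that by (intro borel_measurable_prod) (auto intro!: borel_measurable_diff)
  have Pb: "\<bar>P K w\<bar> \<le> (1 + \<bar>s\<bar>) ^ card K" for K w
  proof -
    have "\<bar>P K w\<bar> = (\<Prod>j\<in>K. \<bar>1 - s * indicator (B j) (Y j w)\<bar>)" by (simp add: P_def abs_prod)
    also have "\<dots> \<le> (\<Prod>j\<in>K. 1 + \<bar>s\<bar>)" by (intro prod_mono) (auto simp: indicator_def)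
    finally show ?thesis by simp
  qed
  have ii: "integrable M (\<lambda>w. iexp (f w))" if [measurable]: "f \<in> borel_measurable M" for f :: "'w \<Rightarrow> real"
    by (rule integrable_const_bound[of _ 1]) auto
  have S[measurable]: "(\<lambda>w. \<Sum>j\<in>K. c j * Y j w) \<in> borel_measurable M" if "K \<subseteq> J" for K c
    using that by (intro borel_measurable_sum) auto
  have S'[measurable]: "(\<lambda>w. \<Sum>j\<in>J. c j * Y j w) \<in> borel_measurable M" for c
    by (rule S) simp
  have base: "(LINT w|M. complex_of_real (Z w) * iexp (\<Sum>j\<in>J. c j * Y j w)) = 0" for c
  proof -
    let ?U = "\<lambda>w. iexp (\<Sum>j\<in>J. c j * Y j w)"
    define e where "e = (LINT w|M. ?U w)"
    have iU: "integrable M ?U" by (rule ii) simp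
    have ne: "norm e \<le> 1"
    proof -
      have "norm e \<le> (LINT w|M. norm (?U w))" unfolding e_def by (rule integral_norm_bound)
      then show ?thesis by (simp add: prob_space)
    qed
    have "(LINT w|M. (?U w - e) * indicator A (X w)) = 0"
    proof (rule signed_char_eq_zero[OF \<open>prob_space M\<close>, where B=2])
      show "norm (?U w - e) \<le> 2" for w
        using norm_triangle_ineq4[of "?U w" e] ne by (simp add: norm_exp_eq_Re)
      fix t
      have "(LINT w|M. (?U w - e) * iexp (t * X w)) = (LINT w|M. iexp (t * X w + (\<Sum>j\<in>J. c j * Y j w)) - e * iexp (t * X w))"
        by (intro Bochner_Integration.integral_cong refl, unfold iexp_add, simp only: left_diff_distrib mult.commute[of "iexp (t * _)"])
      also have "\<dots> = (LINT w|M. iexp (t * X w + (\<Sum>j\<in>J. c j * Y j w))) - e * (LINT w|M. iexp (t * X w))"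
      proof (subst Bochner_Integration.integral_diff)
        show "integrable M (\<lambda>w. iexp (t * X w + (\<Sum>j\<in>J. c j * Y j w)))" by (rule ii) simp
        show "integrable M (\<lambda>w. e * iexp (t * X w))" by (rule integrable_mult_right, rule ii) simp
      qed (simp only: integral_mult_right_zero)
      also have "\<dots> = 0" using fac[of t c] by (simp add: e_def)
      finally show "(LINT w|M. (?U w - e) * iexp (t * X w)) = 0" .
    qed (auto simp: A)
    moreover have "integrable M (\<lambda>w. ?U w * indicator A (X w))"
      by (rule integrable_const_bound[of _ 1]) (auto simp: norm_mult indicator_def)
    moreover have "integrable M (\<lambda>w. e * indicator A (X w))"
      by (rule integrable_const_bound[of _ 1]) (use ne in \<open>auto simp: norm_mult indicator_def\<close>)
    ultimately have "(LINT w|M. ?U w * indicator A (X w)) = (LINT w|M. e * indicator A (X w))"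
      by (simp add: left_diff_distrib)
    also have "\<dots> = e * (LINT w|M. indicator A (X w))" by simp
    also have "(LINT w|M. indicator A (X w) :: complex) = (LINT w|M. complex_of_real (indicator A (X w)))"
      by (intro Bochner_Integration.integral_cong) (auto simp: indicator_def)
    also have "\<dots> = complex_of_real a" unfolding a_def by (rule integral_complex_of_real)
    finally have 1: "(LINT w|M. ?U w * indicator A (X w)) = a * e" by simp
    have "(LINT w|M. complex_of_real (Z w) * ?U w) = (LINT w|M. ?U w * indicator A (X w) - a * ?U w)"
      by (intro Bochner_Integration.integral_cong) (auto simp: Z_def indicator_def algebra_simps)
    also have "\<dots> = (LINT w|M. ?U w * indicator A (X w)) - a * e"
      by (subst Bochner_Integration.integral_diff) (use \<open>integrable M (\<lambda>w. ?U w * indicator A (X w))\<close> iU in \<open>auto simp: e_def\<close>)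
    finally show ?thesis using 1 by simp
  qed
  have main: "(LINT w|M. complex_of_real (Z w * P K w) * iexp (\<Sum>j\<in>J-K. c j * Y j w)) = 0"
    if "K \<subseteq> J" for K c
  proof -
    have "finite K" using that J finite_subset by blast
    then show ?thesis using that
    proof (induction K arbitrary: c)
      case empty
      show ?case using base[of c] by (simp add: P_def)
    next
      case (insert k K)
      then have k: "k \<in> J" and K: "K \<subseteq> J" by auto
      let ?D = "\<lambda>w. complex_of_real (Z w * P K w) * iexp (\<Sum>j\<in>J-insert k K. c j * Y j w)"
      have [measurable]: "Y k \<in> borel_measurable M" "P K \<in> borel_measurable M" "B k \<in> sets borel"
        "(\<lambda>w. \<Sum>j\<in>J-insert k K. c j * Y j w) \<in> borel_measurable M"
        using k K Y B P S[of "J-insert k K"] by auto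
      have D0: "(LINT w|M. ?D w * iexp (t * Y k w)) = 0" for t
      proof -
        have "(LINT w|M. ?D w * iexp (t * Y k w)) =
           (LINT w|M. complex_of_real (Z w * P K w) * iexp (\<Sum>j\<in>J-K. (c(k:=t)) j * Y j w))"
        proof (intro Bochner_Integration.integral_cong refl)
          fix w
          have "J - K - {k} = J - insert k K" by auto
          then have "(\<Sum>j\<in>J-K. (c(k:=t)) j * Y j w) = t * Y k w + (\<Sum>j\<in>J-insert k K. (c(k:=t)) j * Y j w)"
            using sum.remove[of "J - K" k "\<lambda>j. (c(k:=t)) j * Y j w"] J k insert.hyps(2) by simp
          also have "(\<Sum>j\<in>J-insert k K. (c(k:=t)) j * Y j w) = (\<Sum>j\<in>J-insert k K. c j * Y j w)"
            by (intro sum.cong) auto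
          finally show "?D w * iexp (t * Y k w) = complex_of_real (Z w * P K w) * iexp (\<Sum>j\<in>J-K. (c(k:=t)) j * Y j w)"
            by (simp only: iexp_add mult.assoc mult.commute[of "iexp (t * Y k w)"])
        qed
        also have "\<dots> = 0" by (rule insert.IH[OF K])
        finally show ?thesis .
      qed
      have Db: "norm (?D w) \<le> (1 + \<bar>s\<bar>) ^ card K" for w
        using mult_mono[OF Zb[of w] Pb[of K w]] by (simp add: norm_mult abs_mult)
      have Dm[measurable]: "?D \<in> borel_measurable M" by measurable
      have 1: "(LINT w|M. ?D w * indicator (B k) (Y k w)) = 0"
        by (rule signed_char_eq_zero[OF \<open>prob_space M\<close>, where B="(1 + \<bar>s\<bar>) ^ card K"])
          (use D0 Db in auto)
      have 2: "(LINT w|M. ?D w) = 0" using D0[of 0] by simp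
      have i1: "integrable M ?D" by (rule integrable_const_bound[OF _ Dm]) (use Db in auto)
      have i2: "integrable M (\<lambda>w. ?D w * indicator (B k) (Y k w))"
        by (rule integrable_const_bound[of _ "(1 + \<bar>s\<bar>) ^ card K"]) 
           (use Db in \<open>auto simp: norm_mult indicator_def\<close>)
      have "(LINT w|M. complex_of_real (Z w * P (insert k K) w) * iexp (\<Sum>j\<in>J-insert k K. c j * Y j w))
        = (LINT w|M. ?D w - s * (?D w * indicator (B k) (Y k w)))"
        using insert by (intro Bochner_Integration.integral_cong) (auto simp: P_def indicator_def algebra_simps)
      also have "\<dots> = 0" using i1 i2 1 2 by (subst Bochner_Integration.integral_diff) auto
      finally show ?case .
    qed
  qed
  have "(LINT w|M. complex_of_real (Z w * P J w)) = 0" using main[of J] by simp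
  then have 0: "(LINT w|M. Z w * P J w) = 0" by (simp only: integral_complex_of_real of_real_eq_0_iff)
  have PJ[measurable]: "P J \<in> borel_measurable M" by (rule P) simp
  have i1: "integrable M (P J)" by (rule integrable_const_bound[OF _ PJ]) (use Pb in auto)
  have i2: "integrable M (\<lambda>w. indicator A (X w) * P J w)"
    by (rule integrable_const_bound[of _ "(1 + \<bar>s\<bar>) ^ card J"]) (use Pb in \<open>auto simp: indicator_def\<close>)
  have "(LINT w|M. indicator A (X w) * P J w) = (LINT w|M. Z w * P J w + a * P J w)"
    by (intro Bochner_Integration.integral_cong) (auto simp: Z_def algebra_simps)
  also have "\<dots> = a * (LINT w|M. P J w)"
  proof -
    have "integrable M (\<lambda>w. Z w * P J w)"
      using Bochner_Integration.integrable_diff[OF i2 integrable_mult_right[OF i1, of a]]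
      by (simp add: Z_def left_diff_distrib)
    then show ?thesis using i1 0 by simp
  qed
  finally show ?thesis by (simp add: P_def a_def)
qed

section \<open>Poisson approximation of void probabilities\<close>

text \<open>Let \<open>\<psi>(s)\<close> be the expectation of \<open>\<Prod>\<^sub>j (1 - s 1\<^sub>A\<^sub>j)\<close>.  Its derivative is minus the sum over
\<open>i\<close> of the expectations in the hypothesis, so \<open>\<bar>\<psi>' + \<lambda> \<psi>\<bar>\<close> is at most \<open>\<delta>\<close> times the number
of events.  The mean value theorem for \<open>\<psi>(s) exp (\<lambda> s)\<close> on \<open>[0,1]\<close> then compares the void probability
\<open>\<psi>(1)\<close> with \<open>exp (- \<lambda>)\<close>.\<close>

lemma void_probability_poisson:
  fixes A :: "'v \<Rightarrow> 'w set" and p \<delta> :: real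
  assumes "prob_space M" and V: "finite V"
    and A[measurable]: "\<And>j. j \<in> V \<Longrightarrow> A j \<in> sets M"
    and p: "0 \<le> p"
    and dec: "\<And>i s. i \<in> V \<Longrightarrow> 0 \<le> s \<Longrightarrow> s \<le> 1 \<Longrightarrow>
      \<bar>(LINT w|M. indicator (A i) w * (\<Prod>j\<in>V-{i}. 1 - s * indicator (A j) w)) -
        p * (LINT w|M. (\<Prod>j\<in>V. 1 - s * indicator (A j) w))\<bar> \<le> \<delta>"
  shows "\<bar>measure M (space M - (\<Union>j\<in>V. A j)) - exp (- (real (card V) * p))\<bar> \<le> card V * \<delta>"
proof -
  interpret prob_space M by fact
  define a where "a = (\<lambda>j w. indicator (A j) w :: real)"
  have a01: "a j w = 0 \<or> a j w = 1" for j w by (auto simp: a_def indicator_def)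
  have am: "a j \<in> borel_measurable M" if "j \<in> V" for j
    using A[OF that] by (simp add: a_def)
  have iT: "integrable M (\<lambda>w. \<Prod>j\<in>T. a j w)" if "T \<subseteq> V" for T
  proof (rule integrable_const_bound[of _ 1])
    show "(\<lambda>w. \<Prod>j\<in>T. a j w) \<in> borel_measurable M" using am that by (intro borel_measurable_prod) auto
    have "norm (\<Prod>j\<in>T. a j w) \<le> (\<Prod>j\<in>T. 1)" for w
      unfolding prod_norm[symmetric] by (intro prod_mono) (use a01 in \<open>auto simp: a_def indicator_def\<close>)
    then show "AE w in M. norm (\<Prod>j\<in>T. a j w) \<le> 1" by simp
  qed
  have expand: "(\<Prod>j\<in>V. 1 - s * a j w) = (\<Sum>T\<in>Pow V. (-s) ^ card T * (\<Prod>j\<in>T. a j w))" for s w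
  proof -
    have "(\<Prod>j\<in>V. 1 - s * a j w) = (\<Prod>j\<in>V. (- s * a j w) + 1)" by simp
    also have "\<dots> = (\<Sum>T\<in>Pow V. (\<Prod>j\<in>T. - s * a j w) * (\<Prod>j\<in>V-T. 1))"
      by (rule prod_add[OF V])
    also have "\<dots> = (\<Sum>T\<in>Pow V. (-s) ^ card T * (\<Prod>j\<in>T. a j w))"
      by (intro sum.cong refl) (simp only: prod.distrib prod_constant prod.neutral_const power_one mult_1_right)
    finally show ?thesis .
  qed
  define psi where "psi = (\<lambda>s. LINT w|M. (\<Prod>j\<in>V. 1 - s * a j w))"
  have psi: "psi s = (\<Sum>T\<in>Pow V. (-s) ^ card T * (LINT w|M. (\<Prod>j\<in>T. a j w)))" for s
    unfolding psi_def expand using iT by (subst Bochner_Integration.integral_sum) auto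
  define dpsi where "dpsi = (\<lambda>s. \<Sum>T\<in>Pow V. - (real (card T) * (-s) ^ (card T - 1)) * (LINT w|M. (\<Prod>j\<in>T. a j w)))"
  have der: "(psi has_real_derivative dpsi s) (at s)" for s
    unfolding psi[abs_def] dpsi_def
    by (auto intro!: derivative_eq_intros sum.cong)
  have dpsi: "dpsi s = - (\<Sum>i\<in>V. (LINT w|M. a i w * (\<Prod>j\<in>V-{i}. 1 - s * a j w)))" for s
  proof -
    have pt: "(\<Sum>T\<in>Pow V. - (real (card T) * (-s) ^ (card T - 1)) * (\<Prod>j\<in>T. a j w)) =
       (\<Sum>i\<in>V. - (a i w * (\<Prod>j\<in>V-{i}. 1 - s * a j w)))" for w
    proof (rule DERIV_unique)
      show "((\<lambda>s. \<Prod>j\<in>V. 1 - s * a j w) has_real_derivative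
        (\<Sum>T\<in>Pow V. - (real (card T) * (-s) ^ (card T - 1)) * (\<Prod>j\<in>T. a j w))) (at s)"
        unfolding expand by (auto intro!: derivative_eq_intros sum.cong)
      have "((\<lambda>s. \<Prod>j\<in>V. 1 - s * a j w) has_field_derivative
         (\<Sum>i\<in>V. (- a i w) * (\<Prod>j\<in>V-{i}. 1 - s * a j w))) (at s)"
        by (intro has_field_derivative_prod) (auto intro!: derivative_eq_intros)
      then show "((\<lambda>s. \<Prod>j\<in>V. 1 - s * a j w) has_real_derivative
         (\<Sum>i\<in>V. - (a i w * (\<Prod>j\<in>V-{i}. 1 - s * a j w)))) (at s)" by simp
    qed
    have im: "integrable M (\<lambda>w. a i w * (\<Prod>j\<in>V-{i}. 1 - s * a j w))" if i: "i \<in> V" for i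
    proof (rule integrable_const_bound[of _ "(1+\<bar>s\<bar>) ^ card (V-{i})"])
      show "(\<lambda>w. a i w * (\<Prod>j\<in>V-{i}. 1 - s * a j w)) \<in> borel_measurable M"
        using am i by (intro borel_measurable_times borel_measurable_prod borel_measurable_diff) auto
      have "norm (a i w * (\<Prod>j\<in>V-{i}. 1 - s * a j w)) \<le> 1 * (\<Prod>j\<in>V-{i}. 1 + \<bar>s\<bar>)" for w
        unfolding norm_mult prod_norm[symmetric]
        by (intro mult_mono prod_mono prod_nonneg) (use a01 in \<open>auto simp: a_def indicator_def\<close>)
      then show "AE w in M. norm (a i w * (\<Prod>j\<in>V-{i}. 1 - s * a j w)) \<le> (1+\<bar>s\<bar>) ^ card (V-{i})" by simp
    qed
    have "dpsi s = (LINT w|M. (\<Sum>T\<in>Pow V. - (real (card T) * (-s) ^ (card T - 1)) * (\<Prod>j\<in>T. a j w)))"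
      unfolding dpsi_def using iT by (subst Bochner_Integration.integral_sum) auto
    also have "\<dots> = (LINT w|M. (\<Sum>i\<in>V. - (a i w * (\<Prod>j\<in>V-{i}. 1 - s * a j w))))"
      unfolding pt ..
    also have "\<dots> = - (\<Sum>i\<in>V. (LINT w|M. a i w * (\<Prod>j\<in>V-{i}. 1 - s * a j w)))"
      using im by (subst Bochner_Integration.integral_sum) (auto simp: sum_negf)
    finally show ?thesis .
  qed
  define l where "l = real (card V) * p"
  have ode: "\<bar>dpsi s + l * psi s\<bar> \<le> card V * \<delta>" if "0 \<le> s" "s \<le> 1" for s
  proof -
    have "dpsi s + l * psi s = - (\<Sum>i\<in>V. (LINT w|M. a i w * (\<Prod>j\<in>V-{i}. 1 - s * a j w)) - p * psi s)"
      by (simp add: dpsi l_def sum_subtractf)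
    also have "\<bar>\<dots>\<bar> \<le> (\<Sum>i\<in>V. \<bar>(LINT w|M. a i w * (\<Prod>j\<in>V-{i}. 1 - s * a j w)) - p * psi s\<bar>)"
      by simp
    also have "\<dots> \<le> (\<Sum>i\<in>V. \<delta>)"
      unfolding psi_def a_def by (intro sum_mono dec that)
    finally show ?thesis by simp
  qed
  have l0: "0 \<le> card V * \<delta>" using ode[of 0] by simp
  have psi0: "psi 0 = 1" by (simp add: psi_def prob_space)
  have psi1: "psi 1 = measure M (space M - (\<Union>j\<in>V. A j))"
  proof -
    have "psi 1 = (LINT w|M. indicator (space M - (\<Union>j\<in>V. A j)) w)"
      unfolding psi_def
    proof (intro Bochner_Integration.integral_cong refl)
      fix w assume w: "w \<in> space M"
      show "(\<Prod>j\<in>V. 1 - 1 * a j w) = indicator (space M - (\<Union>j\<in>V. A j)) w"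
      proof (cases "\<exists>j\<in>V. w \<in> A j")
        case True
        then show ?thesis using V w by (auto simp: a_def indicator_def)
      next
        case False
        then show ?thesis using w by (auto simp: a_def indicator_def)
      qed
    qed
    also have "\<dots> = measure M (space M - (\<Union>j\<in>V. A j))"
      using V by (subst Bochner_Integration.integral_indicator) (auto simp: Int_absorb2)
    finally show ?thesis .
  qed
  have "\<exists>z. z > 0 \<and> z < 1 \<and> psi 1 * exp (l * 1) - psi 0 * exp (l * 0) = (1 - 0) * ((dpsi z + l * psi z) * exp (l * z))"
    by (rule MVT2) (auto intro!: derivative_eq_intros der simp: algebra_simps)
  then obtain z where z: "0 < z" "z < 1" "psi 1 * exp l - 1 = (dpsi z + l * psi z) * exp (l * z)"
    by (auto simp: psi0)
  have "l * z \<le> l" using z p by (simp add: l_def mult_left_le)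
  have "psi 1 - exp (- l) = (psi 1 * exp l - 1) * exp (- l)"
    by (simp add: left_diff_distrib mult.assoc flip: exp_add)
  then have "\<bar>psi 1 - exp (- l)\<bar> = \<bar>psi 1 * exp l - 1\<bar> * exp (- l)"
    by (simp add: abs_mult)
  also have "\<dots> \<le> (card V * \<delta> * exp l) * exp (-l)"
    unfolding z(3) abs_mult using ode[of z] z \<open>l * z \<le> l\<close> l0
    by (intro mult_right_mono mult_mono) auto
  also have "\<dots> = card V * \<delta>" by (simp add: mult.assoc flip: exp_add)
  finally show ?thesis by (simp add: psi1 l_def)
qed

section \<open>Centered Gaussian variables\<close>

lemma centered_gaussian_square_integrable_char:
  assumes "prob_space M" and X: "centered_gaussian M X"
  shows "integrable M (\<lambda>w. (X w)\<^sup>2)"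
    and "(LINT w|M. iexp (X w)) = exp (- (LINT w|M. (X w)\<^sup>2) / 2)"
    and "(LINT w|M. (X w)\<^sup>2) = \<sigma>\<^sup>2 \<Longrightarrow> 0 < \<sigma> \<Longrightarrow> distr M borel X = density lborel (normal_density 0 \<sigma>)"
proof -
  interpret prob_space M by fact
  have [measurable]: "X \<in> borel_measurable M" using X by (simp add: centered_gaussian_def)
  have "integrable M (\<lambda>w. (X w)\<^sup>2) \<and> (LINT w|M. iexp (X w)) = exp (- (LINT w|M. (X w)\<^sup>2) / 2)
     \<and> ((LINT w|M. (X w)\<^sup>2) = \<sigma>\<^sup>2 \<longrightarrow> 0 < \<sigma> \<longrightarrow> distr M borel X = density lborel (normal_density 0 \<sigma>))"
  proof (cases "distr M borel X = return borel 0")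
    case True
    have "AE x in distr M borel X. x = 0" unfolding True by (simp add: AE_return)
    then have ae: "AE w in M. X w = 0" by (subst (asm) AE_distr_iff) auto
    have "integrable M (\<lambda>w. (X w)\<^sup>2) \<longleftrightarrow> integrable M (\<lambda>w. 0::real)"
      by (rule integrable_cong_AE) (use ae in auto)
    moreover have "(LINT w|M. (X w)\<^sup>2) = (LINT w|M. 0)"
      by (rule integral_cong_AE) (use ae in auto)
    moreover have "(LINT w|M. iexp (X w)) = (LINT w|M. 1)"
      by (rule integral_cong_AE) (use ae in auto)
    ultimately show ?thesis by (simp add: prob_space)
  next
    case False
    then obtain s where s: "s > 0" and D: "distr M borel X = density lborel (normal_density 0 s)"
      using X by (auto simp: centered_gaussian_def)
    have lb: "distr M lborel f = distr M borel f" for f :: "_ \<Rightarrow> real"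
      by (rule distr_cong) auto
    have d: "distributed M lborel X (normal_density 0 s)"
      unfolding distributed_def using D lb[of X] by simp
    have "integrable lborel (\<lambda>x. normal_density 0 s x * (x - 0)^2)"
      using s by (intro integrable_normal_moment)
    then have int: "integrable M (\<lambda>w. (X w)\<^sup>2)"
      by (subst distributed_integrable[OF d, symmetric]) auto
    have v: "(LINT w|M. (X w)\<^sup>2) = s\<^sup>2"
      using normal_distributed_variance[OF s d] normal_distributed_expectation[OF s d] by simp
    have ds: "distributed M lborel (\<lambda>x. X x / s) std_normal_density"
      using d normal_standard_normal_convert[OF s, of X 0] by simp
    have "(LINT w|M. iexp (X w)) = (LINT w|M. iexp (s * (X w / s)))" using s by simp
    also have "\<dots> = (LINT x|distr M borel (\<lambda>w. X w / s). iexp (s * x))"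
      by (subst integral_distr) auto
    also have "distr M borel (\<lambda>w. X w / s) = std_normal_distribution"
      using distributed_distr_eq_density[OF ds] lb[of "\<lambda>w. X w / s"] by simp
    also have "(LINT x|std_normal_distribution. iexp (s * x)) = char std_normal_distribution s"
      by (simp add: char_def)
    also have "\<dots> = exp (- (s\<^sup>2 / 2))" unfolding char_std_normal_distribution by simp
    finally have c: "(LINT w|M. iexp (X w)) = exp (- (s\<^sup>2 / 2))" by (simp add: exp_of_real)
    have "s = \<sigma>" if "s\<^sup>2 = \<sigma>\<^sup>2" "0 < \<sigma>" using that s by (metis less_eq_real_def power2_eq_iff_nonneg)
    then show ?thesis using int v c D by auto
  qed
  then show "integrable M (\<lambda>w. (X w)\<^sup>2)" "(LINT w|M. iexp (X w)) = exp (- (LINT w|M. (X w)\<^sup>2) / 2)"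
   "(LINT w|M. (X w)\<^sup>2) = \<sigma>\<^sup>2 \<Longrightarrow> 0 < \<sigma> \<Longrightarrow> distr M borel X = density lborel (normal_density 0 \<sigma>)"
    by auto
qed

definition gaussian_tail :: "real \<Rightarrow> real \<Rightarrow> real" where
  "gaussian_tail \<sigma> u = measure (density lborel (normal_density 0 \<sigma>)) {u<..}"

text \<open>For \<open>x > u \<ge> 0\<close> we have \<open>x\<^sup>2 \<ge> u\<^sup>2 + (x - u)\<^sup>2\<close>, so the density is bounded by the
claimed factor times the density centered at \<open>u\<close>.\<close>

lemma gaussian_tail_le_exp:
  assumes s: "0 < \<sigma>" and u: "0 \<le> u"
  shows "gaussian_tail \<sigma> u \<le> exp (- u\<^sup>2 / (2 * \<sigma>\<^sup>2))"
proof -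
  have le: "normal_density 0 \<sigma> x \<le> exp (- u\<^sup>2 / (2 * \<sigma>\<^sup>2)) * normal_density u \<sigma> x" if "x > u" for x
  proof -
    have "0 \<le> u * (x - u)" using that u by simp
    then have "u\<^sup>2 + (x - u)\<^sup>2 \<le> x\<^sup>2" by (simp add: power2_eq_square algebra_simps)
    then have "- (x\<^sup>2) / (2 * \<sigma>\<^sup>2) \<le> - u\<^sup>2 / (2 * \<sigma>\<^sup>2) + - (x - u)\<^sup>2 / (2 * \<sigma>\<^sup>2)"
      unfolding add_divide_distrib[symmetric] by (intro divide_right_mono) auto
    then have "exp (- (x\<^sup>2) / (2 * \<sigma>\<^sup>2)) \<le> exp (- u\<^sup>2 / (2 * \<sigma>\<^sup>2)) * exp (- (x - u)\<^sup>2 / (2 * \<sigma>\<^sup>2))"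
      by (simp flip: exp_add)
    then show ?thesis using s by (simp add: normal_density_def field_simps)
  qed
  have "emeasure (density lborel (normal_density 0 \<sigma>)) {u<..} = (\<integral>\<^sup>+x. ennreal (normal_density 0 \<sigma> x) * indicator {u<..} x \<partial>lborel)"
    by (subst emeasure_density) auto
  also have "\<dots> \<le> (\<integral>\<^sup>+x. ennreal (exp (- u\<^sup>2 / (2 * \<sigma>\<^sup>2))) * ennreal (normal_density u \<sigma> x) \<partial>lborel)"
    using le by (intro nn_integral_mono) (auto split: split_indicator simp flip: ennreal_mult' intro!: ennreal_leI)
  also have "\<dots> = ennreal (exp (- u\<^sup>2 / (2 * \<sigma>\<^sup>2))) * emeasure (density lborel (normal_density u \<sigma>)) UNIV"
    by (subst nn_integral_cmult) (auto simp: emeasure_density)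
  also have "emeasure (density lborel (normal_density u \<sigma>)) UNIV = 1"
    using prob_space.emeasure_space_1[OF prob_space_normal_density[OF s, of u]] by simp
  finally have "emeasure (density lborel (normal_density 0 \<sigma>)) {u<..} \<le> ennreal (exp (- u\<^sup>2 / (2 * \<sigma>\<^sup>2)))" by simp
  then show ?thesis unfolding gaussian_tail_def measure_def by (simp add: enn2real_leI)
qed

lemma gaussian_interval_le:
  assumes s: "0 < \<sigma>" and r: "0 \<le> r" "r \<le> u"
  shows "measure (density lborel (normal_density 0 \<sigma>)) {u - r..u + r} \<le>
     2 * r * exp (- (u - r)\<^sup>2 / (2 * \<sigma>\<^sup>2)) / (\<sigma> * sqrt (2 * pi))"
proof -
  let ?c = "exp (- (u - r)\<^sup>2 / (2 * \<sigma>\<^sup>2)) / (\<sigma> * sqrt (2 * pi))"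
  have le: "normal_density 0 \<sigma> x \<le> ?c" if "x \<in> {u - r..u + r}" for x
  proof -
    have "(u - r)\<^sup>2 \<le> x\<^sup>2" using that r by (intro power_mono) auto
    then have "- (x\<^sup>2) / (2 * \<sigma>\<^sup>2) \<le> - (u - r)\<^sup>2 / (2 * \<sigma>\<^sup>2)" by (intro divide_right_mono) auto
    then have "exp (- (x\<^sup>2) / (2 * \<sigma>\<^sup>2)) \<le> exp (- (u - r)\<^sup>2 / (2 * \<sigma>\<^sup>2))" by simp
    then show ?thesis using s by (simp add: normal_density_def real_sqrt_mult divide_right_mono mult.commute mult.left_commute)
  qed
  have c0: "0 \<le> ?c" using s by simp
  have "emeasure (density lborel (normal_density 0 \<sigma>)) {u - r..u + r} = (\<integral>\<^sup>+x. ennreal (normal_density 0 \<sigma> x) * indicator {u - r..u + r} x \<partial>lborel)"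
    by (subst emeasure_density) auto
  also have "\<dots> \<le> (\<integral>\<^sup>+x. ennreal ?c * indicator {u - r..u + r} x \<partial>lborel)"
    using le by (intro nn_integral_mono) (auto split: split_indicator intro!: ennreal_leI)
  also have "\<dots> = ennreal ?c * ennreal (2 * r)"
    using r by (subst nn_integral_cmult_indicator) auto
  also have "\<dots> = ennreal (?c * (2 * r))" using r c0 by (simp flip: ennreal_mult')
  finally have "measure (density lborel (normal_density 0 \<sigma>)) {u - r..u + r} \<le> ?c * (2 * r)"
    unfolding measure_def using c0 r s by (intro enn2real_leI) auto
  then show ?thesis by (simp add: mult_ac)
qed

lemma centered_gaussian_tail_le:
  assumes M: "prob_space M" and X: "centered_gaussian M X"
    and v: "(LINT w|M. (X w)\<^sup>2) \<le> v" "0 < v" and u: "0 \<le> u"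
  shows "measure M {w\<in>space M. u < X w} \<le> exp (- u\<^sup>2 / (2 * v))"
proof -
  have [measurable]: "X \<in> borel_measurable M" using X by (simp add: centered_gaussian_def)
  have eq: "measure M {w\<in>space M. u < X w} = measure (distr M borel X) {u<..}"
    by (subst measure_distr) (auto simp: vimage_def Int_def conj_commute)
  show ?thesis
  proof (cases "distr M borel X = return borel 0")
    case True
    then show ?thesis unfolding eq using u by (simp add: measure_return)
  next
    case False
    then obtain s where s: "s > 0" and D: "distr M borel X = density lborel (normal_density 0 s)"
      using X by (auto simp: centered_gaussian_def)
    have "(LINT w|M. (X w)\<^sup>2) = (LINT x|distr M borel X. x\<^sup>2)"
      by (subst integral_distr) auto
    also have "\<dots> = (LINT x|lborel. normal_density 0 s x * x\<^sup>2)"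
      unfolding D by (subst integral_density) auto
    also have "\<dots> = s\<^sup>2" using integral_normal_moment_even[OF s, of 0 1] by (simp add: eval_nat_numeral)
    finally have sv: "s\<^sup>2 \<le> v" using v by simp
    have "measure M {w\<in>space M. u < X w} \<le> exp (- u\<^sup>2 / (2 * s\<^sup>2))"
      unfolding eq D using gaussian_tail_le_exp[OF s u] by (simp add: gaussian_tail_def)
    also have "u\<^sup>2 / (2 * v) \<le> u\<^sup>2 / (2 * s\<^sup>2)"
      using sv v s by (intro divide_left_mono) auto
    then have "exp (- u\<^sup>2 / (2 * s\<^sup>2)) \<le> exp (- u\<^sup>2 / (2 * v))" by simp
    finally show ?thesis .
  qed
qed

lemma centered_gaussian_field_measurable:
  assumes field: "centered_gaussian_field M V K \<Psi>" and V: "finite V" "x \<in> V"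
  shows "\<Psi> x \<in> borel_measurable M"
proof -
  have "\<forall>c. centered_gaussian M (\<lambda>w. \<Sum>y\<in>V. c y * \<Psi> y w)"
    using field by (simp add: centered_gaussian_field_def)
  from this[THEN spec, of "\<lambda>y. if y = x then 1 else 0"]
  have "centered_gaussian M (\<Psi> x)"
    using V by (simp add: if_distrib[of "\<lambda>c. c * _"] cong: if_cong)
  then show ?thesis by (simp add: centered_gaussian_def)
qed

section \<open>High levels of Gaussian vectors\<close>

text \<open>The characteristic function of a centered Gaussian variable depends on its second moment
only, and second moments of uncorrelated variables add.\<close>

lemma uncorrelated_gaussian_char_factor:
  assumes M: "prob_space M"
    and G: "\<And>t r. centered_gaussian M (\<lambda>w. t * X w + r * Y w)"
    and 0: "(LINT w|M. X w * Y w) = 0"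
  shows "(LINT w|M. iexp (t * X w + Y w)) = (LINT w|M. iexp (t * X w)) * (LINT w|M. iexp (Y w))"
proof -
  have X: "integrable M (\<lambda>w. (X w)\<^sup>2)" "integrable M (\<lambda>w. (Y w)\<^sup>2)" "integrable M (\<lambda>w. (X w + Y w)\<^sup>2)"
    using centered_gaussian_square_integrable_char(1)[OF M G[of 1 0]]
      centered_gaussian_square_integrable_char(1)[OF M G[of 0 1]]
      centered_gaussian_square_integrable_char(1)[OF M G[of 1 1]] by auto
  have XY_eq: "(\<lambda>w. X w * Y w) = (\<lambda>w. ((X w + Y w)\<^sup>2 - (X w)\<^sup>2 - (Y w)\<^sup>2) / 2)"
    by (auto simp: power2_eq_square algebra_simps)
  have XY: "integrable M (\<lambda>w. X w * Y w)" unfolding XY_eq using X by simp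
  have "(LINT w|M. (t * X w + Y w)\<^sup>2) = (LINT w|M. t\<^sup>2 * (X w)\<^sup>2 + 2 * t * (X w * Y w) + (Y w)\<^sup>2)"
    by (intro Bochner_Integration.integral_cong) (auto simp: power2_eq_square algebra_simps)
  also have "\<dots> = (LINT w|M. (t * X w)\<^sup>2) + (LINT w|M. (Y w)\<^sup>2)"
    using X XY 0 by (simp add: power_mult_distrib)
  finally have e: "(LINT w|M. (t * X w + Y w)\<^sup>2) = (LINT w|M. (t * X w)\<^sup>2) + (LINT w|M. (Y w)\<^sup>2)" .
  show ?thesis
    using centered_gaussian_square_integrable_char(2)[OF M G[of t 0]]
      centered_gaussian_square_integrable_char(2)[OF M G[of 0 1]]
      centered_gaussian_square_integrable_char(2)[OF M G[of t 1]] e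
    by (simp add: add_divide_distrib flip: exp_add of_real_mult)
qed

text \<open>Products of factors of absolute value at most \<open>1\<close> differ by at most the sum of the
differences of their factors.\<close>

lemma expectation_prod_diff_le:
  fixes W :: "'w \<Rightarrow> real" and h h' :: "'v \<Rightarrow> 'w \<Rightarrow> real"
  assumes M: "prob_space M" and J: "finite J"
    and W: "W \<in> borel_measurable M" "\<And>w. 0 \<le> W w" "\<And>w. W w \<le> 1"
    and h: "\<And>j. j \<in> J \<Longrightarrow> h j \<in> borel_measurable M" "\<And>j w. \<bar>h j w\<bar> \<le> 1"
    and h': "\<And>j. j \<in> J \<Longrightarrow> h' j \<in> borel_measurable M" "\<And>j w. \<bar>h' j w\<bar> \<le> 1"
  shows "\<bar>(LINT w|M. W w * (\<Prod>j\<in>J. h j w)) - (LINT w|M. W w * (\<Prod>j\<in>J. h' j w))\<bar>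
    \<le> (\<Sum>j\<in>J. (LINT w|M. W w * \<bar>h j w - h' j w\<bar>))"
proof -
  interpret prob_space M by fact
  have i1: "integrable M (\<lambda>w. W w * (\<Prod>j\<in>J. f j w))"
    if f: "\<And>j. j \<in> J \<Longrightarrow> f j \<in> borel_measurable M" "\<And>j w. \<bar>f j w\<bar> \<le> 1" for f :: "'v \<Rightarrow> 'w \<Rightarrow> real"
  proof (rule integrable_const_bound[of _ 1])
    show "(\<lambda>w. W w * (\<Prod>j\<in>J. f j w)) \<in> borel_measurable M"
      using W(1) f(1) by (intro borel_measurable_times borel_measurable_prod)
    have "\<bar>\<Prod>j\<in>J. f j w\<bar> \<le> 1" for w unfolding abs_prod using f(2) by (auto intro!: prod_le_1)
    then show "AE w in M. norm (W w * (\<Prod>j\<in>J. f j w)) \<le> 1"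
      using W by (auto simp: abs_mult intro!: mult_le_one)
  qed
  have i2: "integrable M (\<lambda>w. W w * \<bar>h j w - h' j w\<bar>)" if "j \<in> J" for j
  proof (rule integrable_const_bound[of _ "1 * 2"])
    show "(\<lambda>w. W w * \<bar>h j w - h' j w\<bar>) \<in> borel_measurable M" using W(1) h(1)[OF that] h'(1)[OF that] by simp
    have "\<bar>h j w - h' j w\<bar> \<le> 2" for w using h(2)[of j w] h'(2)[of j w] by linarith
    then show "AE w in M. norm (W w * \<bar>h j w - h' j w\<bar>) \<le> 1 * 2"
      unfolding norm_mult using W by (intro AE_I2 mult_mono) auto
  qed
  have "\<bar>(LINT w|M. W w * (\<Prod>j\<in>J. h j w)) - (LINT w|M. W w * (\<Prod>j\<in>J. h' j w))\<bar> =
    \<bar>LINT w|M. W w * (\<Prod>j\<in>J. h j w) - W w * (\<Prod>j\<in>J. h' j w)\<bar>"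
    using i1[OF h] i1[OF h'] by simp
  also have "\<dots> \<le> (LINT w|M. \<bar>W w * (\<Prod>j\<in>J. h j w) - W w * (\<Prod>j\<in>J. h' j w)\<bar>)"
    by (rule integral_abs_bound)
  also have "\<dots> \<le> (LINT w|M. (\<Sum>j\<in>J. W w * \<bar>h j w - h' j w\<bar>))"
  proof (rule integral_mono)
    fix w
    have "\<bar>(\<Prod>j\<in>J. h j w) - (\<Prod>j\<in>J. h' j w)\<bar> \<le> (\<Sum>j\<in>J. \<bar>h j w - h' j w\<bar>)"
      using norm_prod_diff[of J "\<lambda>j. h j w" "\<lambda>j. h' j w"] h(2) h'(2) by simp
    then show "\<bar>W w * (\<Prod>j\<in>J. h j w) - W w * (\<Prod>j\<in>J. h' j w)\<bar> \<le> (\<Sum>j\<in>J. W w * \<bar>h j w - h' j w\<bar>)"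
      using W by (simp add: abs_mult mult_left_mono flip: right_diff_distrib sum_distrib_left)
  qed (use i1[OF h] i1[OF h'] i2 in auto)
  also have "\<dots> = (\<Sum>j\<in>J. (LINT w|M. W w * \<bar>h j w - h' j w\<bar>))"
    using i2 by (subst Bochner_Integration.integral_sum) auto
  finally show ?thesis .
qed

text \<open>Poisson approximation for exceedances of \<open>u\<close>.  The set \<open>B x\<close> contains the sites that may be
strongly correlated with \<open>x\<close>.  In the error per site, the first two terms come from dropping the
factors in \<open>B x\<close>: two near sites exceed \<open>u\<close> together only if their sum, of variance at most
\<open>2 (\<sigma>\<^sup>2 + \<kappa>)\<close>, exceeds \<open>2 u\<close>.  The other two come from replacing the field at a far site by its
residual.  This shifts it by at most \<open>\<rho> L\<close> unless \<open>\<bar>\<Psi> x\<bar> > L\<close>, an event whose probability is at most \<open>l\<close>;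
and a shift by \<open>\<rho> L\<close> changes an exceedance only for values in a window around \<open>u\<close>, of probability at
most \<open>q\<close>.\<close>

lemma gaussian_void_probability:
  fixes \<Psi> :: "'v \<Rightarrow> 'w \<Rightarrow> real" and \<sigma> \<kappa> \<rho> L u p l q :: real and b :: nat
  assumes field: "centered_gaussian_field M V K \<Psi>" and V: "finite V"
    and \<sigma>: "0 < \<sigma>" and diag: "\<And>x. x \<in> V \<Longrightarrow> K x x = \<sigma>\<^sup>2"
    and B: "\<And>x. x \<in> V \<Longrightarrow> B x \<subseteq> V" "\<And>x. x \<in> V \<Longrightarrow> x \<in> B x" "\<And>x. x \<in> V \<Longrightarrow> card (B x) \<le> b"
    and near: "\<And>x y. x \<in> V \<Longrightarrow> y \<in> B x \<Longrightarrow> y \<noteq> x \<Longrightarrow> K x y \<le> \<kappa>" and \<kappa>: "0 \<le> \<kappa>"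
    and far: "\<And>x y. x \<in> V \<Longrightarrow> y \<in> V \<Longrightarrow> y \<notin> B x \<Longrightarrow> \<bar>K x y\<bar> \<le> \<rho> * \<sigma>\<^sup>2"
    and L: "0 \<le> \<rho>" "0 \<le> L" "2 * \<rho> * L \<le> u"
    and p: "p = gaussian_tail \<sigma> u"
    and l: "l = 2 * exp (- L\<^sup>2 / (2 * \<sigma>\<^sup>2))"
    and q: "q = 4 * \<rho> * L * exp (- (u - 2 * \<rho> * L)\<^sup>2 / (2 * \<sigma>\<^sup>2)) / (\<sigma> * sqrt (2 * pi))"
  shows "\<bar>measure M {w \<in> space M. \<forall>x\<in>V. \<Psi> x w \<le> u} - exp (- (real (card V) * p))\<bar> \<le>
     real (card V) * (b * exp (- u\<^sup>2 / (\<sigma>\<^sup>2 + \<kappa>)) + b * p\<^sup>2 + 4 * card V * l + 2 * card V * p * q)"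
proof -
  have M: "prob_space M" and lin: "\<And>c. centered_gaussian M (\<lambda>\<omega>. \<Sum>x\<in>V. c x * \<Psi> x \<omega>)"
    and cov: "\<And>x y. x \<in> V \<Longrightarrow> y \<in> V \<Longrightarrow> (LINT w|M. \<Psi> x w * \<Psi> y w) = K x y"
    using field by (auto simp: centered_gaussian_field_def)
  interpret prob_space M by fact
  have lin2: "centered_gaussian M (\<lambda>w. t * \<Psi> i w + r * \<Psi> j w)" if ij: "i \<in> V" "j \<in> V" for i j t r
  proof -
    have "(\<lambda>w. \<Sum>x\<in>V. ((if x = i then t else 0) + (if x = j then r else 0)) * \<Psi> x w) = (\<lambda>w. t * \<Psi> i w + r * \<Psi> j w)"
      using V ij by (simp add: distrib_right sum.distrib if_distrib[of "\<lambda>z. z * _"] cong: if_cong)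
    then show ?thesis using lin[of "\<lambda>x. (if x = i then t else 0) + (if x = j then r else 0)"] by simp
  qed
  have cg: "centered_gaussian M (\<Psi> i)" if "i \<in> V" for i using lin2[OF that that, of 1 0] by simp
  have meas: "\<Psi> i \<in> borel_measurable M" if "i \<in> V" for i
    using cg[OF that] by (simp add: centered_gaussian_def)
  have sq: "(LINT w|M. (\<Psi> i w)\<^sup>2) = \<sigma>\<^sup>2" if "i \<in> V" for i
    using cov[OF that that] diag[OF that] by (simp add: power2_eq_square)
  have sqi: "integrable M (\<lambda>w. (\<Psi> i w)\<^sup>2)" if "i \<in> V" for i
    by (rule centered_gaussian_square_integrable_char(1)[OF M cg[OF that]])
  have pri: "integrable M (\<lambda>w. \<Psi> i w * \<Psi> j w)" if "i \<in> V" "j \<in> V" for i j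
  proof -
    have "integrable M (\<lambda>w. (1 * \<Psi> i w + 1 * \<Psi> j w)\<^sup>2)"
      by (rule centered_gaussian_square_integrable_char(1)[OF M lin2[OF that]])
    moreover have eq: "(\<lambda>w. \<Psi> i w * \<Psi> j w) = (\<lambda>w. ((\<Psi> i w + \<Psi> j w)\<^sup>2 - (\<Psi> i w)\<^sup>2 - (\<Psi> j w)\<^sup>2) / 2)"
      by (auto simp: power2_eq_square algebra_simps)
    ultimately show ?thesis unfolding eq using sqi that by simp
  qed
  have law: "distr M borel (\<Psi> i) = density lborel (normal_density 0 \<sigma>)" if "i \<in> V" for i
    by (rule centered_gaussian_square_integrable_char(3)[OF M cg[OF that] sq[OF that] \<sigma>])
  have bint: "integrable M f" if "f \<in> borel_measurable M" "\<And>w. \<bar>f w\<bar> \<le> C" for f :: "'w \<Rightarrow> real" and C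
    by (rule integrable_const_bound[of _ C]) (use that in auto)
  have iset: "integrable M (indicat_real S)" if "S \<in> sets M" for S
    by (rule bint[OF borel_measurable_indicator[OF that], of 1]) (simp add: indicator_def)
  have lawE: "(LINT w|M. indicator I (\<Psi> i w)) = measure (density lborel (normal_density 0 \<sigma>)) I"
    if i: "i \<in> V" and [measurable]: "I \<in> sets borel" for i I
  proof -
    have [measurable]: "\<Psi> i \<in> borel_measurable M" using meas[OF i] .
    have "(LINT w|M. indicator I (\<Psi> i w)) = (LINT x|distr M borel (\<Psi> i). indicator I x :: real)"
      by (subst integral_distr) auto
    then show ?thesis using law[OF i] by simp
  qed
  have p01: "0 \<le> p" "p \<le> 1"
    using prob_space.prob_le_1[OF prob_space_normal_density[OF \<sigma>]] by (auto simp: p gaussian_tail_def)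
  have pE: "(LINT w|M. indicator {u<..} (\<Psi> i w)) = p" if "i \<in> V" for i
    using lawE[OF that, of "{u<..}"] by (simp add: p gaussian_tail_def)
  have u0: "0 \<le> u" using L by (meson mult_nonneg_nonneg order_trans zero_le_numeral)
  have q0: "0 \<le> q" using L \<sigma> by (simp add: q)
  have l0: "0 \<le> l" by (simp add: l)
  have lE: "(LINT w|M. indicator {x. L < \<bar>x\<bar>} (\<Psi> i w)) \<le> l" if i: "i \<in> V" for i
  proof -
    have [measurable]: "\<Psi> i \<in> borel_measurable M" using meas[OF i] .
    have 1: "measure M {w\<in>space M. L < \<Psi> i w} \<le> exp (- L\<^sup>2 / (2 * \<sigma>\<^sup>2))"
      by (rule centered_gaussian_tail_le[OF M cg[OF i]]) (use sq[OF i] \<sigma> L in auto)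
    have 2: "measure M {w\<in>space M. L < - \<Psi> i w} \<le> exp (- L\<^sup>2 / (2 * \<sigma>\<^sup>2))"
    proof (rule centered_gaussian_tail_le[OF M])
      show "centered_gaussian M (\<lambda>w. - \<Psi> i w)" using lin2[OF i i, of "-1" 0] by simp
    qed (use sq[OF i] \<sigma> L in auto)
    have "(LINT w|M. indicat_real {x. L < \<bar>x\<bar>} (\<Psi> i w)) \<le>
      (LINT w|M. indicator {w\<in>space M. L < \<Psi> i w} w + indicator {w\<in>space M. L < - \<Psi> i w} w)"
    proof (rule integral_mono)
      show "integrable M (\<lambda>w. indicator {x. L < \<bar>x\<bar>} (\<Psi> i w) :: real)"
        by (rule bint[of _ 1]) (auto simp: indicator_def)
      show "integrable M (\<lambda>w. indicat_real {w\<in>space M. L < \<Psi> i w} w + indicator {w\<in>space M. L < - \<Psi> i w} w)"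
        by (rule bint[of _ 2], measurable, auto simp: indicator_def)
    qed (auto simp: indicator_def)
    also have "\<dots> = measure M {w\<in>space M. L < \<Psi> i w} + measure M {w\<in>space M. L < - \<Psi> i w}"
      by (subst Bochner_Integration.integral_add) (simp_all add: iset)
    finally show ?thesis using 1 2 by (simp add: l)
  qed
  have qE: "(LINT w|M. indicator {u - 2 * \<rho> * L..u + 2 * \<rho> * L} (\<Psi> i w)) \<le> q" if i: "i \<in> V" for i
    using lawE[OF i, of "{u - 2 * \<rho> * L..u + 2 * \<rho> * L}"] gaussian_interval_le[OF \<sigma>, of "2*\<rho>*L" u] L
    by (simp add: q)
  have pairE: "(LINT w|M. indicator {u<..} (\<Psi> i w) * indicator {u<..} (\<Psi> j w)) \<le> exp (- u\<^sup>2 / (\<sigma>\<^sup>2 + \<kappa>))"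
    if i: "i \<in> V" and j: "j \<in> V" and k: "K i j \<le> \<kappa>" for i j
  proof -
    have [measurable]: "\<Psi> i \<in> borel_measurable M" "\<Psi> j \<in> borel_measurable M" using meas i j by auto
    have "(LINT w|M. (1 * \<Psi> i w + 1 * \<Psi> j w)\<^sup>2) = (LINT w|M. (\<Psi> i w)\<^sup>2 + (\<Psi> j w)\<^sup>2 + 2 * (\<Psi> i w * \<Psi> j w))"
      by (intro Bochner_Integration.integral_cong) (auto simp: power2_eq_square algebra_simps)
    also have "\<dots> = 2 * (\<sigma>\<^sup>2 + K i j)"
      using sqi[OF i] sqi[OF j] pri[OF i j] sq[OF i] sq[OF j] cov[OF i j] by simp
    finally have v: "(LINT w|M. (1 * \<Psi> i w + 1 * \<Psi> j w)\<^sup>2) \<le> 2 * (\<sigma>\<^sup>2 + \<kappa>)" using k by simp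
    have pos: "0 < \<sigma>\<^sup>2 + \<kappa>" using \<sigma> \<kappa> by (simp add: add_pos_nonneg)
    have "(LINT w|M. indicat_real {u<..} (\<Psi> i w) * indicator {u<..} (\<Psi> j w)) \<le>
      (LINT w|M. indicator {w\<in>space M. 2 * u < 1 * \<Psi> i w + 1 * \<Psi> j w} w)"
    proof (rule integral_mono)
      show "integrable M (\<lambda>w. indicator {u<..} (\<Psi> i w) * indicator {u<..} (\<Psi> j w) :: real)"
        by (rule bint[of _ 1]) (auto simp: indicator_def)
      show "integrable M (indicat_real {w\<in>space M. 2 * u < 1 * \<Psi> i w + 1 * \<Psi> j w})"
        by (rule iset) measurable
    qed (auto simp: indicator_def)
    also have "\<dots> = measure M {w\<in>space M. 2 * u < 1 * \<Psi> i w + 1 * \<Psi> j w}" by simp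
    also have "\<dots> \<le> exp (- (2 * u)\<^sup>2 / (2 * (2 * (\<sigma>\<^sup>2 + \<kappa>))))"
      by (rule centered_gaussian_tail_le[OF M lin2[OF i j] v]) (use pos u0 in auto)
    also have "- (2 * u)\<^sup>2 / (2 * (2 * (\<sigma>\<^sup>2 + \<kappa>))) = - u\<^sup>2 / (\<sigma>\<^sup>2 + \<kappa>)"
      using pos by (simp only: power_mult_distrib) (simp add: field_simps)
    finally show ?thesis .
  qed
  define \<delta> where "\<delta> = b * exp (- u\<^sup>2 / (\<sigma>\<^sup>2 + \<kappa>)) + b * p\<^sup>2 + 4 * card V * l + 2 * card V * p * q"
  define A where "A = (\<lambda>j. {w\<in>space M. u < \<Psi> j w})"
  have Am: "A j \<in> sets M" if "j \<in> V" for j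
    unfolding A_def using meas[OF that] by simp
  have "\<bar>measure M (space M - (\<Union>j\<in>V. A j)) - exp (- (real (card V) * p))\<bar> \<le> card V * \<delta>"
  proof (rule void_probability_poisson[OF M V Am p01(1)])
    fix i and s :: real assume i: "i \<in> V" and s: "0 \<le> s" "s \<le> 1"
    define a where "a = (\<lambda>j w. indicator {u<..} (\<Psi> j w) :: real)"
    define res where "res = (\<lambda>j w. \<Psi> j w - K i j / \<sigma>\<^sup>2 * \<Psi> i w)"
    define F where "F = V - B i"
    define h where "h = (\<lambda>j w. 1 - s * a j w)"
    define h' where "h' = (\<lambda>j w. if j \<in> F then 1 - s * indicator {u<..} (res j w) else 1)"
    have FV: "F \<subseteq> V" and fF: "finite F" using V by (auto simp: F_def)
    have mi[measurable]: "\<Psi> i \<in> borel_measurable M" using meas[OF i] .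
    have resm: "res j \<in> borel_measurable M" if "j \<in> V" for j
      unfolding res_def using meas[OF that] by simp
    have am: "a j \<in> borel_measurable M" if "j \<in> V" for j
      unfolding a_def using meas[OF that] by simp
    have hm: "h j \<in> borel_measurable M" if "j \<in> V" for j
      unfolding h_def using am[OF that] by simp
    have h'm: "h' j \<in> borel_measurable M" if "j \<in> V" for j
      unfolding h'_def using resm[OF that] by simp
    have hb: "\<bar>h j w\<bar> \<le> 1" "\<bar>h' j w\<bar> \<le> 1" for j w
      using s by (auto simp: h_def h'_def a_def indicator_def)
    have aAi: "a j w = indicator (A j) w" if "w \<in> space M" for j w
      using that by (auto simp: a_def A_def indicator_def)
    have E1: "(LINT w|M. indicator (A i) w * (\<Prod>j\<in>V-{i}. 1 - s * indicator (A j) w)) = (LINT w|M. a i w * (\<Prod>j\<in>V-{i}. h j w))"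
      by (intro Bochner_Integration.integral_cong refl) (simp add: aAi h_def)
    have E2: "(LINT w|M. (\<Prod>j\<in>V. 1 - s * indicator (A j) w)) = (LINT w|M. (\<Prod>j\<in>V. h j w))"
      by (intro Bochner_Integration.integral_cong refl) (simp add: aAi h_def)
    \<comment> \<open>All linear combinations of \<open>\<Psi> i\<close> and the residuals are Gaussian, and the residuals are
        uncorrelated with \<open>\<Psi> i\<close>.\<close>
    have fac: "(LINT w|M. iexp (t * \<Psi> i w + (\<Sum>j\<in>J. c j * res j w))) =
        (LINT w|M. iexp (t * \<Psi> i w)) * (LINT w|M. iexp (\<Sum>j\<in>J. c j * res j w))" if J: "J \<subseteq> F" for J t c
    proof (rule uncorrelated_gaussian_char_factor[OF M])
      have JV: "J \<subseteq> V" using J FV by blast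
      show "centered_gaussian M (\<lambda>w. t * \<Psi> i w + r * (\<Sum>j\<in>J. c j * res j w))" for t r
      proof -
        define m where "m = t - r * (\<Sum>j\<in>J. c j * (K i j / \<sigma>\<^sup>2))"
        have "(\<Sum>x\<in>V. ((if x = i then m else 0) + (if x \<in> J then r * c x else 0)) * \<Psi> x w) =
           t * \<Psi> i w + r * (\<Sum>j\<in>J. c j * res j w)" for w
        proof -
          have "(\<Sum>x\<in>V. ((if x = i then m else 0) + (if x \<in> J then r * c x else 0)) * \<Psi> x w) =
             (\<Sum>x\<in>V. (if x = i then m * \<Psi> x w else 0)) + (\<Sum>x\<in>V. if x \<in> J then r * c x * \<Psi> x w else 0)"
            unfolding sum.distrib[symmetric] by (intro sum.cong) (auto simp: algebra_simps)
          also have "\<dots> = m * \<Psi> i w + (\<Sum>x\<in>J. r * c x * \<Psi> x w)"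
            using V i JV by (simp add: sum.inter_restrict[symmetric] Int_absorb1)
          also have "\<dots> = t * \<Psi> i w + r * (\<Sum>j\<in>J. c j * res j w)"
            by (simp add: m_def res_def algebra_simps sum_distrib_left sum_distrib_right sum_subtractf)
          finally show ?thesis .
        qed
        then show ?thesis using lin[of "\<lambda>x. (if x = i then m else 0) + (if x \<in> J then r * c x else 0)"] by simp
      qed
      have "(LINT w|M. \<Psi> i w * (\<Sum>j\<in>J. c j * res j w)) = (LINT w|M. (\<Sum>j\<in>J. c j * (\<Psi> i w * \<Psi> j w - K i j / \<sigma>\<^sup>2 * (\<Psi> i w * \<Psi> i w))))"
        by (intro Bochner_Integration.integral_cong) (auto simp: res_def sum_distrib_left algebra_simps)
      also have "\<dots> = (\<Sum>j\<in>J. c j * (K i j - K i j / \<sigma>\<^sup>2 * K i i))"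
        using JV i by (subst Bochner_Integration.integral_sum) (auto simp: pri cov subset_iff)
      also have "\<dots> = 0" using diag[OF i] \<sigma> by simp
      finally show "(LINT w|M. \<Psi> i w * (\<Sum>j\<in>J. c j * res j w)) = 0" .
    qed
    have indep: "(LINT w|M. indicator {u<..} (\<Psi> i w) * (\<Prod>j\<in>J. 1 - r * indicator I (res j w))) =
        p * (LINT w|M. (\<Prod>j\<in>J. 1 - r * indicator I (res j w)) :: real)"
      if J: "J \<subseteq> F" and I: "I \<in> sets borel" for J r I
      unfolding pE[OF i, symmetric]
      by (rule char_factor_imp_product_factor[OF M _ _ _ fac[OF J]])
        (use J FV fF I resm finite_subset in auto)
    have prod_h': "(\<Prod>j\<in>T. h' j w) = (\<Prod>j\<in>F. 1 - s * indicator {u<..} (res j w))" if "F \<subseteq> T" "finite T" for T w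
      using that unfolding h'_def by (simp add: prod.inter_restrict[symmetric] Int_absorb1)
    have iF: "F \<subseteq> V - {i}" using B(2)[OF i] by (auto simp: F_def)
    have E3: "(LINT w|M. a i w * (\<Prod>j\<in>V-{i}. h' j w)) = p * (LINT w|M. (\<Prod>j\<in>V. h' j w))"
      using indep[of F "{u<..}" s] prod_h'[OF iF] prod_h'[OF FV V] V by (simp add: a_def)
    have diffb: "\<bar>h j w - h' j w\<bar> \<le> 2" for j w using hb[of j w] by linarith
    have dm: "(\<lambda>w. \<bar>h j w - h' j w\<bar>) \<in> borel_measurable M" if "j \<in> V" for j
      using hm[OF that] h'm[OF that] by simp
    have ai: "a i \<in> borel_measurable M" using am i .
    have ab: "0 \<le> a j w" "a j w \<le> 1" "\<bar>a j w\<bar> \<le> 1" for j w by (auto simp: a_def indicator_def)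
    have R1: "\<bar>(LINT w|M. a i w * (\<Prod>j\<in>V-{i}. h j w)) - (LINT w|M. a i w * (\<Prod>j\<in>V-{i}. h' j w))\<bar>
       \<le> (\<Sum>j\<in>V-{i}. (LINT w|M. a i w * \<bar>h j w - h' j w\<bar>))"
      by (rule expectation_prod_diff_le[OF M]) (use V ai ab hm h'm hb in auto)
    have R2: "\<bar>(LINT w|M. (\<Prod>j\<in>V. h j w)) - (LINT w|M. (\<Prod>j\<in>V. h' j w))\<bar> \<le> (\<Sum>j\<in>V. (LINT w|M. \<bar>h j w - h' j w\<bar>))"
      using expectation_prod_diff_le[OF M V, of "\<lambda>_. 1" h h'] hm h'm hb by simp
    \<comment> \<open>At a far site the factor changes only if \<open>\<Psi> i\<close> is large or the residual is close to \<open>u\<close>.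
        The second event is independent of \<open>\<Psi> i\<close>, which provides the additional factor \<open>p\<close>.\<close>
    define c where "c = (\<lambda>w. indicator {x. L < \<bar>x\<bar>} (\<Psi> i w) :: real)"
    define d where "d = (\<lambda>j w. indicator {u - \<rho> * L..u + \<rho> * L} (res j w) :: real)"
    have cb: "\<bar>c w\<bar> \<le> 1" and db: "\<bar>d j w\<bar> \<le> 1" and adb: "\<bar>a i w * d j w\<bar> \<le> 1"
      and aab: "\<bar>a i w * a j w\<bar> \<le> 1" for j w
      by (auto simp: a_def c_def d_def indicator_def)
    have cm[measurable]: "c \<in> borel_measurable M" unfolding c_def by measurable
    have d_m: "d j \<in> borel_measurable M" if "j \<in> V" for j
      unfolding d_def using resm[OF that] by simp
    have small: "\<bar>K i j / \<sigma>\<^sup>2 * \<Psi> i w\<bar> \<le> \<rho> * L" if j: "j \<in> F" and w: "\<bar>\<Psi> i w\<bar> \<le> L" for j w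
    proof -
      have "\<bar>K i j\<bar> \<le> \<rho> * \<sigma>\<^sup>2" using far[OF i] j by (auto simp: F_def)
      then have "\<bar>K i j / \<sigma>\<^sup>2\<bar> \<le> \<rho>" using \<sigma> by (simp add: abs_divide divide_le_eq)
      then show ?thesis unfolding abs_mult using w L by (intro mult_mono) auto
    qed
    have far1: "\<bar>h j w - h' j w\<bar> \<le> c w + d j w" if j: "j \<in> F" for j w
    proof (cases "\<bar>\<Psi> i w\<bar> \<le> L")
      case True
      define z where "z = K i j / \<sigma>\<^sup>2 * \<Psi> i w"
      have "\<bar>z\<bar> \<le> \<rho> * L" "res j w = \<Psi> j w - z" using small[OF j True] by (simp_all only: z_def res_def)
      then show ?thesis using s j True
        by (auto simp: h_def h'_def a_def c_def d_def indicator_def abs_le_iff)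
    next
      case False
      then show ?thesis using s j by (auto simp: h_def h'_def a_def c_def d_def indicator_def)
    qed
    have dE: "(LINT w|M. d j w) \<le> q + l" if j: "j \<in> F" for j
    proof -
      have jV: "j \<in> V" using j FV by auto
      then have [measurable]: "d j \<in> borel_measurable M" "\<Psi> j \<in> borel_measurable M" using d_m meas by auto
      have i1: "integrable M c" by (rule bint[of _ 1]) (simp_all add: cb)
      have i2: "integrable M (\<lambda>w. indicator {u - 2 * \<rho> * L..u + 2 * \<rho> * L} (\<Psi> j w) :: real)"
        by (rule bint[of _ 1]) (auto simp: indicator_def)
      have "(LINT w|M. d j w) \<le> (LINT w|M. indicator {u - 2 * \<rho> * L..u + 2 * \<rho> * L} (\<Psi> j w) + c w)"
      proof (rule integral_mono)
        show "integrable M (d j)" by (rule bint[of _ 1]) (simp_all add: db)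
        show "integrable M (\<lambda>w. indicator {u - 2 * \<rho> * L..u + 2 * \<rho> * L} (\<Psi> j w) + c w)" using i1 i2 by simp
        fix w
        show "d j w \<le> indicator {u - 2 * \<rho> * L..u + 2 * \<rho> * L} (\<Psi> j w) + c w"
        proof (cases "\<bar>\<Psi> i w\<bar> \<le> L")
          case True
          define z where "z = K i j / \<sigma>\<^sup>2 * \<Psi> i w"
          have "\<bar>z\<bar> \<le> \<rho> * L" "res j w = \<Psi> j w - z" using small[OF j True] by (simp_all only: z_def res_def)
          then show ?thesis
            by (auto simp: c_def d_def indicator_def abs_le_iff)
        next
          case False
          then show ?thesis by (auto simp: c_def d_def indicator_def)
        qed
      qed
      also have "\<dots> \<le> q + l" using i1 i2 qE[OF jV] lE[OF i] by (simp add: c_def)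
      finally show ?thesis .
    qed
    have far2: "(LINT w|M. \<bar>h j w - h' j w\<bar>) \<le> q + 2 * l" 
      and far3: "(LINT w|M. a i w * \<bar>h j w - h' j w\<bar>) \<le> l + p * (q + l)" if j: "j \<in> F" for j
    proof -
      have jV: "j \<in> V" using j FV by auto
      then have [measurable]: "d j \<in> borel_measurable M" "h j \<in> borel_measurable M" "h' j \<in> borel_measurable M"
        "a i \<in> borel_measurable M" using ai am hm h'm d_m by auto
      have i1: "integrable M c" by (rule bint[of _ 1]) (simp_all add: cb)
      have i2: "integrable M (d j)" by (rule bint[of _ 1]) (simp_all add: db)
      have i3: "integrable M (\<lambda>w. a i w * d j w)" by (rule bint[of _ 1]) (simp_all only: adb, simp)
      have i4: "integrable M (\<lambda>w. \<bar>h j w - h' j w\<bar>)" by (rule bint[of _ 2]) (use diffb in auto)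
      have "(LINT w|M. \<bar>h j w - h' j w\<bar>) \<le> (LINT w|M. c w + d j w)"
        by (rule integral_mono) (use i1 i2 i4 far1[OF j] in auto)
      also have "\<dots> \<le> l + (q + l)" using i1 i2 lE[OF i] dE[OF j] by (simp add: c_def)
      finally show "(LINT w|M. \<bar>h j w - h' j w\<bar>) \<le> q + 2 * l" by simp
      have "(LINT w|M. a i w * \<bar>h j w - h' j w\<bar>) \<le> (LINT w|M. c w + a i w * d j w)"
      proof (rule integral_mono)
        show "integrable M (\<lambda>w. a i w * \<bar>h j w - h' j w\<bar>)" 
          by (rule bint[of _ "1*2"], simp, unfold abs_mult, intro mult_mono)
          (use ab diffb in auto)
        fix w
        have "a i w * \<bar>h j w - h' j w\<bar> \<le> a i w * (c w + d j w)"
          using far1[OF j] ab by (intro mult_left_mono) auto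
        also have "\<dots> \<le> c w + a i w * d j w"
          by (auto simp: a_def c_def d_def indicator_def)
        finally show "a i w * \<bar>h j w - h' j w\<bar> \<le> c w + a i w * d j w" .
      qed (use i1 i3 in auto)
      also have "\<dots> = (LINT w|M. c w) + (LINT w|M. a i w * d j w)" using i1 i3 by simp
      also have "(LINT w|M. a i w * d j w) = p * (LINT w|M. d j w)"
      proof -
        have ia: "integrable M (a i)" by (rule bint[of _ 1]) (use ab in auto)
        have "(LINT w|M. a i w * (1 - d j w)) = p * (LINT w|M. 1 - d j w)"
          using indep[of "{j}" "{u - \<rho> * L..u + \<rho> * L}" 1] j by (simp add: a_def d_def)
        then show ?thesis using ia i2 i3 pE[OF i] by (simp add: right_diff_distrib prob_space a_def)
      qed
      also have "(LINT w|M. c w) + p * (LINT w|M. d j w) \<le> l + p * (q + l)"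
        using lE[OF i] dE[OF j] p01 by (intro add_mono mult_left_mono) (auto simp: c_def)
      finally show "(LINT w|M. a i w * \<bar>h j w - h' j w\<bar>) \<le> l + p * (q + l)" .
    qed
    \<comment> \<open>At a near site the factor is dropped, which matters only if \<open>\<Psi> j\<close> exceeds \<open>u\<close>.\<close>
    have near1: "\<bar>h j w - h' j w\<bar> \<le> a j w" if "j \<notin> F" for j w
      using that s by (auto simp: h_def h'_def a_def indicator_def)
    have near2: "(LINT w|M. \<bar>h j w - h' j w\<bar>) \<le> p" if j: "j \<in> B i" for j
    proof -
      have jV: "j \<in> V" and jF: "j \<notin> F" using j B(1)[OF i] by (auto simp: F_def)
      have "(LINT w|M. \<bar>h j w - h' j w\<bar>) \<le> (LINT w|M. a j w)"
        by (rule integral_mono, rule bint[of _ 2], use dm[OF jV] diffb in simp, use diffb in simp, rule bint[of _ 1])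
          (use am[OF jV] ab near1[OF jF] in auto)
      then show ?thesis using pE[OF jV] by (simp add: a_def)
    qed
    have near3: "(LINT w|M. a i w * \<bar>h j w - h' j w\<bar>) \<le> exp (- u\<^sup>2 / (\<sigma>\<^sup>2 + \<kappa>))" if j: "j \<in> B i" "j \<noteq> i" for j
    proof -
      have jV: "j \<in> V" and jF: "j \<notin> F" using j B(1)[OF i] by (auto simp: F_def)
      then have [measurable]: "a j \<in> borel_measurable M" "h j \<in> borel_measurable M" "h' j \<in> borel_measurable M"
        "a i \<in> borel_measurable M" using ai am hm h'm d_m by auto
      have "(LINT w|M. a i w * \<bar>h j w - h' j w\<bar>) \<le> (LINT w|M. a i w * a j w)"
      proof (rule integral_mono)
        show "integrable M (\<lambda>w. a i w * \<bar>h j w - h' j w\<bar>)" 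
          by (rule bint[of _ "1*2"], simp, unfold abs_mult, intro mult_mono)
          (use ab diffb in auto)
        show "integrable M (\<lambda>w. a i w * a j w)"
          by (rule bint[of _ 1]) (simp_all only: aab, simp)
      qed (use near1[OF jF] ab in \<open>auto intro: mult_left_mono\<close>)
      also have "\<dots> \<le> exp (- u\<^sup>2 / (\<sigma>\<^sup>2 + \<kappa>))" using pairE[OF i jV near[OF i j]] by (simp add: a_def)
      finally show ?thesis .
    qed
    have fB: "finite (B i)" using B(1)[OF i] V finite_subset by blast
    have VBF: "V = B i \<union> F" "B i \<inter> F = {}" using B(1)[OF i] by (auto simp: F_def)
    have cF: "card F \<le> card V" by (rule card_mono[OF V FV])
    define e where "e = exp (- u\<^sup>2 / (\<sigma>\<^sup>2 + \<kappa>))"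
    have S1: "(\<Sum>j\<in>V-{i}. (LINT w|M. a i w * \<bar>h j w - h' j w\<bar>)) \<le> b * e + card V * (l + p * (q + l))"
    proof -
      have Vi: "V - {i} = (B i - {i}) \<union> F" using VBF iF by auto
      have "(\<Sum>j\<in>V-{i}. (LINT w|M. a i w * \<bar>h j w - h' j w\<bar>)) =
         (\<Sum>j\<in>B i-{i}. (LINT w|M. a i w * \<bar>h j w - h' j w\<bar>)) + (\<Sum>j\<in>F. (LINT w|M. a i w * \<bar>h j w - h' j w\<bar>))"
        unfolding Vi by (rule sum.union_disjoint) (use fB fF VBF in auto)
      also have "\<dots> \<le> (\<Sum>j\<in>B i-{i}. e) + (\<Sum>j\<in>F. l + p * (q + l))"
        by (intro add_mono sum_mono) (use near3 far3 in \<open>auto simp: e_def\<close>)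
      also have "\<dots> = card (B i - {i}) * e + card F * (l + p * (q + l))" by simp
      also have "\<dots> \<le> b * e + card V * (l + p * (q + l))"
        using card_mono[OF fB, of "B i - {i}"] B(3)[OF i] cF l0 q0 p01
        by (intro add_mono mult_right_mono) (auto simp: e_def)
      finally show ?thesis .
    qed
    have S2: "(\<Sum>j\<in>V. (LINT w|M. \<bar>h j w - h' j w\<bar>)) \<le> b * p + card V * (q + 2 * l)"
    proof -
      have "(\<Sum>j\<in>V. (LINT w|M. \<bar>h j w - h' j w\<bar>)) =
         (\<Sum>j\<in>B i. (LINT w|M. \<bar>h j w - h' j w\<bar>)) + (\<Sum>j\<in>F. (LINT w|M. \<bar>h j w - h' j w\<bar>))"
        unfolding VBF(1) by (rule sum.union_disjoint) (use fB fF VBF in auto)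
      also have "\<dots> \<le> (\<Sum>j\<in>B i. p) + (\<Sum>j\<in>F. q + 2 * l)"
        by (intro add_mono sum_mono) (use near2 far2 in auto)
      also have "\<dots> = card (B i) * p + card F * (q + 2 * l)" by simp
      also have "\<dots> \<le> b * p + card V * (q + 2 * l)"
        using B(3)[OF i] cF l0 q0 p01
        by (intro add_mono mult_right_mono) auto
      finally show ?thesis .
    qed
    have "\<bar>(LINT w|M. a i w * (\<Prod>j\<in>V-{i}. h j w)) - p * (LINT w|M. (\<Prod>j\<in>V. h j w))\<bar> \<le>
      \<bar>(LINT w|M. a i w * (\<Prod>j\<in>V-{i}. h j w)) - (LINT w|M. a i w * (\<Prod>j\<in>V-{i}. h' j w))\<bar>
      + p * \<bar>(LINT w|M. (\<Prod>j\<in>V. h j w)) - (LINT w|M. (\<Prod>j\<in>V. h' j w))\<bar>"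
    proof -
      have "\<bar>x - p * y\<bar> \<le> \<bar>x - p * z\<bar> + p * \<bar>y - z\<bar>" for x y z
      proof -
        have "x - p * y = (x - p * z) - p * (y - z)" by (simp add: algebra_simps)
        then have "\<bar>x - p * y\<bar> \<le> \<bar>x - p * z\<bar> + \<bar>p * (y - z)\<bar>" by (metis abs_triangle_ineq4)
        then show ?thesis using p01 by (simp add: abs_mult)
      qed
      then show ?thesis unfolding E3 .
    qed
    also have "\<dots> \<le> (b * e + card V * (l + p * (q + l))) + p * (b * p + card V * (q + 2 * l))"
      by (rule add_mono[OF order_trans[OF R1 S1] mult_left_mono[OF order_trans[OF R2 S2] p01(1)]])
    also have "\<dots> = b * e + b * p\<^sup>2 + card V * (l + 3 * (p * l)) + 2 * card V * p * q"
      by (simp add: power2_eq_square algebra_simps)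
    also have "\<dots> \<le> \<delta>"
    proof -
      have "p * l \<le> l" using p01 l0 by (simp add: mult_left_le_one_le)
      then have "real (card V) * (l + 3 * (p * l)) \<le> card V * (4 * l)" by (intro mult_left_mono) auto
      then show ?thesis by (simp add: \<delta>_def e_def)
    qed
    finally show "\<bar>(LINT w|M. indicator (A i) w * (\<Prod>j\<in>V-{i}. 1 - s * indicator (A j) w)) -
        p * (LINT w|M. (\<Prod>j\<in>V. 1 - s * indicator (A j) w))\<bar> \<le> \<delta>"
      unfolding E1 E2 .
  qed
  moreover have "space M - (\<Union>j\<in>V. A j) = {w \<in> space M. \<forall>x\<in>V. \<Psi> x w \<le> u}"
    by (auto simp: A_def not_less)
  ultimately show ?thesis by (simp add: \<delta>_def)
qed

section \<open>Gaussian tails at the Gumbel level\<close>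

text \<open>The function \<open>- \<sigma>\<^sup>2 f(x) / x\<close>, where \<open>f\<close> is the density, has derivative
\<open>f(x) (1 + \<sigma>\<^sup>2 / x\<^sup>2)\<close>; integrating from \<open>u\<close> to infinity gives both bounds.\<close>

lemma gaussian_tail_mills:
  assumes s: "0 < \<sigma>" and u: "0 < u"
  defines "v \<equiv> u / \<sigma>"
  defines "R \<equiv> exp (- v\<^sup>2 / 2) / (v * sqrt (2 * pi))"
  shows "gaussian_tail \<sigma> u \<le> R" "R \<le> gaussian_tail \<sigma> u * (1 + 1 / v\<^sup>2)"
proof -
  let ?nd = "normal_density 0 \<sigma>"
  let ?f = "\<lambda>x. ?nd x * (1 + \<sigma>\<^sup>2 / x\<^sup>2)" and ?F = "\<lambda>x. - \<sigma>\<^sup>2 * ?nd x / x"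
  have v: "v > 0" using s u by (simp add: v_def)
  have D: "(?F has_real_derivative ?f x) (at x)" if x: "u \<le> x" for x
  proof -
    have x0: "x \<noteq> 0" using x u by auto
    have nd: "(?nd has_real_derivative ?nd x * (- x / \<sigma>\<^sup>2)) (at x)"
      unfolding normal_density_def using s
      by (auto intro!: derivative_eq_intros simp: field_simps power2_eq_square)
    show ?thesis
      using s x0 by (auto intro!: derivative_eq_intros nd simp: field_simps power2_eq_square)
  qed
  have lim: "(?F \<longlongrightarrow> 0) at_top"
    unfolding normal_density_def using s by real_asymp
  have pos: "0 \<le> ?f x" for x by (intro mult_nonneg_nonneg) auto
  have I: "(\<integral>\<^sup>+x. ennreal (?f x) * indicator {u..} x \<partial>lborel) = ennreal (0 - ?F u)"
    by (rule nn_integral_FTC_atLeast[OF _ D pos lim]) auto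
  have Fu: "0 - ?F u = R"
    using s u by (simp add: R_def v_def normal_density_def power_divide real_sqrt_mult field_simps power2_eq_square)
  have "emeasure (density lborel ?nd) {u<..} = (\<integral>\<^sup>+x. ennreal (?nd x) * indicator {u<..} x \<partial>lborel)"
    by (subst emeasure_density) auto
  also have "\<dots> = (\<integral>\<^sup>+x. ennreal (?nd x) * indicator {u..} x \<partial>lborel)"
  proof (rule nn_integral_cong_AE)
    show "AE x in lborel. ennreal (?nd x) * indicator {u<..} x = ennreal (?nd x) * indicator {u..} x"
      using AE_lborel_singleton[of u] by eventually_elim (auto simp: indicator_def)
  qed
  finally have tail: "ennreal (gaussian_tail \<sigma> u) = (\<integral>\<^sup>+x. ennreal (?nd x) * indicator {u..} x \<partial>lborel)"
    using finite_measure.emeasure_eq_measure[OF prob_space.finite_measure[OF prob_space_normal_density[OF s, of 0]], of "{u<..}"]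
    by (simp add: gaussian_tail_def)
  have R0: "0 \<le> R" using v by (simp add: R_def)
  have t0: "0 \<le> gaussian_tail \<sigma> u" by (simp add: gaussian_tail_def)
  have "ennreal (gaussian_tail \<sigma> u) \<le> ennreal R"
    unfolding tail Fu[symmetric] I[symmetric]
    by (intro nn_integral_mono mult_right_mono ennreal_leI) (auto simp: algebra_simps)
  then show "gaussian_tail \<sigma> u \<le> R" using R0 by simp
  have "ennreal R \<le> (\<integral>\<^sup>+x. ennreal (1 + 1 / v\<^sup>2) * (ennreal (?nd x) * indicator {u..} x) \<partial>lborel)"
    unfolding Fu[symmetric] I[symmetric]
  proof (rule nn_integral_mono)
    fix x
    have "?f x \<le> (1 + 1 / v\<^sup>2) * ?nd x" if x: "u \<le> x"
    proof -
      have "u\<^sup>2 \<le> x\<^sup>2" using x u by (intro power_mono) auto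
      then have "\<sigma>\<^sup>2 / x\<^sup>2 \<le> \<sigma>\<^sup>2 / u\<^sup>2" using u x by (intro divide_left_mono mult_pos_pos) auto
      also have "\<dots> = 1 / v\<^sup>2" using s u by (simp add: v_def power_divide)
      finally show ?thesis by (subst mult.commute) (intro mult_right_mono, auto)
    qed
    moreover have "ennreal ((1 + 1 / v\<^sup>2) * ?nd x) = ennreal (1 + 1 / v\<^sup>2) * ennreal (?nd x)"
      by (rule ennreal_mult) auto
    ultimately show "ennreal (?f x) * indicator {u..} x \<le> ennreal (1 + 1 / v\<^sup>2) * (ennreal (?nd x) * indicator {u..} x)"
      using ennreal_leI[of "?f x" "(1 + 1 / v\<^sup>2) * ?nd x"] by (cases "u \<le> x") simp_all
  qed
  also have "\<dots> = ennreal (1 + 1 / v\<^sup>2) * ennreal (gaussian_tail \<sigma> u)"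
    unfolding tail by (subst nn_integral_cmult) auto
  also have "\<dots> = ennreal (gaussian_tail \<sigma> u * (1 + 1 / v\<^sup>2))"
    using t0 by (subst ennreal_mult[symmetric]) (simp_all add: mult.commute)
  finally show "R \<le> gaussian_tail \<sigma> u * (1 + 1 / v\<^sup>2)"
    using t0 by (subst (asm) ennreal_le_iff) auto
qed

text \<open>The level \<open>a\<^sub>N z + b\<^sub>N\<close> in units of \<open>sqrt g\<close>, as a function of \<open>L = ln N\<close>.\<close>

definition gumbel_level :: "real \<Rightarrow> real \<Rightarrow> real" where
  "gumbel_level z L = (let \<beta> = sqrt (2 * L) - (ln L + ln (4 * pi)) / (2 * sqrt (2 * L)) in \<beta> + z / \<beta>)"

lemma a_const_b_const_level:
  assumes "g > 0"
  shows "a_const g N * z + b_const g N = sqrt g * gumbel_level z (ln N)"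
proof -
  define \<beta> where "\<beta> = sqrt (2 * ln N) - (ln (ln N) + ln (4 * pi)) / (2 * sqrt (2 * ln N))"
  have "b_const g N = sqrt g * \<beta>" by (simp add: b_const_def \<beta>_def)
  moreover have "a_const g N = sqrt g / \<beta>"
    using assms real_div_sqrt[of g] by (simp add: a_const_def calculation divide_divide_eq_left[symmetric] del: divide_divide_eq_left)
  moreover have "gumbel_level z (ln N) = \<beta> + z / \<beta>" by (simp add: gumbel_level_def \<beta>_def Let_def)
  ultimately show ?thesis by (simp add: algebra_simps)
qed

text \<open>The logarithm of \<open>N\<close> times the leading term of the standard Gaussian tail at the level.  In
the variable \<open>x = sqrt (2 L)\<close> the level is \<open>x - (2 ln x + ln (2 \<pi>)) / (2 x) + z / x\<close> up to lower order,
so half of its square is \<open>L - ln x - ln (2 \<pi>) / 2 + z + o(1)\<close>.\<close>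

lemma gumbel_level_log_tail:
  "((\<lambda>L. L - (gumbel_level z L)\<^sup>2 / 2 - ln (gumbel_level z L) - ln (2 * pi) / 2) \<longlongrightarrow> - z) at_top"
proof -
  define c where "c = ln (2 * pi)"
  let ?b = "\<lambda>x. x - (2 * ln x + c) / (2 * x)"
  let ?v = "\<lambda>x. ?b x + z / ?b x"
  have "((\<lambda>x. x\<^sup>2 / 2 - (?v x)\<^sup>2 / 2 - ln (?v x) - c / 2) \<longlongrightarrow> - ((z * 2 - c) / 2) - c / 2) at_top"
    by real_asymp
  then have "((\<lambda>x. x\<^sup>2 / 2 - (?v x)\<^sup>2 / 2 - ln (?v x) - c / 2) \<longlongrightarrow> - z) at_top"
    by (simp add: field_simps)
  moreover have "filterlim (\<lambda>L. sqrt (2 * L)) at_top at_top" by real_asymp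
  ultimately have "((\<lambda>L. (sqrt (2 * L))\<^sup>2 / 2 - (?v (sqrt (2 * L)))\<^sup>2 / 2 - ln (?v (sqrt (2 * L))) - c / 2) \<longlongrightarrow> - z) at_top"
    by (rule filterlim_compose)
  moreover have "\<forall>\<^sub>F L in at_top. (sqrt (2 * L))\<^sup>2 / 2 - (?v (sqrt (2 * L)))\<^sup>2 / 2 - ln (?v (sqrt (2 * L))) - c / 2 =
     L - (gumbel_level z L)\<^sup>2 / 2 - ln (gumbel_level z L) - ln (2 * pi) / 2"
    using eventually_gt_at_top[of 0]
  proof eventually_elim
    case (elim L)
    have "2 * ln (sqrt (2 * L)) + c = ln L + ln (4 * pi)"
    proof -
      have "2 * ln (sqrt (2 * L)) + c = ln (2 * L) + ln (2 * pi)" using elim by (simp add: ln_sqrt c_def)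
      also have "\<dots> = ln L + ln (4 * pi)"
      proof -
        have "ln (4 :: real) = 2 * ln 2" using ln_realpow[of 2 2] by simp
        then show ?thesis using elim pi_gt_zero by (simp add: ln_mult)
      qed
      finally show ?thesis .
    qed
    then have "?v (sqrt (2 * L)) = gumbel_level z L" by (simp add: gumbel_level_def Let_def)
    then show ?case using elim by (simp add: c_def)
  qed
  ultimately show ?thesis by (rule Lim_transform_eventually)
qed

lemma gumbel_level_limits:
  shows "((\<lambda>L. (gumbel_level z L)\<^sup>2 / L) \<longlongrightarrow> 2) at_top"
    and "((\<lambda>L. gumbel_level z L / L) \<longlongrightarrow> 0) at_top"
    and "filterlim (gumbel_level z) at_top at_top"
    and "filterlim (\<lambda>L. sqrt (2 * L) - (ln L + ln (4 * pi)) / (2 * sqrt (2 * L))) at_top at_top"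
proof -
  have "((\<lambda>L. (gumbel_level z L)\<^sup>2 / L) \<longlongrightarrow> (2 powr (1 / 2))\<^sup>2) at_top"
    unfolding gumbel_level_def Let_def by real_asymp
  then show "((\<lambda>L. (gumbel_level z L)\<^sup>2 / L) \<longlongrightarrow> 2) at_top" by (simp add: powr_half_sqrt)
  show "((\<lambda>L. gumbel_level z L / L) \<longlongrightarrow> 0) at_top"
    unfolding gumbel_level_def Let_def by real_asymp
  show "filterlim (gumbel_level z) at_top at_top"
    unfolding gumbel_level_def Let_def by real_asymp
  show "filterlim (\<lambda>L. sqrt (2 * L) - (ln L + ln (4 * pi)) / (2 * sqrt (2 * L))) at_top at_top"
    by real_asymp
qed

section \<open>Maxima of weakly correlated Gaussian vectors\<close>

text \<open>Replacing the variance \<open>g\<close> by \<open>s\<close> changes the exponent by \<open>v\<^sup>2 (s - g) / (2 s)\<close>, where \<open>v\<close> is the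
level in units of \<open>sqrt g\<close>.  As \<open>v\<^sup>2 \<sim> 2 ln N\<close>, this is negligible if \<open>s - g\<close> is small compared with
\<open>1 / ln N\<close>.\<close>

lemma gaussian_tail_gumbel_level:
  fixes N s :: "nat \<Rightarrow> real" and g z :: real
  assumes g: "0 < g" and N: "filterlim N at_top sequentially"
    and s: "(\<lambda>n. (s n - g) * ln (N n)) \<longlonglongrightarrow> 0"
  defines "u \<equiv> \<lambda>n. sqrt g * gumbel_level z (ln (N n))"
  defines "w \<equiv> \<lambda>n. u n / sqrt (s n)"
  shows "(\<lambda>n. N n * (exp (- (w n)\<^sup>2 / 2) / (w n * sqrt (2 * pi)))) \<longlonglongrightarrow> exp (- z)"
    and "(\<lambda>n. N n * gaussian_tail (sqrt (s n)) (u n)) \<longlonglongrightarrow> exp (- z)"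
    and "s \<longlonglongrightarrow> g"
proof -
  define L where "L = (\<lambda>n. ln (N n))"
  define v where "v = (\<lambda>n. gumbel_level z (L n))"
  define R where "R = (\<lambda>n. exp (- (w n)\<^sup>2 / 2) / (w n * sqrt (2 * pi)))"
  have L: "filterlim L at_top sequentially" unfolding L_def by (rule filterlim_compose[OF ln_at_top N])
  have v: "filterlim v at_top sequentially" unfolding v_def by (rule filterlim_compose[OF gumbel_level_limits(3) L])
  have v2: "(\<lambda>n. (v n)\<^sup>2 / L n) \<longlonglongrightarrow> 2" unfolding v_def by (rule filterlim_compose[OF gumbel_level_limits(1) L])
  have lt: "(\<lambda>n. L n - (v n)\<^sup>2 / 2 - ln (v n) - ln (2 * pi) / 2) \<longlonglongrightarrow> - z"
    unfolding v_def by (rule filterlim_compose[OF gumbel_level_log_tail L])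
  have Lpos: "\<forall>\<^sub>F n in sequentially. 0 < L n" using L by (simp add: filterlim_at_top_dense)
  have vpos: "\<forall>\<^sub>F n in sequentially. 0 < v n" using v by (simp add: filterlim_at_top_dense)
  have Npos: "\<forall>\<^sub>F n in sequentially. 0 < N n" using N by (simp add: filterlim_at_top_dense)
  have invL: "(\<lambda>n. inverse (L n)) \<longlonglongrightarrow> 0" by (rule tendsto_inverse_0_at_top[OF L])
  have "(\<lambda>n. (s n - g) * L n * inverse (L n)) \<longlonglongrightarrow> 0"
    using tendsto_mult[OF s invL] by (simp add: L_def)
  then have "(\<lambda>n. s n - g) \<longlonglongrightarrow> 0"
  proof (rule Lim_transform_eventually)
    show "\<forall>\<^sub>F n in sequentially. (s n - g) * L n * inverse (L n) = s n - g"
      using Lpos by eventually_elim simp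
  qed
  then show sg: "s \<longlonglongrightarrow> g" by (simp add: LIM_zero_iff)
  have spos: "\<forall>\<^sub>F n in sequentially. 0 < s n" by (rule order_tendstoD(1)[OF sg g])
  have sq: "(\<lambda>n. sqrt (s n)) \<longlonglongrightarrow> sqrt g" by (intro tendsto_intros sg)
  let ?f = "\<lambda>n. exp (L n - (v n)\<^sup>2 / 2 - ln (v n) - ln (2 * pi) / 2) *
      exp ((v n)\<^sup>2 / L n * ((s n - g) * L n) / (2 * s n)) * (sqrt (s n) / sqrt g)"
  have "?f \<longlonglongrightarrow>
      exp (- z) * exp (2 * 0 / (2 * g)) * (sqrt g / sqrt g)"
    using g s by (intro tendsto_intros lt v2 sg sq) (auto simp: L_def)
  then have lim: "?f \<longlonglongrightarrow> exp (- z)"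
    using g by simp
  have R: "(\<lambda>n. N n * R n) \<longlonglongrightarrow> exp (- z)"
  proof (rule Lim_transform_eventually[OF lim])
    show "\<forall>\<^sub>F n in sequentially. ?f n = N n * R n"
      using Lpos vpos Npos spos
    proof eventually_elim
      case (elim n)
      have w: "w n = sqrt g * v n / sqrt (s n)" by (simp add: w_def u_def v_def L_def)
      have w2: "(w n)\<^sup>2 = g * (v n)\<^sup>2 / s n" using elim g by (simp add: w power_divide power_mult_distrib)
      have "(v n)\<^sup>2 / L n * ((s n - g) * L n) / (2 * s n) = (v n)\<^sup>2 / 2 - (w n)\<^sup>2 / 2"
        unfolding w2 using elim by (simp add: field_simps)
      then have "exp (L n - (v n)\<^sup>2 / 2 - ln (v n) - ln (2 * pi) / 2) * exp ((v n)\<^sup>2 / L n * ((s n - g) * L n) / (2 * s n))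
        = exp (L n + (- (w n)\<^sup>2 / 2) - ln (v n) - ln (2 * pi) / 2)"
        by (simp flip: exp_add)
      also have "\<dots> = N n * exp (- (w n)\<^sup>2 / 2) / v n / exp (ln (2 * pi) / 2)"
        using elim by (simp only: exp_diff exp_add L_def exp_ln)
      also have "exp (ln (2 * pi) / 2) = sqrt (2 * pi)"
        using pi_gt_zero by (simp add: ln_sqrt[symmetric])
      finally show ?case using elim g unfolding R_def w by (simp add: field_simps)
    qed
  qed
  then show "(\<lambda>n. N n * (exp (- (w n)\<^sup>2 / 2) / (w n * sqrt (2 * pi)))) \<longlonglongrightarrow> exp (- z)" by (simp add: R_def)
  have w_lim: "filterlim w at_top sequentially"
  proof -
    have "filterlim (\<lambda>n. sqrt g / sqrt (s n) * v n) at_top sequentially"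
      using g by (intro filterlim_tendsto_pos_mult_at_top[OF tendsto_divide[OF tendsto_const sq] _ v]) auto
    then show ?thesis by (simp add: w_def[abs_def] u_def v_def L_def)
  qed
  have "(\<lambda>n. N n * R n / (1 + (inverse (w n))\<^sup>2)) \<longlonglongrightarrow> exp (- z) / (1 + 0\<^sup>2)"
    by (intro tendsto_intros R tendsto_inverse_0_at_top[OF w_lim]) simp
  then have lower: "(\<lambda>n. N n * R n / (1 + (inverse (w n))\<^sup>2)) \<longlonglongrightarrow> exp (- z)" by simp
  show "(\<lambda>n. N n * gaussian_tail (sqrt (s n)) (u n)) \<longlonglongrightarrow> exp (- z)"
  proof (rule tendsto_sandwich[OF _ _ lower R])
    have mills: "\<forall>\<^sub>F n in sequentially. gaussian_tail (sqrt (s n)) (u n) \<le> R n \<and>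
      R n \<le> gaussian_tail (sqrt (s n)) (u n) * (1 + (inverse (w n))\<^sup>2)"
      using vpos spos
    proof eventually_elim
      case (elim n)
      have "0 < u n" using elim g by (simp add: u_def v_def L_def)
      moreover have iw: "(inverse (w n))\<^sup>2 = 1 / (w n)\<^sup>2" by (simp add: inverse_eq_divide power_divide)
      ultimately show ?case
        using gaussian_tail_mills[of "sqrt (s n)" "u n"] elim unfolding iw R_def w_def by simp
    qed
    show "\<forall>\<^sub>F n in sequentially. N n * gaussian_tail (sqrt (s n)) (u n) \<le> N n * R n"
      using mills Npos by eventually_elim simp
    show "\<forall>\<^sub>F n in sequentially. N n * R n / (1 + (inverse (w n))\<^sup>2) \<le> N n * gaussian_tail (sqrt (s n)) (u n)"
      using mills Npos
    proof eventually_elim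
      case (elim n)
      have "0 < 1 + (inverse (w n))\<^sup>2" by (simp add: add_pos_nonneg)
      moreover have "N n * R n \<le> N n * (gaussian_tail (sqrt (s n)) (u n) * (1 + (inverse (w n))\<^sup>2))"
        using elim by (intro mult_left_mono) auto
      ultimately show ?case by (subst pos_divide_le_eq) (simp_all add: mult.assoc)
    qed
  qed
qed

text \<open>With \<open>\<kappa> = s - \<delta>\<close> and truncation at \<open>L = ln N\<close>, all error terms of \<open>gaussian_void_probability\<close>
vanish.  The decisive one belongs to near pairs: each pair has joint exceedance probability about
\<open>N\<close> to the power \<open>- 2 g / (2 g - \<delta>) = - 1 - \<delta> / (2 g - \<delta>)\<close>, and there are at most
\<open>C N\<^sup>1\<^sup>+\<^sup>\<eta>\<close> of them, which explains the condition on \<open>\<eta>\<close>.\<close>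

lemma gaussian_max_gumbel:
  fixes M :: "nat \<Rightarrow> 'w measure" and \<Psi> :: "nat \<Rightarrow> 'v \<Rightarrow> 'w \<Rightarrow> real" and V :: "nat \<Rightarrow> 'v set"
  defines "N \<equiv> \<lambda>n. real (card (V n))"
  assumes \<delta>: "0 < \<delta>" "\<delta> < g" and \<eta>: "\<eta> < \<delta> / (2 * g - \<delta>)"
    and N: "filterlim N at_top sequentially"
    and field: "\<forall>\<^sub>F n in sequentially. centered_gaussian_field (M n) (V n) (K n) (\<Psi> n) \<and> finite (V n)"
    and diag: "\<forall>\<^sub>F n in sequentially. \<forall>x\<in>V n. K n x x = s n"
    and off: "\<forall>\<^sub>F n in sequentially. \<forall>x\<in>V n. \<forall>y\<in>V n. y \<noteq> x \<longrightarrow> K n x y \<le> s n - \<delta>"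
    and B: "\<forall>\<^sub>F n in sequentially. \<forall>x\<in>V n. B n x \<subseteq> V n \<and> x \<in> B n x \<and> card (B n x) \<le> b n"
    and far: "\<forall>\<^sub>F n in sequentially. \<forall>x\<in>V n. \<forall>y\<in>V n. y \<notin> B n x \<longrightarrow> \<bar>K n x y\<bar> \<le> r n"
    and s: "(\<lambda>n. (s n - g) * ln (N n)) \<longlonglongrightarrow> 0"
    and b: "\<forall>\<^sub>F n in sequentially. real (b n) \<le> C * N n powr \<eta>"
    and r: "\<And>n. 0 \<le> r n" "(\<lambda>n. r n * (ln (N n))\<^sup>2) \<longlonglongrightarrow> 0"
  shows "(\<lambda>n. measure (M n) {w \<in> space (M n). \<forall>x\<in>V n. \<Psi> n x w \<le> a_const g (N n) * z + b_const g (N n)})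
    \<longlonglongrightarrow> exp (- exp (- z))"
proof -
  have g: "0 < g" using \<delta> by simp
  define L where "L = (\<lambda>n. ln (N n))"
  define v where "v = (\<lambda>n. gumbel_level z (L n))"
  define u where "u = (\<lambda>n. sqrt g * v n)"
  define \<sigma> where "\<sigma> = (\<lambda>n. sqrt (s n))"
  define w where "w = (\<lambda>n. u n / \<sigma> n)"
  define p where "p = (\<lambda>n. gaussian_tail (\<sigma> n) (u n))"
  define \<rho> where "\<rho> = (\<lambda>n. r n / s n)"
  define l where "l = (\<lambda>n. 2 * exp (- (L n)\<^sup>2 / (2 * (\<sigma> n)\<^sup>2)))"
  define q where "q = (\<lambda>n. 4 * \<rho> n * L n * exp (- (u n - 2 * \<rho> n * L n)\<^sup>2 / (2 * (\<sigma> n)\<^sup>2)) / (\<sigma> n * sqrt (2 * pi)))"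
  have L: "filterlim L at_top sequentially" unfolding L_def by (rule filterlim_compose[OF ln_at_top N])
  have v: "filterlim v at_top sequentially" unfolding v_def by (rule filterlim_compose[OF gumbel_level_limits(3) L])
  have v2: "(\<lambda>n. (v n)\<^sup>2 / L n) \<longlonglongrightarrow> 2" unfolding v_def by (rule filterlim_compose[OF gumbel_level_limits(1) L])
  have vL: "(\<lambda>n. v n / L n) \<longlonglongrightarrow> 0" unfolding v_def by (rule filterlim_compose[OF gumbel_level_limits(2) L])
  have NR: "(\<lambda>n. N n * (exp (- (w n)\<^sup>2 / 2) / (w n * sqrt (2 * pi)))) \<longlonglongrightarrow> exp (- z)"
    and Np: "(\<lambda>n. N n * p n) \<longlonglongrightarrow> exp (- z)" and sg: "s \<longlonglongrightarrow> g"
    using gaussian_tail_gumbel_level(1,2)[OF g N s, of z] gaussian_tail_gumbel_level(3)[OF g N s] by (simp_all add: w_def p_def \<sigma>_def u_def v_def L_def)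
  have Lpos: "\<forall>\<^sub>F n in sequentially. 0 < L n" using L by (simp add: filterlim_at_top_dense)
  have vpos: "\<forall>\<^sub>F n in sequentially. 0 < v n" using v by (simp add: filterlim_at_top_dense)
  have v1: "\<forall>\<^sub>F n in sequentially. 1 / sqrt g < v n" using v by (simp add: filterlim_at_top_dense)
  have Npos: "\<forall>\<^sub>F n in sequentially. 0 < N n" using N by (simp add: filterlim_at_top_dense)
  have spos: "\<forall>\<^sub>F n in sequentially. \<delta> < s n" by (rule order_tendstoD(1)[OF sg \<delta>(2)])
  have invL: "(\<lambda>n. inverse (L n)) \<longlonglongrightarrow> 0" by (rule tendsto_inverse_0_at_top[OF L])
  have rL2: "(\<lambda>n. r n * (L n)\<^sup>2) \<longlonglongrightarrow> 0" using r(2) by (simp add: L_def)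
  have \<rho>L: "(\<lambda>n. \<rho> n * L n) \<longlonglongrightarrow> 0"
  proof (rule Lim_transform_eventually)
    show "(\<lambda>n. r n * (L n)\<^sup>2 * inverse (L n) / s n) \<longlonglongrightarrow> 0"
      using tendsto_divide[OF tendsto_mult[OF rL2 invL] sg] g by simp
    show "\<forall>\<^sub>F n in sequentially. r n * (L n)\<^sup>2 * inverse (L n) / s n = \<rho> n * L n"
      using Lpos by eventually_elim (simp add: \<rho>_def power2_eq_square)
  qed
  have \<rho>Lu: "(\<lambda>n. \<rho> n * L n * u n) \<longlonglongrightarrow> 0"
  proof (rule Lim_transform_eventually)
    show "(\<lambda>n. r n * (L n)\<^sup>2 * (v n / L n) * sqrt g / s n) \<longlonglongrightarrow> 0"
      using tendsto_divide[OF tendsto_mult[OF tendsto_mult[OF rL2 vL] tendsto_const[of "sqrt g"]] sg] g by simp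
    show "\<forall>\<^sub>F n in sequentially. r n * (L n)\<^sup>2 * (v n / L n) * sqrt g / s n = \<rho> n * L n * u n"
      using Lpos by eventually_elim (simp add: \<rho>_def u_def power2_eq_square)
  qed
  \<comment> \<open>The exponent \<open>1 + \<eta> - 2 g / (2 g - \<delta>)\<close> of \<open>N\<close> is negative by the choice of \<open>\<eta>\<close>.\<close>
  let ?e = "\<lambda>n. 1 + \<eta> - g * ((v n)\<^sup>2 / L n) / (2 * s n - \<delta>)" and ?E = "\<lambda>n. exp (- (u n)\<^sup>2 / ((\<sigma> n)\<^sup>2 + (s n - \<delta>)))"
  have T1: "(\<lambda>n. N n * (b n * ?E n)) \<longlonglongrightarrow> 0"
  proof (rule tendsto_sandwich[OF _ _ tendsto_const])
    have "?e \<longlonglongrightarrow> 1 + \<eta> - g * 2 / (2 * g - \<delta>)"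
      using \<delta> by (intro tendsto_intros v2 sg) auto
    moreover have "1 + \<eta> - g * 2 / (2 * g - \<delta>) < 0"
      using \<eta> \<delta> by (simp add: field_simps)
    ultimately have "filterlim (\<lambda>n. ?e n * L n) at_bot sequentially"
      by (rule filterlim_tendsto_neg_mult_at_bot[OF _ _ L])
    then have "(\<lambda>n. exp (?e n * L n)) \<longlonglongrightarrow> 0"
      by (rule filterlim_compose[OF exp_at_bot])
    then show "(\<lambda>n. C * exp (?e n * L n)) \<longlonglongrightarrow> 0"
      by (rule tendsto_mult_right_zero)
    show "\<forall>\<^sub>F n in sequentially. N n * (b n * ?E n) \<le>
      C * exp (?e n * L n)"
      using Npos Lpos spos b
    proof eventually_elim
      case (elim n)
      have e: "- (u n)\<^sup>2 / ((\<sigma> n)\<^sup>2 + (s n - \<delta>)) = - (g * ((v n)\<^sup>2 / L n) / (2 * s n - \<delta>)) * L n"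
        using elim \<delta> g by (simp add: u_def \<sigma>_def power_mult_distrib)
      have "N n * (b n * ?E n) \<le>
         N n * (C * N n powr \<eta> * ?E n)"
        using elim by (intro mult_left_mono mult_right_mono) auto
      also have "\<dots> = C * (exp (L n) * exp (\<eta> * L n) * exp (- (g * ((v n)\<^sup>2 / L n) / (2 * s n - \<delta>)) * L n))"
        unfolding e using elim by (simp add: powr_def L_def)
      also have "\<dots> = C * exp (?e n * L n)"
        by (simp add: algebra_simps flip: exp_add)
      finally show ?case .
    qed
    show "\<forall>\<^sub>F n in sequentially. 0 \<le> N n * (b n * ?E n)"
      by (simp add: N_def)
  qed
  have \<eta>1: "\<eta> < 1"
  proof -
    have "\<delta> / (2 * g - \<delta>) < 1" using \<delta> by (subst pos_divide_less_eq) auto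
    then show ?thesis using \<eta> by simp
  qed
  have T2: "(\<lambda>n. N n * (b n * (p n)\<^sup>2)) \<longlonglongrightarrow> 0"
  proof (rule tendsto_sandwich[OF _ _ tendsto_const])
    have "(\<lambda>n. (N n * p n)\<^sup>2 * (C * N n powr (\<eta> - 1))) \<longlonglongrightarrow> (exp (- z))\<^sup>2 * (C * 0)"
      using \<eta>1 by (intro tendsto_intros Np tendsto_neg_powr N) auto
    then show "(\<lambda>n. (N n * p n)\<^sup>2 * (C * N n powr (\<eta> - 1))) \<longlonglongrightarrow> 0" by simp
    show "\<forall>\<^sub>F n in sequentially. N n * (b n * (p n)\<^sup>2) \<le> (N n * p n)\<^sup>2 * (C * N n powr (\<eta> - 1))"
      using Npos b
    proof eventually_elim
      case (elim n)
      have "N n * (b n * (p n)\<^sup>2) \<le> N n * (C * N n powr \<eta> * (p n)\<^sup>2)"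
        using elim by (intro mult_left_mono mult_right_mono) auto
      also have "\<dots> = (N n * p n)\<^sup>2 * (C * N n powr (\<eta> - 1))"
        using elim by (simp add: powr_diff power2_eq_square)
      finally show ?case .
    qed
    show "\<forall>\<^sub>F n in sequentially. 0 \<le> N n * (b n * (p n)\<^sup>2)" by (simp add: N_def)
  qed
  \<comment> \<open>Truncating at \<open>L = ln N\<close> costs \<open>exp (- c (ln N)\<^sup>2)\<close>, less than any power of \<open>N\<close>.\<close>
  have T3: "(\<lambda>n. N n * (4 * N n * l n)) \<longlonglongrightarrow> 0"
  proof (rule Lim_transform_eventually)
    let ?h = "\<lambda>n. L n * ((1 / (2 * s n) - 2 * inverse (L n)) * L n)"
    have "filterlim (\<lambda>n. (1 / (2 * s n) - 2 * inverse (L n)) * L n) at_top sequentially"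
    proof (rule filterlim_tendsto_pos_mult_at_top[OF _ _ L])
      show "(\<lambda>n. 1 / (2 * s n) - 2 * inverse (L n)) \<longlonglongrightarrow> 1 / (2 * g) - 2 * 0"
        using g by (intro tendsto_intros invL sg) auto
    qed (use g in simp)
    then have "filterlim (\<lambda>n. - ?h n) at_bot sequentially"
      by (intro filterlim_uminus_at_top[THEN iffD1] filterlim_at_top_mult_at_top[OF L])
    then have "(\<lambda>n. exp (- ?h n)) \<longlonglongrightarrow> 0"
      by (rule filterlim_compose[OF exp_at_bot])
    then show "(\<lambda>n. 8 * exp (- ?h n)) \<longlonglongrightarrow> 0"
      by (rule tendsto_mult_right_zero)
    show "\<forall>\<^sub>F n in sequentially. 8 * exp (- ?h n) = N n * (4 * N n * l n)"
      using Npos spos Lpos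
    proof eventually_elim
      case (elim n)
      have eN: "exp (L n) = N n" using elim by (simp add: L_def)
      have eq: "- ?h n = L n + L n + (- (L n)\<^sup>2 / (2 * (\<sigma> n)\<^sup>2))"
        using elim \<delta> by (simp add: \<sigma>_def power2_eq_square field_simps)
      show ?case unfolding eq exp_add eN l_def by simp
    qed
  qed
  \<comment> \<open>Expanding the square in \<open>q\<close> shows that \<open>q\<close> is of order \<open>\<rho> L u / s\<close> times the tail at the
      level, and \<open>\<rho> L u\<close> tends to \<open>0\<close>.\<close>
  have T4: "(\<lambda>n. N n * (2 * N n * p n * q n)) \<longlonglongrightarrow> 0"
  proof (rule Lim_transform_eventually)
    let ?f = "\<lambda>n. 2 * (N n * p n) * ((N n * (exp (- (w n)\<^sup>2 / 2) / (w n * sqrt (2 * pi)))) * (4 * (\<rho> n * L n * u n) / s n) *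
       exp (2 * (\<rho> n * L n * u n) / s n - 2 * (\<rho> n * L n)\<^sup>2 / s n))"
    have "?f \<longlonglongrightarrow>
       2 * exp (- z) * (exp (- z) * (4 * 0 / g) * exp (2 * 0 / g - 2 * 0\<^sup>2 / g))"
      using g by (intro tendsto_intros NR Np \<rho>Lu \<rho>L sg) auto
    then show "?f \<longlonglongrightarrow> 0" by simp
    show "\<forall>\<^sub>F n in sequentially. ?f n = N n * (2 * N n * p n * q n)"
      using Npos spos vpos
    proof eventually_elim
      case (elim n)
      then have s0: "0 < s n" using \<delta> by simp
      have \<sigma>0: "0 < \<sigma> n" and \<sigma>2: "(\<sigma> n)\<^sup>2 = s n" "s n = \<sigma> n * \<sigma> n" using s0 by (simp_all add: \<sigma>_def)
      have u0: "0 < u n" using elim g by (simp add: u_def)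
      define t where "t = \<rho> n * L n"
      have "- (u n - 2 * t)\<^sup>2 / (2 * s n) = - (w n)\<^sup>2 / 2 + (2 * (t * u n) / s n - 2 * t\<^sup>2 / s n)"
        unfolding w_def power_divide \<sigma>2(1) using s0 by (simp add: power2_eq_square field_simps)
      then have "q n = 4 * t * (exp (- (w n)\<^sup>2 / 2) * exp (2 * (t * u n) / s n - 2 * t\<^sup>2 / s n)) / (\<sigma> n * sqrt (2 * pi))"
        unfolding q_def \<sigma>2(1) by (simp add: t_def mult.assoc flip: exp_add)
      moreover have "exp (- (w n)\<^sup>2 / 2) / (w n * sqrt (2 * pi)) * (4 * (t * u n) / s n) = 4 * t * exp (- (w n)\<^sup>2 / 2) / (\<sigma> n * sqrt (2 * pi))"
        unfolding w_def \<sigma>2(2) using u0 \<sigma>0 by (simp add: field_simps)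
      ultimately have "q n = exp (- (w n)\<^sup>2 / 2) / (w n * sqrt (2 * pi)) * (4 * (t * u n) / s n) *
          exp (2 * (t * u n) / s n - 2 * t\<^sup>2 / s n)"
        by (simp only: times_divide_eq_left mult.assoc)
      then show ?case unfolding t_def[symmetric] by (simp only: mult_ac)
    qed
  qed
  define \<epsilon> where "\<epsilon> = (\<lambda>n. N n * (b n * exp (- (u n)\<^sup>2 / ((\<sigma> n)\<^sup>2 + (s n - \<delta>))) + b n * (p n)\<^sup>2 + 4 * N n * l n + 2 * N n * p n * q n))"
  have "\<epsilon> \<longlonglongrightarrow> 0 + 0 + 0 + 0"
    unfolding \<epsilon>_def distrib_left by (intro tendsto_add T1 T2 T3 T4)
  then have \<epsilon>: "\<epsilon> \<longlonglongrightarrow> 0" by simp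
  let ?P = "\<lambda>n. measure (M n) {w \<in> space (M n). \<forall>x\<in>V n. \<Psi> n x w \<le> u n}"
  have small: "\<forall>\<^sub>F n in sequentially. 2 * \<rho> n * L n < 1"
    using order_tendstoD(2)[OF \<rho>L, of "1 / 2"] by (simp add: mult_ac)
  have "\<forall>\<^sub>F n in sequentially. norm (?P n - exp (- (N n * p n))) \<le> \<epsilon> n"
    using field diag off B far Lpos v1 spos small
  proof eventually_elim
    case (elim n)
    then have s0: "0 < s n" using \<delta> by simp
    have \<sigma>0: "0 < \<sigma> n" and \<sigma>2: "(\<sigma> n)\<^sup>2 = s n" using s0 by (simp_all add: \<sigma>_def)
    have "1 < u n" using elim g by (simp add: u_def field_simps)
    have "\<bar>?P n - exp (- (real (card (V n)) * p n))\<bar> \<le> real (card (V n)) *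
       (b n * exp (- (u n)\<^sup>2 / ((\<sigma> n)\<^sup>2 + (s n - \<delta>))) + b n * (p n)\<^sup>2 + 4 * card (V n) * l n + 2 * card (V n) * p n * q n)"
    proof (rule gaussian_void_probability[where K="K n" and B="B n" and \<rho>="\<rho> n" and L="L n"])
      show "0 < \<sigma> n" by (rule \<sigma>0)
      show "0 \<le> s n - \<delta>" using elim by simp
      show "\<bar>K n x y\<bar> \<le> \<rho> n * (\<sigma> n)\<^sup>2" if "x \<in> V n" "y \<in> V n" "y \<notin> B n x" for x y
        using elim that s0 by (simp add: \<rho>_def \<sigma>2)
      show "0 \<le> \<rho> n" using r(1)[of n] s0 by (simp add: \<rho>_def)
      show "2 * \<rho> n * L n \<le> u n" using elim \<open>1 < u n\<close> by linarith
      show "K n x y \<le> s n - \<delta>" if "x \<in> V n" "y \<in> B n x" "y \<noteq> x" for x y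
        using elim that by blast
    qed (use elim in \<open>auto simp: \<sigma>2 p_def l_def q_def\<close>)
    then show ?case by (simp add: \<epsilon>_def N_def)
  qed
  then have "(\<lambda>n. ?P n - exp (- (N n * p n))) \<longlonglongrightarrow> 0"
    by (rule Lim_null_comparison[OF _ \<epsilon>])
  moreover have "(\<lambda>n. exp (- (N n * p n))) \<longlonglongrightarrow> exp (- exp (- z))" by (intro tendsto_intros Np)
  ultimately have "(\<lambda>n. (?P n - exp (- (N n * p n))) + exp (- (N n * p n))) \<longlonglongrightarrow> 0 + exp (- exp (- z))"
    by (rule tendsto_add)
  then show ?thesis
    unfolding a_const_b_const_level[OF g] by (simp add: u_def v_def L_def)
qed

section \<open>The zero-average Gaussian free field\<close>

lemma cdf_gumbel: "cdf gumbel z = exp (- exp (- z))"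
proof -
  let ?F = "\<lambda>z :: real. exp (- exp (- z))"
  have "continuous (at_right a) ?F" for a by (intro continuous_intros)
  moreover have "(?F \<longlongrightarrow> 0) at_bot" by real_asymp
  ultimately show ?thesis
    unfolding cdf_def gumbel_def by (intro measure_interval_measure_Iic) auto
qed

theorem corollary2p3:
  fixes M :: "nat \<Rightarrow> 'w measure"
    and \<Psi> :: "nat \<Rightarrow> int ^ 'd \<Rightarrow> 'w \<Rightarrow> real"
  assumes "CARD('d) \<ge> 3"
    and "\<And>n. n \<ge> 2 \<Longrightarrow> zero_average_gff n (M n) (\<Psi> n)"
  shows "gumbel_domain_of_attraction M (\<lambda>n \<omega>. MAX \<alpha>\<in>torus n. \<Psi> n \<alpha> \<omega>) \<and>
    (let g = green_lattice (0 :: int ^ 'd) 0; N = (\<lambda>n. real (n ^ CARD('d))) in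
      \<forall>z. (\<lambda>n. \<P>(\<omega> in M n. (MAX \<alpha>\<in>torus n. \<Psi> n \<alpha> \<omega>) \<le> a_const g (N n) * z + b_const g (N n)))
        \<longlonglongrightarrow> exp (- exp (- z)))"
proof -
  define g where "g = green_lattice (0 :: int ^ 'd) 0"
  define N where "N = (\<lambda>n. real (n ^ CARD('d)))"
  define V where "V = (\<lambda>n. torus n :: (int ^ 'd) set)"
  define s where "s = (\<lambda>n. green_torus n (0 :: int ^ 'd) 0)"
  have g1: "1 \<le> g" unfolding g_def by (rule green_lattice_ge_1[OF assms(1)])
  obtain C where C: "C > 0" "\<And>n. n \<ge> 3 \<Longrightarrow> \<bar>s n - g\<bar> \<le> C / sqrt n"
    "\<And>n m x y. n \<ge> 3 \<Longrightarrow> 1 \<le> m \<Longrightarrow> m \<le> n \<Longrightarrow> x \<in> torus n \<Longrightarrow> (y :: int ^ 'd) \<in> torus n \<Longrightarrow>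
      y \<notin> torus_box n m x \<Longrightarrow> \<bar>green_torus n x y\<bar> \<le> C / sqrt m"
    using green_torus_estimates[OF assms(1)] unfolding s_def g_def by blast
  have cardV: "real (card (V n)) = N n" for n by (simp add: V_def N_def card_torus)
  have finV: "finite (V n)" for n unfolding V_def by (rule finite_torus)
  have neV: "n \<ge> 2 \<Longrightarrow> V n \<noteq> {}" for n by (auto simp: V_def torus_def intro!: exI[of _ 0])
  have lnN: "ln (N n) = CARD('d) * ln n" if "n > 0" for n using that by (simp add: N_def ln_realpow)
  \<comment> \<open>Half of the largest exponent that \<open>gaussian_max_gumbel\<close> admits for \<open>\<delta> = 1/2\<close>.\<close>
  define \<eta> where "\<eta> = 1 / (2 * (4 * g - 1))"
  have \<eta>: "0 < \<eta>" "\<eta> < 1" "\<eta> < (1 / 2) / (2 * g - 1 / 2)" using g1 by (auto simp: \<eta>_def field_simps)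
  define m where "m = (\<lambda>n. nat \<lceil>real n powr \<eta>\<rceil>)"
  have m: "1 \<le> m n" "m n \<le> n" "real n powr \<eta> \<le> real (m n)" "real (m n) \<le> 2 * real n powr \<eta>"
    "1 \<le> real n powr \<eta>" if n: "n \<ge> 3" for n
  proof -
    have p1: "1 \<le> real n powr \<eta>" using n \<eta> by (intro ge_one_powr_ge_zero) auto
    have p2: "real n powr \<eta> \<le> real n powr 1" using n \<eta> by (intro powr_mono) auto
    show "1 \<le> real n powr \<eta>" by (rule p1)
    show "1 \<le> m n" "real n powr \<eta> \<le> real (m n)" "real (m n) \<le> 2 * real n powr \<eta>"
      using p1 unfolding m_def by linarith+
    show "m n \<le> n" using p2 n unfolding m_def by (simp add: ceiling_le_iff)
  qed
  have lim: "(\<lambda>n. measure (M n) {w \<in> space (M n). \<forall>x\<in>V n. \<Psi> n x w \<le> a_const g (N n) * z + b_const g (N n)})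
    \<longlonglongrightarrow> exp (- exp (- z))" for z
    unfolding cardV[symmetric]
  proof (rule gaussian_max_gumbel[where K=green_torus and s=s and \<delta>="1/2" and \<eta>=\<eta> and B="\<lambda>n. torus_box n (m n)"
        and b="\<lambda>n. (2 * m n + 1) ^ CARD('d)" and r="\<lambda>n. C / sqrt (m n)" and C="5 ^ CARD('d)"])
    show "0 < (1 / 2 :: real)" "1 / 2 < g" using g1 by auto
    show "\<eta> < (1 / 2) / (2 * g - 1 / 2)" by (rule \<eta>)
    have "filterlim (\<lambda>n. real n ^ CARD('d)) at_top sequentially"
      by (intro filterlim_pow_at_top filterlim_real_sequentially) simp
    then show "filterlim (\<lambda>n. real (card (V n))) at_top sequentially"
      unfolding cardV by (simp add: N_def)
    show "\<forall>\<^sub>F n in sequentially. centered_gaussian_field (M n) (V n) (green_torus n) (\<Psi> n) \<and> finite (V n)"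
      using eventually_ge_at_top[of 2]
      by eventually_elim (use assms(2) finV in \<open>auto simp: zero_average_gff_def V_def\<close>)
    show "\<forall>\<^sub>F n in sequentially. \<forall>x\<in>V n. green_torus n x x = s n"
      using eventually_ge_at_top[of 3] by eventually_elim (simp add: V_def s_def green_torus_diag)
    show "\<forall>\<^sub>F n in sequentially. \<forall>x\<in>V n. \<forall>y\<in>V n. y \<noteq> x \<longrightarrow> green_torus n x y \<le> s n - 1 / 2"
      using eventually_ge_at_top[of 3] by eventually_elim (use green_torus_offdiag_gap in \<open>auto simp: V_def s_def\<close>)
    show "\<forall>\<^sub>F n in sequentially. \<forall>x\<in>V n. torus_box n (m n) x \<subseteq> V n \<and> x \<in> torus_box n (m n) x \<and>
        card (torus_box n (m n) x) \<le> (2 * m n + 1) ^ CARD('d)"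
      using eventually_ge_at_top[of 3]
    proof eventually_elim
      case (elim n)
      then have "0 < n" by simp
      then show ?case unfolding V_def using torus_box_subset in_torus_box card_torus_box by blast
    qed
    show "\<forall>\<^sub>F n in sequentially. \<forall>x\<in>V n. \<forall>y\<in>V n. y \<notin> torus_box n (m n) x \<longrightarrow> \<bar>green_torus n x y\<bar> \<le> C / sqrt (m n)"
      using eventually_ge_at_top[of 3] by eventually_elim (use C(3) m in \<open>auto simp: V_def\<close>)
    show "(\<lambda>n. (s n - g) * ln (real (card (V n)))) \<longlonglongrightarrow> 0"
    proof (rule Lim_null_comparison)
      show "\<forall>\<^sub>F n in sequentially. norm ((s n - g) * ln (real (card (V n)))) \<le> C / sqrt n * (CARD('d) * ln n)"
        using eventually_ge_at_top[of 3]
      proof eventually_elim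
        case (elim n)
        have "\<bar>s n - g\<bar> * \<bar>CARD('d) * ln n\<bar> \<le> C / sqrt n * (CARD('d) * ln n)"
          using C(2)[OF elim] elim by (intro mult_mono) auto
        then show ?case using elim by (simp add: cardV lnN abs_mult)
      qed
      show "(\<lambda>n. C / sqrt n * (CARD('d) * ln n)) \<longlonglongrightarrow> 0" by real_asymp
    qed
    show "\<forall>\<^sub>F n in sequentially. real ((2 * m n + 1) ^ CARD('d)) \<le> 5 ^ CARD('d) * real (card (V n)) powr \<eta>"
      using eventually_ge_at_top[of 3]
    proof eventually_elim
      case (elim n)
      have "real (2 * m n + 1) \<le> 5 * real n powr \<eta>" using m[OF elim] by simp
      then have "real (2 * m n + 1) ^ CARD('d) \<le> (5 * real n powr \<eta>) ^ CARD('d)" by (intro power_mono) auto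
      also have "\<dots> = 5 ^ CARD('d) * real (card (V n)) powr \<eta>"
        using elim by (simp add: power_mult_distrib cardV N_def powr_powr powr_realpow[symmetric] mult.commute)
      finally show ?case by simp
    qed
    show "0 \<le> C / sqrt (m n)" for n using C by simp
    show "(\<lambda>n. C / sqrt (m n) * (ln (real (card (V n))))\<^sup>2) \<longlonglongrightarrow> 0"
    proof (rule Lim_null_comparison)
      show "\<forall>\<^sub>F n in sequentially. norm (C / sqrt (m n) * (ln (real (card (V n))))\<^sup>2) \<le> C / sqrt (real n powr \<eta>) * (CARD('d) * ln n)\<^sup>2"
        using eventually_ge_at_top[of 3]
      proof eventually_elim
        case (elim n)
        have "0 < real n powr \<eta>" using elim by simp
        then have "C / sqrt (m n) \<le> C / sqrt (real n powr \<eta>)"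
          using m[OF elim] C by (intro divide_left_mono mult_pos_pos) auto
        then have "C / sqrt (m n) * (CARD('d) * ln n)\<^sup>2 \<le> C / sqrt (real n powr \<eta>) * (CARD('d) * ln n)\<^sup>2"
          by (intro mult_right_mono) auto
        then show ?case using elim C by (simp add: cardV lnN abs_mult)
      qed
      show "(\<lambda>n. C / sqrt (real n powr \<eta>) * (CARD('d) * ln n)\<^sup>2) \<longlonglongrightarrow> 0" using \<eta>(1) by real_asymp
    qed
  qed
  let ?P = "\<lambda>z n. measure (M n) {w \<in> space (M n). (MAX \<alpha>\<in>torus n. \<Psi> n \<alpha> w) \<le> a_const g (N n) * z + b_const g (N n)}"
  have max_le: "(MAX \<alpha>\<in>torus n. \<Psi> n \<alpha> w) \<le> c \<longleftrightarrow> (\<forall>x\<in>V n. \<Psi> n x w \<le> c)" if "n \<ge> 2" for n w c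
    using finV[of n] neV[OF that] by (simp add: V_def)
  have lim': "?P z
    \<longlonglongrightarrow> exp (- exp (- z))" for z
  proof (rule Lim_transform_eventually[OF lim])
    show "\<forall>\<^sub>F n in sequentially. measure (M n) {w \<in> space (M n). \<forall>x\<in>V n. \<Psi> n x w \<le> a_const g (N n) * z + b_const g (N n)} =
      ?P z n"
      using eventually_ge_at_top[of 2] by eventually_elim (simp add: max_le)
  qed
  have "gumbel_domain_of_attraction M (\<lambda>n \<omega>. MAX \<alpha>\<in>torus n. \<Psi> n \<alpha> \<omega>)"
    unfolding gumbel_domain_of_attraction_def
  proof (intro exI conjI allI)
    \<comment> \<open>For small \<open>n\<close> the normalising constant need not be positive; the limit does not see these \<open>n\<close>.\<close>
    define a where "a = (\<lambda>n. if 0 < a_const g (N n) then a_const g (N n) else 1)"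
    let ?X = "\<lambda>n \<omega>. ((MAX \<alpha>\<in>torus n. \<Psi> n \<alpha> \<omega>) - b_const g (N n)) / a n"
    show "0 < a n" for n by (simp add: a_def)
    have "\<forall>\<^sub>F n in sequentially. 0 < a_const g (N n)"
    proof -
      have Ninf: "filterlim N at_top sequentially"
        unfolding N_def of_nat_power by (intro filterlim_pow_at_top filterlim_real_sequentially) simp
      have "\<forall>\<^sub>F L in at_top. 0 < sqrt (2 * L) - (ln L + ln (4 * pi)) / (2 * sqrt (2 * L))"
        using gumbel_level_limits(4) unfolding filterlim_at_top_dense by blast
      from eventually_compose_filterlim[OF this filterlim_compose[OF ln_at_top Ninf]]
      show ?thesis
        by eventually_elim (use g1 in \<open>simp add: a_const_def b_const_def\<close>)
    qed
    then have ev: "\<forall>\<^sub>F n in sequentially. n \<ge> 2 \<and> a n = a_const g (N n)"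
      using eventually_ge_at_top[of 2] by eventually_elim (simp add: a_def)
    show "weak_conv_m (\<lambda>n. distr (M n) borel (?X n)) gumbel"
      unfolding weak_conv_m_def weak_conv_def
    proof (intro allI impI)
      fix z
      show "(\<lambda>n. cdf (distr (M n) borel (?X n)) z) \<longlonglongrightarrow> cdf gumbel z"
        unfolding cdf_gumbel
      proof (rule Lim_transform_eventually[OF lim'])
        show "\<forall>\<^sub>F n in sequentially. ?P z n =
          cdf (distr (M n) borel (?X n)) z"
          using ev
        proof eventually_elim
          case (elim n)
          then have n: "n \<ge> 2" and a: "a n = a_const g (N n)" by auto
          have apos: "0 < a n" by (simp add: a_def)
          have field: "centered_gaussian_field (M n) (V n) (green_torus n) (\<Psi> n)"
            using assms(2)[OF n] by (simp add: zero_average_gff_def V_def)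
          have meas: "\<Psi> n x \<in> borel_measurable (M n)" if "x \<in> V n" for x
            by (rule centered_gaussian_field_measurable[OF field finV that])
          have [measurable]: "(\<lambda>w. MAX \<alpha>\<in>torus n. \<Psi> n \<alpha> w) \<in> borel_measurable (M n)"
            using borel_measurable_Max[of "V n" "\<Psi> n" "M n"] finV meas by (simp add: V_def)
          have "cdf (distr (M n) borel (?X n)) z =
            measure (M n) ((?X n) -` {..z} \<inter> space (M n))"
            unfolding cdf_def by (subst measure_distr) auto
          also have "(?X n) -` {..z} \<inter> space (M n) =
            {w \<in> space (M n). (MAX \<alpha>\<in>torus n. \<Psi> n \<alpha> w) \<le> a_const g (N n) * z + b_const g (N n)}"
            using apos by (auto simp: a[symmetric] field_simps simp del: Max_le_iff)
          finally show ?case by simp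
        qed
      qed
    qed
  qed
  then show ?thesis using lim' by (simp add: Let_def g_def N_def del: of_nat_power)
qed

end
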